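(* Let $Y=(y,s)\in\mathbb{R}^{n+1}$, $r>0$, and $Q_r=Q_r(Y)\subset Q$. For every $\beta_1\in(0,1)$ there exists $\mu\in(0,1)$, depending only on $n,\nu,S,\beta_1$, such that the following holds. If $u\in C^{2,1}(\overline{Q_r})$ satisfies $-u_t+Lu\ge 0$ in $Q_r$ and $$\big|\{u>0\}\cap Q_r(Y)\big|\le\mu\,|Q_r(Y)|,$$ then $$\mathcal{M}_{r/2}(Y)\le\beta_1\,\mathcal{M}_r(Y),\qquad\text{where }\ \mathcal{M}_\rho(Y):=\sup_{Q_\rho(Y)}u_+ .$$ In addition, $\beta_1\to0^+$ as $\mu\to0^+$ (i.e. the constant $\beta_1=\beta_1(n,\nu,S,\mu)$ in the estimate can be taken to tend to $0$ as $\mu\to 0^+$).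
   Context: Notation: $B_r(y)=\{x\in\mathbb{R}^n:|x-y|<r\}$; for $Y=(y,s)$, $Q_r(Y)=B_r(y)\times(s-r^2,s)$; $u_+=\max(u,0)$; $|\cdot|$ of a set is Lebesgue measure; $C^{2,1}$: twice continuously differentiable in $x$, once in $t$. Operator: $n\ge1$, $\nu\ge1$; $Lu:=\sum_{i,j}a_{ij}D_{ij}u+\sum_ib_iD_iu$, with $a_{ij},b_i$ real measurable on an open set $Q\subset\mathbb{R}^{n+1}$ (the domain of definition), satisfying for all $X\in Q$, $\xi\in\mathbb{R}^n$: $\nu^{-1}|\xi|^2\le\sum a_{ij}(X)\xi_i\xi_j$, $\sum a_{ij}(X)^2\le\nu^2$, and $S:=\int\big[\sup_t|b(x,t)|\big]^n\,dx<\infty$, where $\sup_t$ is the essential supremum over $t$ with $(x,t)\in Q$. *)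

theory Defs
  imports "HOL-Analysis.Analysis" "HOL-Probability.Essential_Supremum"
begin

text \<open>Points of space-time are pairs (x, t) with x in \<open>real ^ 'n\<close>; the dimension is \<open>CARD('n)\<close>.\<close>

definition cylinder :: "(real ^ 'n) \<times> real \<Rightarrow> real \<Rightarrow> ((real ^ 'n) \<times> real) set" where
  "cylinder Y r = ball (fst Y) r \<times> {snd Y - r\<^sup>2 <..< snd Y}"

definition dx :: "'n \<Rightarrow> ((real ^ 'n) \<times> real \<Rightarrow> real) \<Rightarrow> (real ^ 'n) \<times> real \<Rightarrow> real" where
  "dx i u X = deriv (\<lambda>h. u (fst X + h *\<^sub>R axis i 1, snd X)) 0"

definition dt :: "((real ^ 'n) \<times> real \<Rightarrow> real) \<Rightarrow> (real ^ 'n) \<times> real \<Rightarrow> real" where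
  "dt u X = deriv (\<lambda>t. u (fst X, t)) (snd X)"

definition dx_exists :: "'n \<Rightarrow> ((real ^ 'n) \<times> real \<Rightarrow> real) \<Rightarrow> (real ^ 'n) \<times> real \<Rightarrow> bool" where
  "dx_exists i u X \<longleftrightarrow> (\<lambda>h. u (fst X + h *\<^sub>R axis i 1, snd X)) field_differentiable (at 0)"

definition dt_exists :: "((real ^ 'n) \<times> real \<Rightarrow> real) \<Rightarrow> (real ^ 'n) \<times> real \<Rightarrow> bool" where
  "dt_exists u X \<longleftrightarrow> (\<lambda>t. u (fst X, t)) field_differentiable (at (snd X))"

definition extends_continuously ::
  "'a::topological_space set \<Rightarrow> ('a \<Rightarrow> real) \<Rightarrow> bool" where
  "extends_continuously U f \<longleftrightarrow>
     (\<exists>g. continuous_on (closure U) g \<and> (\<forall>X\<in>U. g X = f X))"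

text \<open>The class \<open>C\<^sup>2\<^sup>,\<^sup>1\<close> on the closure of an open set U: the derivatives are taken in U
  and extend continuously to the closure.\<close>

definition C21_closure ::
  "((real ^ 'n) \<times> real) set \<Rightarrow> ((real ^ 'n) \<times> real \<Rightarrow> real) \<Rightarrow> bool" where
  "C21_closure U u \<longleftrightarrow>
     continuous_on (closure U) u \<and>
     (\<forall>X\<in>U. dt_exists u X \<and> (\<forall>i. dx_exists i u X \<and> (\<forall>j. dx_exists i (dx j u) X))) \<and>
     extends_continuously U (dt u) \<and>
     (\<forall>i. extends_continuously U (dx i u)) \<and>
     (\<forall>i j. extends_continuously U (dx i (dx j u)))"

definition elliptic_op ::
  "((real ^ 'n) \<times> real \<Rightarrow> real ^ 'n ^ 'n) \<Rightarrow> ((real ^ 'n) \<times> real \<Rightarrow> real ^ 'n) \<Rightarrow>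
   ((real ^ 'n) \<times> real \<Rightarrow> real) \<Rightarrow> (real ^ 'n) \<times> real \<Rightarrow> real" where
  "elliptic_op a b u X =
     (\<Sum>i\<in>UNIV. \<Sum>j\<in>UNIV. a X $ i $ j * dx i (dx j u) X) + (\<Sum>i\<in>UNIV. b X $ i * dx i u X)"

text \<open>For x outside the projection of Q the time slice is empty, and the essential supremum
  over it is 0, the least element of \<open>ennreal\<close>.\<close>

definition drift_integral ::
  "((real ^ 'n) \<times> real) set \<Rightarrow> ((real ^ 'n) \<times> real \<Rightarrow> real ^ 'n) \<Rightarrow> ennreal" where
  "drift_integral Q b =
     (\<integral>\<^sup>+x. (esssup (lebesgue_on {t. (x, t) \<in> Q}) (\<lambda>t. ennreal (norm (b (x, t))))) ^ CARD('n)
        \<partial>lebesgue)"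

definition admissible_coeffs ::
  "real \<Rightarrow> real \<Rightarrow> ((real ^ 'n) \<times> real) set \<Rightarrow> ((real ^ 'n) \<times> real \<Rightarrow> real ^ 'n ^ 'n) \<Rightarrow>
   ((real ^ 'n) \<times> real \<Rightarrow> real ^ 'n) \<Rightarrow> bool" where
  "admissible_coeffs \<nu> S Q a b \<longleftrightarrow>
     (\<forall>i j. (\<lambda>X. a X $ i $ j) \<in> borel_measurable (lebesgue_on Q)) \<and>
     (\<forall>i. (\<lambda>X. b X $ i) \<in> borel_measurable (lebesgue_on Q)) \<and>
     (\<forall>X\<in>Q. \<forall>\<xi>::real ^ 'n.
        (norm \<xi>)\<^sup>2 / \<nu> \<le> (\<Sum>i\<in>UNIV. \<Sum>j\<in>UNIV. a X $ i $ j * \<xi> $ i * \<xi> $ j)) \<and>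
     (\<forall>X\<in>Q. (\<Sum>i\<in>UNIV. \<Sum>j\<in>UNIV. (a X $ i $ j)\<^sup>2) \<le> \<nu>\<^sup>2) \<and>
     drift_integral Q b = ennreal S"

definition sup_pos ::
  "((real ^ 'n) \<times> real \<Rightarrow> real) \<Rightarrow> (real ^ 'n) \<times> real \<Rightarrow> real \<Rightarrow> real" where
  "sup_pos u Y \<rho> = (SUP X\<in>cylinder Y \<rho>. max (u X) 0)"

end

theory Submission
  imports Defs
begin

text \<open>Fix a point \<open>(x0, t0)\<close> of the half cylinder and suppose that u exceeds \<open>\<beta> M1\<close> there, where M1 is
  the supremum of the positive part of u over the cylinder of size r. Subtract from u a paraboloid
  that is at least M1 on the lateral boundary and the bottom of a smaller cylinder with top centre
  \<open>(x0, t0)\<close> and size \<open>\<rho>\<close>, and that vanishes at \<open>(x0, t0)\<close>. The difference w is positive only where u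
  is, and its maximum M is at least comparable to \<open>\<beta> M1\<close>. It satisfies
  \<open>- w\<^sub>t + L w \<ge> - \<eta> - \<gamma> \<bar>b\<bar> \<bar>x - x0\<bar> / \<rho>\<close> with \<open>\<eta>\<close> of order \<open>M1 / \<rho>\<^sup>2\<close> and \<open>\<gamma>\<close> of order \<open>M1 / \<rho>\<close>.

  The core is a maximum principle of Aleksandrov-Bakelman-Pucci and Krylov type. For every slope p of
  norm at most \<open>M / (4 \<rho>)\<close> consider the height over \<open>x0\<close> of the lowest plane of slope p above w. Its
  running maximum in time, started from M/4, climbs by at least M/2, and it climbs only while the
  plane touches w at a point with gradient p, where w is positive, increases in time and has
  nonpositive Hessian. The area inequality for the gradient map at fixed time bounds the
  integral over p by the integral over x of the time increments of w times a power of the trace of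
  the Hessian. If the drift dominates the equation at the contact point, the increments are summed over time, at fixed x, to at most M, so that only the supremum of \<open>\<bar>b\<bar>\<close> over
  time enters, in the power n. If the bounded source \<open>\<eta>\<close> dominates, it bounds the increments too, and
  what remains is the measure of the set where u is positive. With the weight \<open>\<bar>p\<bar>\<^sup>-\<^sup>n\<close> over m dyadic
  annuli of slopes, the left side grows like m while the part of the drift that is proportional to the
  gradient contributes a multiple of S. This is \<open>discrete_maximum_principle\<close>. Time is discrete in it:
  then only the gradient map at each fixed time has to be differentiable, which is what the class
  \<open>C\<^sup>2\<^sup>,\<^sup>1\<close> provides, and increments of running maxima replace derivatives of monotone functions of time.

  The source \<open>\<gamma> \<bar>b\<bar> \<bar>x - x0\<bar> / \<rho>\<close> is not small merely because u is positive on a small set, since the drift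
  may concentrate there. But the weights \<open>(\<bar>x - x0\<bar> / \<rho>)\<^sup>n\<close> at the dyadic scales \<open>\<rho> = r / 2\<^sup>i\<close> have a
  bounded sum, so among K scales there is one at which the weighted drift integral is at most \<open>2 S / K\<close>
  (\<open>scale_selection\<close>). Taking m large against S, then K large against m and \<open>\<beta>\<close>, then \<open>\<mu>\<close> small against
  all of these gives a contradiction (\<open>smallness_contradiction\<close>).\<close>

section \<open>Nonnegative symmetric matrices\<close>

definition nonneg_form :: "real ^ 'n ^ 'n \<Rightarrow> bool" where
  "nonneg_form N \<longleftrightarrow> (\<forall>\<xi>. 0 \<le> \<xi> \<bullet> (N *v \<xi>))"

lemma form_eq_sum: "\<xi> \<bullet> (N *v \<eta>) = (\<Sum>i\<in>UNIV. \<Sum>j\<in>UNIV. N $ i $ j * \<xi> $ i * \<eta> $ j)"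
  for N :: "real ^ 'n ^ 'n"
  by (simp add: inner_vec_def matrix_vector_mult_def sum_distrib_left mult_ac)

lemma form_axis: "axis i 1 \<bullet> (N *v axis j 1) = N $ i $ j" for N :: "real ^ 'n ^ 'n"
  by (simp add: matrix_vector_mul_component inner_axis' inner_axis)

lemma form_axis_left: "axis i 1 \<bullet> (N *v x) = (N *v x) $ i" for N :: "real ^ 'n ^ 'n"
  by (simp add: inner_axis')

lemma symmetric_form:
  fixes N :: "real ^ 'n ^ 'n"
  assumes "transpose N = N"
  shows "x \<bullet> (N *v y) = y \<bullet> (N *v x)"
  by (metis assms dot_lmul_matrix inner_commute vector_transpose_matrix)

lemma form_diff_scaleR:
  fixes N :: "real ^ 'n ^ 'n"
  assumes "transpose N = N"
  shows "(x - s *\<^sub>R y) \<bullet> (N *v (x - s *\<^sub>R y)) =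
           x \<bullet> (N *v x) - 2 * s * (y \<bullet> (N *v x)) + s\<^sup>2 * (y \<bullet> (N *v y))"
  using symmetric_form[OF assms, of x y]
  by (simp add: matrix_vector_mult_diff_distrib matrix_vector_mult_scaleR inner_diff_left inner_diff_right
      power2_eq_square algebra_simps)

lemma nonneg_form_diagonal: "nonneg_form N \<Longrightarrow> 0 \<le> N $ i $ i"
  unfolding nonneg_form_def using form_axis[of i N i] by metis

lemma nonneg_form_entry_le:
  fixes N :: "real ^ 'n ^ 'n"
  assumes "transpose N = N" "nonneg_form N"
  shows "2 * \<bar>N $ i $ j\<bar> \<le> N $ i $ i + N $ j $ j"
proof -
  have "0 \<le> (axis i 1 - s *\<^sub>R axis j 1) \<bullet> (N *v (axis i 1 - s *\<^sub>R axis j 1))" for s :: real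
    using assms(2) by (simp add: nonneg_form_def)
  then have q: "0 \<le> N $ i $ i - 2 * s * N $ j $ i + s\<^sup>2 * N $ j $ j" for s :: real
    unfolding form_diff_scaleR[OF assms(1)] form_axis .
  have s: "N $ j $ i = N $ i $ j"
    by (metis assms(1) transpose_def vec_lambda_beta)
  show ?thesis using q[of 1] q[of "-1"] unfolding s by (simp add: abs_if)
qed

lemma nonneg_form_zero_diagonal:
  fixes N :: "real ^ 'n ^ 'n"
  assumes "transpose N = N" "nonneg_form N" "N $ i $ i = 0"
  shows "N $ i $ j = 0"
proof (rule ccontr)
  assume ne: "N $ i $ j \<noteq> 0"
  have s: "N $ j $ i = N $ i $ j"
    by (metis assms(1) transpose_def vec_lambda_beta)
  have "0 \<le> (axis j 1 - s *\<^sub>R axis i 1) \<bullet> (N *v (axis j 1 - s *\<^sub>R axis i 1))" for s :: real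
    using assms(2) by (simp add: nonneg_form_def)
  then have "0 \<le> N $ j $ j - 2 * s * N $ i $ j" for s :: real
    unfolding form_diff_scaleR[OF assms(1)] form_axis using assms(3) by simp
  from this[of "(N $ j $ j + 1) / (2 * N $ i $ j)"] ne show False
    by (simp add: field_simps)
qed

lemma nonneg_form_entry_le_trace:
  fixes N :: "real ^ 'n ^ 'n"
  assumes "transpose N = N" "nonneg_form N"
  shows "\<bar>N $ i $ j\<bar> \<le> trace N"
proof -
  have "N $ k $ k \<le> trace N" for k
    unfolding trace_def using nonneg_form_diagonal[OF assms(2)]
    by (intro member_le_sum) auto
  with nonneg_form_entry_le[OF assms, of i j] show ?thesis
    by (smt (verit))
qed

lemma trace_nonneg: "nonneg_form N \<Longrightarrow> 0 \<le> trace N"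
  unfolding trace_def by (intro sum_nonneg) (simp add: nonneg_form_diagonal)

text \<open>Bounding each entry by the trace in the Leibniz expansion loses only a dimensional factor
  against the inequality of the arithmetic and geometric means, and does without eigenvalues.\<close>

lemma det_le_trace_power:
  fixes N :: "real ^ 'n ^ 'n"
  assumes "transpose N = N" "nonneg_form N"
  shows "\<bar>det N\<bar> \<le> fact CARD('n) * trace N ^ CARD('n)"
proof -
  have "\<bar>det N\<bar> \<le> (\<Sum>p\<in>{p. p permutes (UNIV::'n set)}. \<bar>of_int (sign p) * (\<Prod>i\<in>UNIV. N $ i $ p i)\<bar>)"
    unfolding det_def by (rule sum_abs)
  also have "\<dots> \<le> (\<Sum>p\<in>{p. p permutes (UNIV::'n set)}. trace N ^ CARD('n))"
  proof (rule sum_mono)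
    fix p :: "'n \<Rightarrow> 'n"
    have "\<bar>of_int (sign p) * (\<Prod>i\<in>UNIV. N $ i $ p i)\<bar> = (\<Prod>i\<in>UNIV. \<bar>N $ i $ p i\<bar>)"
      by (simp add: abs_mult sign_def abs_prod)
    also have "\<dots> \<le> (\<Prod>i\<in>(UNIV::'n set). trace N)"
      by (intro prod_mono) (simp add: nonneg_form_entry_le_trace[OF assms])
    finally show "\<bar>of_int (sign p) * (\<Prod>i\<in>UNIV. N $ i $ p i)\<bar> \<le> trace N ^ CARD('n)" by simp
  qed
  also have "\<dots> = fact CARD('n) * trace N ^ CARD('n)"
    by (simp add: card_permutations)
  finally show ?thesis .
qed

text \<open>Schur complements: subtracting the rank-one matrix built from a row with nonzero diagonal
  entry keeps N nonnegative and clears that row, and each rank-one part contributes a value of the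
  form of A. Iterating exhausts N.\<close>

lemma nonneg_forms_contraction:
  fixes A N :: "real ^ 'n ^ 'n"
  assumes "nonneg_form A" "transpose N = N" "nonneg_form N"
  shows "0 \<le> (\<Sum>i\<in>UNIV. \<Sum>j\<in>UNIV. A $ i $ j * N $ i $ j)"
  using assms(2,3)
proof (induction "card {i. N $ i $ i \<noteq> 0}" arbitrary: N rule: less_induct)
  case less
  show ?case
  proof (cases "\<forall>i. N $ i $ i = 0")
    case True
    then have "N $ i $ j = 0" for i j
      using nonneg_form_zero_diagonal[OF less.prems] by blast
    then show ?thesis by simp
  next
    case False
    then obtain k where k: "N $ k $ k \<noteq> 0" by blast
    then have kp: "N $ k $ k > 0"
      using nonneg_form_diagonal[OF less.prems(2), of k] by simp
    have sym: "N $ i $ j = N $ j $ i" for i j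
      by (metis less.prems(1) transpose_def vec_lambda_beta)
    define v where "v = N $ k"
    define N' where "N' = (\<chi> i j. N $ i $ j - v $ i * v $ j / N $ k $ k)"
    have symN': "transpose N' = N'"
      by (simp add: transpose_def N'_def vec_eq_iff sym mult.commute)
    have form: "\<xi> \<bullet> (N' *v \<xi>) = \<xi> \<bullet> (N *v \<xi>) - (v \<bullet> \<xi>)\<^sup>2 / N $ k $ k" for \<xi>
    proof -
      have "(v \<bullet> \<xi>)\<^sup>2 = (\<Sum>i\<in>UNIV. \<Sum>j\<in>UNIV. v $ i * v $ j * \<xi> $ i * \<xi> $ j)"
        by (simp add: inner_vec_def power2_eq_square sum_product mult_ac)
      then have "(v \<bullet> \<xi>)\<^sup>2 / N $ k $ k = (\<Sum>i\<in>UNIV. \<Sum>j\<in>UNIV. v $ i * v $ j / N $ k $ k * \<xi> $ i * \<xi> $ j)"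
        by (simp add: sum_divide_distrib)
      then show ?thesis
        by (simp add: form_eq_sum N'_def sum_subtractf[symmetric] algebra_simps)
    qed
    have vk: "v \<bullet> \<xi> = axis k 1 \<bullet> (N *v \<xi>)" for \<xi>
      by (simp add: v_def form_axis_left matrix_vector_mul_component)
    have psd': "nonneg_form N'"
      unfolding nonneg_form_def
    proof
      fix \<xi> :: "real ^ 'n"
      define s where "s = (v \<bullet> \<xi>) / N $ k $ k"
      have "0 \<le> (\<xi> - s *\<^sub>R axis k 1) \<bullet> (N *v (\<xi> - s *\<^sub>R axis k 1))"
        using less.prems(2) by (simp add: nonneg_form_def)
      also have "\<dots> = \<xi> \<bullet> (N *v \<xi>) - 2 * s * (v \<bullet> \<xi>) + s\<^sup>2 * N $ k $ k"
        by (simp add: form_diff_scaleR[OF less.prems(1)] vk form_axis)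
      also have "\<dots> = \<xi> \<bullet> (N' *v \<xi>)"
        using k by (simp add: form s_def power2_eq_square field_simps)
      finally show "0 \<le> \<xi> \<bullet> (N' *v \<xi>)" .
    qed
    have sub: "{i. N' $ i $ i \<noteq> 0} \<subset> {i. N $ i $ i \<noteq> 0}"
    proof -
      have "N' $ i $ i = 0" if "N $ i $ i = 0" for i
        using nonneg_form_zero_diagonal[OF less.prems that, of k] sym[of i k] that
        by (simp add: N'_def v_def)
      moreover have "N' $ k $ k = 0" using k by (simp add: N'_def v_def)
      ultimately show ?thesis using k by blast
    qed
    have IH: "0 \<le> (\<Sum>i\<in>UNIV. \<Sum>j\<in>UNIV. A $ i $ j * N' $ i $ j)"
      by (rule less.hyps[OF _ symN' psd']) (rule psubset_card_mono[OF _ sub], simp)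
    have Av: "0 \<le> (v \<bullet> (A *v v)) / N $ k $ k"
      using assms(1) kp by (simp add: nonneg_form_def)
    have "(\<Sum>i\<in>UNIV. \<Sum>j\<in>UNIV. A $ i $ j * N $ i $ j)
        = (\<Sum>i\<in>UNIV. \<Sum>j\<in>UNIV. A $ i $ j * N' $ i $ j) + (v \<bullet> (A *v v)) / N $ k $ k"
      by (simp add: form_eq_sum N'_def sum_divide_distrib sum.distrib[symmetric] algebra_simps)
    with IH Av show ?thesis by simp
  qed
qed

text \<open>Ellipticity leaves A minus the identity over \<open>\<nu>\<close> nonnegative, so its contraction with N is too.\<close>

lemma elliptic_contraction_ge_trace:
  fixes A N :: "real ^ 'n ^ 'n"
  assumes "0 < \<nu>" "\<And>\<xi>. (norm \<xi>)\<^sup>2 / \<nu> \<le> (\<Sum>i\<in>UNIV. \<Sum>j\<in>UNIV. A $ i $ j * \<xi> $ i * \<xi> $ j)"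
    and "transpose N = N" "nonneg_form N"
  shows "trace N / \<nu> \<le> (\<Sum>i\<in>UNIV. \<Sum>j\<in>UNIV. A $ i $ j * N $ i $ j)"
proof -
  define A' where "A' = A - mat (1 / \<nu>)"
  have entry: "A' $ i $ j = A $ i $ j - (if i = j then 1 / \<nu> else 0)" for i j
    by (simp add: A'_def mat_def)
  have d: "(\<Sum>i\<in>UNIV. \<Sum>j\<in>UNIV. (if i = j then 1 / \<nu> else 0) * f i j) = (\<Sum>i\<in>UNIV. f i i) / \<nu>"
    for f :: "'n \<Rightarrow> 'n \<Rightarrow> real"
    by (simp add: if_distrib[where f="\<lambda>z. z * _"] sum.delta sum_divide_distrib cong: if_cong)
  have "nonneg_form A'"
    unfolding nonneg_form_def
  proof
    fix \<xi> :: "real ^ 'n"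
    have "\<xi> \<bullet> (A' *v \<xi>) = (\<Sum>i\<in>UNIV. \<Sum>j\<in>UNIV. A $ i $ j * \<xi> $ i * \<xi> $ j)
        - (\<Sum>i\<in>UNIV. \<Sum>j\<in>UNIV. (if i = j then 1 / \<nu> else 0) * (\<xi> $ i * \<xi> $ j))"
      unfolding form_eq_sum entry sum_subtractf[symmetric] by (simp add: left_diff_distrib mult.assoc)
    also have "(\<Sum>i\<in>UNIV. \<Sum>j\<in>UNIV. (if i = j then 1 / \<nu> else 0) * (\<xi> $ i * \<xi> $ j)) = (norm \<xi>)\<^sup>2 / \<nu>"
      unfolding d by (simp add: power2_norm_eq_inner inner_vec_def)
    finally show "0 \<le> \<xi> \<bullet> (A' *v \<xi>)" using assms(2)[of \<xi>] by simp
  qed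
  from nonneg_forms_contraction[OF this assms(3,4)]
  have "0 \<le> (\<Sum>i\<in>UNIV. \<Sum>j\<in>UNIV. A $ i $ j * N $ i $ j)
      - (\<Sum>i\<in>UNIV. \<Sum>j\<in>UNIV. (if i = j then 1 / \<nu> else 0) * N $ i $ j)"
    unfolding entry sum_subtractf[symmetric] by (simp add: left_diff_distrib)
  then show ?thesis unfolding d by (simp add: trace_def)
qed

section \<open>The area inequality for gradient maps\<close>

text \<open>A copy of a finite type that carries a well-order, as the index types of the area inequality do.\<close>

typedef 'a wo = "UNIV :: 'a set" morphisms wo_rep wo_abs by simp

lemma bij_wo_rep: "bij wo_rep"
  by (metis bijI' wo_abs_inverse wo_rep_inject UNIV_I)

instance wo :: (finite) finite
proof
  show "finite (UNIV :: 'a wo set)"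
    by (rule finite_imageD[where f=wo_rep]) (use bij_wo_rep in \<open>auto simp: bij_def\<close>)
qed

definition wo_index :: "'a::finite wo \<Rightarrow> nat" where
  "wo_index = (SOME f. inj f)"

lemma inj_wo_index: "inj (wo_index :: 'a::finite wo \<Rightarrow> nat)"
proof -
  obtain f :: "'a wo \<Rightarrow> nat" where "inj f"
    using finite_imp_inj_to_nat_seg[of "UNIV :: 'a wo set"] by auto
  then show ?thesis
    unfolding wo_index_def by (rule someI[of inj])
qed

instantiation wo :: (finite) wellorder
begin

definition less_eq_wo :: "'a wo \<Rightarrow> 'a wo \<Rightarrow> bool" where
  "less_eq_wo x y \<longleftrightarrow> wo_index x \<le> wo_index y"

definition less_wo :: "'a wo \<Rightarrow> 'a wo \<Rightarrow> bool" where
  "less_wo x y \<longleftrightarrow> wo_index x < wo_index y"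

instance
proof (intro_classes, unfold less_eq_wo_def less_wo_def)
  fix x y :: "'a wo"
  show "wo_index x \<le> wo_index y \<Longrightarrow> wo_index y \<le> wo_index x \<Longrightarrow> x = y"
    by (metis inj_wo_index injD le_antisym)
next
  fix P :: "'a wo \<Rightarrow> bool" and a
  assume "\<And>x. (\<And>y. wo_index y < wo_index x \<Longrightarrow> P y) \<Longrightarrow> P x"
  then show "P a" by (rule measure_induct_rule)
qed auto

end


lemma nn_integral_compact_eq_integral:
  fixes f :: "'a::euclidean_space \<Rightarrow> real"
  assumes "compact S" "continuous_on S f" "\<And>x. x \<in> S \<Longrightarrow> 0 \<le> f x"
  shows "f integrable_on S" "(\<integral>\<^sup>+x\<in>S. ennreal (f x) \<partial>lborel) = ennreal (integral S f)"
proof -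
  have int: "integrable lborel (\<lambda>x. indicator S x *\<^sub>R f x)"
    by (rule borel_integrable_compact[OF assms(1,2)])
  then have si: "set_integrable lborel S f"
    by (simp add: set_integrable_def)
  show "f integrable_on S"
    by (rule set_borel_integral_eq_integral(1)[OF si])
  have "(\<integral>\<^sup>+x\<in>S. ennreal (f x) \<partial>lborel) = (\<integral>\<^sup>+x. ennreal (indicator S x *\<^sub>R f x) \<partial>lborel)"
    by (intro nn_integral_cong) (auto simp: indicator_def)
  also have "\<dots> = ennreal (LINT x : S | lborel. f x)"
    unfolding set_lebesgue_integral_def using assms(3)
    by (intro nn_integral_eq_integral[OF int]) (auto simp: indicator_def)
  finally show "(\<integral>\<^sup>+x\<in>S. ennreal (f x) \<partial>lborel) = ennreal (integral S f)"
    by (simp add: set_borel_integral_eq_integral(2)[OF si])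
qed

lemma borel_measurable_compact_indicator:
  fixes f :: "'a::euclidean_space \<Rightarrow> real"
  assumes "compact S" "continuous_on S f"
  shows "(\<lambda>x. ennreal (f x) * indicator S x) \<in> borel_measurable borel"
proof -
  have "(\<lambda>x. indicator S x *\<^sub>R f x) \<in> borel_measurable borel"
    using borel_integrable_compact[OF assms] by (auto dest: borel_measurable_integrable)
  then have "(\<lambda>x. ennreal (indicator S x *\<^sub>R f x)) \<in> borel_measurable borel" by measurable
  also have "(\<lambda>x. ennreal (indicator S x *\<^sub>R f x)) = (\<lambda>x. ennreal (f x) * indicator S x)"
    by (auto simp: fun_eq_iff indicator_def)
  finally show ?thesis .
qed

lemma continuous_on_trace: "continuous_on S H \<Longrightarrow> continuous_on S (\<lambda>x. trace (H x :: real ^ 'n ^ 'n))"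
  unfolding trace_def by (intro continuous_intros)

lemma continuous_on_det: "continuous_on S H \<Longrightarrow> continuous_on S (\<lambda>x. det (H x :: real ^ 'n ^ 'n))"
  unfolding det_def by (intro continuous_intros)

text \<open>Where f does not vanish the Jacobian matrix of g is symmetric and nonpositive, so a power of the
  trace controls the Jacobian determinant in the area inequality.\<close>

lemma gradient_image_le_trace_wellordered:
  fixes g :: "real ^ 'n::{finite,wellorder} \<Rightarrow> real ^ 'n::{finite,wellorder}"
    and H :: "real ^ 'n::{finite,wellorder} \<Rightarrow> real ^ 'n::{finite,wellorder} ^ 'n::{finite,wellorder}"
    and f :: "real ^ 'n::{finite,wellorder} \<Rightarrow> real"
  assumes S: "compact S"
    and g: "\<And>x. x \<in> S \<Longrightarrow> (g has_derivative (\<lambda>h. H x *v h)) (at x within S)"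
    and H: "continuous_on S H" and f: "continuous_on (g ` S) f"
    and f0: "\<And>x. x \<in> S \<Longrightarrow> 0 \<le> f (g x)"
    and nsd: "\<And>x. x \<in> S \<Longrightarrow> f (g x) \<noteq> 0 \<Longrightarrow> transpose (- H x) = - H x \<and> nonneg_form (- H x)"
  shows "(\<integral>\<^sup>+p\<in>g ` S. ennreal (f p) \<partial>lborel) \<le>
    (\<integral>\<^sup>+x\<in>S. ennreal (fact CARD('n) * trace (- H x) ^ CARD('n) * f (g x)) \<partial>lborel)"
proof -
  have gc: "continuous_on S g"
    by (rule has_derivative_continuous_on[OF g])
  have fg: "continuous_on S (\<lambda>x. f (g x))"
    using continuous_on_compose[OF gc f] by (simp add: o_def)
  have D: "continuous_on S (\<lambda>x. \<bar>det (H x)\<bar> * f (g x))"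
    by (intro continuous_intros continuous_on_det H fg)
  have E: "continuous_on S (\<lambda>x. fact CARD('n) * trace (- H x) ^ CARD('n) * f (g x))"
    by (intro continuous_intros continuous_on_trace H fg)
  have le: "\<bar>det (H x)\<bar> * f (g x) \<le> fact CARD('n) * trace (- H x) ^ CARD('n) * f (g x)"
    if "x \<in> S" for x
  proof (cases "f (g x) = 0")
    case False
    note n = nsd[OF that False]
    have "\<bar>det (- H x)\<bar> \<le> fact CARD('n) * trace (- H x) ^ CARD('n)"
      using det_le_trace_power n by blast
    moreover have "\<bar>det (- H x)\<bar> = \<bar>det (H x)\<bar>"
    proof -
      have "- H x = mat (-1) ** H x"
        by (simp add: vec_eq_iff matrix_matrix_mult_def mat_def if_distrib[where f="\<lambda>z. z * _"] cong: if_cong)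
      then have "det (- H x) = det (mat (-1 :: real) :: real ^ 'n::{finite,wellorder} ^ 'n::{finite,wellorder}) * det (H x)"
        by (simp add: det_mul)
      moreover have "\<bar>det (mat (-1 :: real) :: real ^ 'n::{finite,wellorder} ^ 'n::{finite,wellorder})\<bar> = 1"
        by (subst det_diagonal) (auto simp: mat_def)
      ultimately show ?thesis by (simp add: abs_mult)
    qed
    ultimately show ?thesis
      using f0[OF that] by (intro mult_right_mono) auto
  qed simp
  have "0 \<le> \<bar>det (H x)\<bar> * f (g x)" if "x \<in> S" for x
    using f0[OF that] by simp
  then have E0: "0 \<le> fact CARD('n) * trace (- H x) ^ CARD('n) * f (g x)" if "x \<in> S" for x
    using le[OF that] that by (meson order_trans)
  have "integral (g ` S) f \<le> integral S (\<lambda>x. \<bar>det (matrix (\<lambda>h. H x *v h))\<bar> * f (g x))"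
    using nn_integral_compact_eq_integral(1)[OF S D] f0
    by (intro integral_on_image_ubound g) auto
  also have "\<dots> \<le> integral S (\<lambda>x. fact CARD('n) * trace (- H x) ^ CARD('n) * f (g x))"
    using nn_integral_compact_eq_integral(1)[OF S D] nn_integral_compact_eq_integral(1)[OF S E] f0 le E0
    by (intro integral_le) auto
  finally have "ennreal (integral (g ` S) f) \<le>
      ennreal (integral S (\<lambda>x. fact CARD('n) * trace (- H x) ^ CARD('n) * f (g x)))"
    by (rule ennreal_leI)
  moreover have "(\<integral>\<^sup>+p\<in>g ` S. ennreal (f p) \<partial>lborel) = ennreal (integral (g ` S) f)"
    by (rule nn_integral_compact_eq_integral(2)[OF compact_continuous_image[OF gc S] f]) (use f0 in auto)
  ultimately show ?thesis
    using nn_integral_compact_eq_integral(2)[OF S E E0] by simp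
qed

text \<open>Every finite index type carries a well-order after relabelling, and relabelling coordinates is a
  linear isometry that preserves Lebesgue measure, so the inequality passes to every finite index
  type. The trace is carried over as a sum over indices, which spares the relabelling of the
  permutations in the determinant.\<close>

definition to_wo :: "real ^ 'n \<Rightarrow> real ^ 'n wo" where
  "to_wo x = (\<chi> i. x $ wo_rep i)"

definition from_wo :: "real ^ 'n wo \<Rightarrow> real ^ 'n" where
  "from_wo y = (\<chi> i. y $ wo_abs i)"

lemma from_to_wo [simp]: "from_wo (to_wo x) = x"
  by (simp add: from_wo_def to_wo_def wo_abs_inverse)

lemma to_from_wo [simp]: "to_wo (from_wo y) = y"
  by (simp add: from_wo_def to_wo_def wo_rep_inverse)

lemma sum_wo: "(\<Sum>i\<in>UNIV. f (wo_rep i)) = (\<Sum>i\<in>UNIV. f i)"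
  by (rule sum.reindex_bij_betw[OF bij_wo_rep])

lemma card_wo: "CARD('n wo) = CARD('n)"
  using bij_betw_same_card[OF bij_wo_rep] .

lemma linear_to_wo: "linear to_wo"
  by (rule linearI) (simp_all add: to_wo_def vec_eq_iff)

lemma linear_from_wo: "linear from_wo"
  by (rule linearI) (simp_all add: from_wo_def vec_eq_iff)

lemma lborel_distr_to_wo: "distr lborel lborel (to_wo :: real ^ 'n \<Rightarrow> _) = lborel"
proof (rule lborel_eqI[symmetric])
  have meas: "(to_wo :: real ^ 'n \<Rightarrow> _) \<in> borel_measurable borel"
    using linear_continuous_on[OF linear_conv_bounded_linear[THEN iffD1, OF linear_to_wo]]
    by (intro borel_measurable_continuous_onI)
  fix l u :: "real ^ 'n wo"
  assume le: "\<And>b. b \<in> Basis \<Longrightarrow> l \<bullet> b \<le> u \<bullet> b"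
  have le': "l $ i \<le> u $ i" for i
    using le[of "axis i 1"] by (auto simp: Basis_vec_def inner_axis)
  have prod_eq: "(\<Prod>b\<in>Basis. x \<bullet> b) = (\<Prod>i\<in>UNIV. x $ i)" for x :: "real ^ 'm::finite"
  proof -
    have "(\<Prod>b\<in>Basis. x \<bullet> b) = (\<Prod>b\<in>(\<lambda>i. axis i 1) ` UNIV. x \<bullet> b)"
      by (intro prod.cong) (auto simp: Basis_vec_def)
    also have "\<dots> = (\<Prod>i\<in>UNIV. x \<bullet> axis i 1)"
      by (subst prod.reindex) (auto simp: inj_on_def axis_eq_axis)
    finally show ?thesis by (simp add: inner_axis)
  qed
  have "to_wo -` box l u = box (from_wo l) (from_wo u)"
    by (auto simp: mem_box_cart to_wo_def from_wo_def) (metis wo_abs_inverse wo_rep_inverse UNIV_I)+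
  then have "emeasure (distr lborel lborel to_wo) (box l u) = emeasure lborel (box (from_wo l) (from_wo u))"
    using meas by (subst emeasure_distr) auto
  also have "\<dots> = ennreal (\<Prod>b\<in>Basis. (from_wo u - from_wo l) \<bullet> b)"
    by (rule emeasure_lborel_box) (auto simp: Basis_vec_def inner_axis from_wo_def le')
  also have "(\<Prod>b\<in>Basis. (from_wo u - from_wo l) \<bullet> b) = (\<Prod>i\<in>UNIV. (from_wo u - from_wo l) $ wo_rep i)"
    unfolding prod_eq by (rule prod.reindex_bij_betw[OF bij_wo_rep, symmetric])
  also have "\<dots> = (\<Prod>b\<in>Basis. (u - l) \<bullet> b)"
    unfolding prod_eq by (simp add: from_wo_def wo_rep_inverse)
  finally show "emeasure (distr lborel lborel (to_wo :: real ^ 'n \<Rightarrow> _)) (box l u) = ennreal (\<Prod>b\<in>Basis. (u - l) \<bullet> b)" .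
qed simp

lemma nn_integral_from_wo:
  fixes f :: "real ^ 'n \<Rightarrow> ennreal"
  assumes "f \<in> borel_measurable borel"
  shows "(\<integral>\<^sup>+y. f (from_wo y) \<partial>lborel) = (\<integral>\<^sup>+x. f x \<partial>lborel)"
proof -
  have m1: "(to_wo :: real ^ 'n \<Rightarrow> _) \<in> borel_measurable borel"
    using linear_continuous_on[OF linear_conv_bounded_linear[THEN iffD1, OF linear_to_wo]]
    by (intro borel_measurable_continuous_onI)
  have m2: "(from_wo :: _ \<Rightarrow> real ^ 'n) \<in> borel_measurable borel"
    using linear_continuous_on[OF linear_conv_bounded_linear[THEN iffD1, OF linear_from_wo]]
    by (intro borel_measurable_continuous_onI)
  have "(\<integral>\<^sup>+y. f (from_wo y) \<partial>lborel) = (\<integral>\<^sup>+y. f (from_wo y) \<partial>distr lborel lborel (to_wo :: real ^ 'n \<Rightarrow> _))"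
    by (simp add: lborel_distr_to_wo)
  also have "\<dots> = (\<integral>\<^sup>+x. f (from_wo (to_wo x)) \<partial>lborel)"
    using m1 m2 assms by (intro nn_integral_distr) (auto intro: measurable_compose)
  finally show ?thesis by simp
qed

lemma gradient_image_le_trace:
  fixes g :: "real ^ 'n \<Rightarrow> real ^ 'n" and H :: "real ^ 'n \<Rightarrow> real ^ 'n ^ 'n"
    and f :: "real ^ 'n \<Rightarrow> real"
  assumes S: "compact S"
    and g: "\<And>x. x \<in> S \<Longrightarrow> (g has_derivative (\<lambda>h. H x *v h)) (at x within S)"
    and H: "continuous_on S H" and f: "continuous_on (g ` S) f"
    and f0: "\<And>x. x \<in> S \<Longrightarrow> 0 \<le> f (g x)"
    and nsd: "\<And>x. x \<in> S \<Longrightarrow> f (g x) \<noteq> 0 \<Longrightarrow> transpose (- H x) = - H x \<and> nonneg_form (- H x)"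
  shows "(\<integral>\<^sup>+p\<in>g ` S. ennreal (f p) \<partial>lborel) \<le>
    (\<integral>\<^sup>+x\<in>S. ennreal (fact CARD('n) * trace (- H x) ^ CARD('n) * f (g x)) \<partial>lborel)"
proof -
  define S' where "S' = to_wo ` S"
  define g' where "g' = (\<lambda>y. to_wo (g (from_wo y)))"
  define H' where "H' = (\<lambda>y. \<chi> i j. H (from_wo y) $ wo_rep i $ wo_rep j)"
  have bl1: "bounded_linear (to_wo :: real ^ 'n \<Rightarrow> _)"
    using linear_to_wo linear_conv_bounded_linear by blast
  have bl2: "bounded_linear (from_wo :: _ \<Rightarrow> real ^ 'n)"
    using linear_from_wo linear_conv_bounded_linear by blast
  have S'S: "from_wo ` S' = S" by (force simp: S'_def image_image)
  have mem: "y \<in> S' \<longleftrightarrow> from_wo y \<in> S" for y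
    unfolding S'_def by (metis from_to_wo image_iff to_from_wo)
  have gS: "g' ` S' = to_wo ` (g ` S)"
    by (simp add: g'_def S'_def image_image)
  have memg: "p \<in> g' ` S' \<longleftrightarrow> from_wo p \<in> g ` S" for p
    unfolding gS by (metis (no_types, lifting) from_to_wo image_iff to_from_wo)
  have mv: "to_wo (H x *v h) = H' (to_wo x) *v to_wo h" for x h
    by (simp add: vec_eq_iff H'_def to_wo_def[of h] matrix_vector_mult_def)
       (simp add: to_wo_def sum_wo[of "\<lambda>j. H x $ _ $ j * h $ j"])
  have gd: "(g' has_derivative (\<lambda>h. H' y *v h)) (at y within S')" if "y \<in> S'" for y
  proof -
    have 1: "(from_wo has_derivative from_wo) (at y within S')"
      by (rule bounded_linear_imp_has_derivative[OF bl2])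
    have 2: "(g has_derivative (\<lambda>h. H (from_wo y) *v h)) (at (from_wo y) within from_wo ` S')"
      unfolding S'S using g that mem by blast
    have "((\<lambda>y. g (from_wo y)) has_derivative (\<lambda>h. H (from_wo y) *v from_wo h)) (at y within S')"
      using has_derivative_compose[OF 1, of g] has_derivative_in_compose[OF 1 2] by blast
    from bounded_linear.has_derivative[OF bl1 this]
    show ?thesis unfolding g'_def mv by simp
  qed
  have cto: "continuous_on A (to_wo :: real ^ 'n \<Rightarrow> _)" for A
    by (rule linear_continuous_on[OF bl1])
  have cfrom: "continuous_on A (from_wo :: _ \<Rightarrow> real ^ 'n)" for A
    by (rule linear_continuous_on[OF bl2])
  have cH: "continuous_on S' H'"
    unfolding H'_def
    by (intro continuous_intros continuous_on_compose2[OF H cfrom]) (auto simp: mem)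
  have cf: "continuous_on (g' ` S') (\<lambda>p. f (from_wo p))"
    by (rule continuous_on_compose2[OF f cfrom]) (use memg in auto)
  have tr: "trace (- H' y) = trace (- H (from_wo y))" for y
    unfolding trace_def by (simp add: H'_def sum_negf sum_wo[of "\<lambda>i. H (from_wo y) $ i $ i"])
  have neg: "transpose (- H' y) = - H' y \<and> nonneg_form (- H' y)"
    if "transpose (- H (from_wo y)) = - H (from_wo y)" "nonneg_form (- H (from_wo y))" for y
  proof
    show "transpose (- H' y) = - H' y"
      using that(1) by (simp add: transpose_def vec_eq_iff H'_def)
    show "nonneg_form (- H' y)"
      unfolding nonneg_form_def
    proof
      fix \<xi> :: "real ^ 'n wo"
      have "\<xi> \<bullet> (- H' y *v \<xi>) = (\<Sum>i\<in>UNIV. \<Sum>j\<in>UNIV. (- H (from_wo y)) $ wo_rep i $ wo_rep j *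
          from_wo \<xi> $ wo_rep i * from_wo \<xi> $ wo_rep j)"
        by (simp add: form_eq_sum H'_def from_wo_def wo_rep_inverse)
      also have "\<dots> = (\<Sum>i\<in>UNIV. \<Sum>j\<in>UNIV. (- H (from_wo y)) $ wo_rep i $ j *
          from_wo \<xi> $ wo_rep i * from_wo \<xi> $ j)"
        by (intro sum.cong refl sum_wo)
      also have "\<dots> = from_wo \<xi> \<bullet> (- H (from_wo y) *v from_wo \<xi>)"
        unfolding form_eq_sum by (rule sum_wo)
      finally show "0 \<le> \<xi> \<bullet> (- H' y *v \<xi>)"
        using that(2) by (simp add: nonneg_form_def)
    qed
  qed
  have gc: "continuous_on S g"
    by (rule has_derivative_continuous_on[OF g])
  have fg: "continuous_on S (\<lambda>x. f (g x))"
    using continuous_on_compose[OF gc f] by (simp add: o_def)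
  have main: "(\<integral>\<^sup>+p\<in>g' ` S'. ennreal (f (from_wo p)) \<partial>lborel) \<le>
    (\<integral>\<^sup>+y\<in>S'. ennreal (fact CARD('n wo) * trace (- H' y) ^ CARD('n wo) * f (from_wo (g' y))) \<partial>lborel)"
  proof (rule gradient_image_le_trace_wellordered[OF _ gd cH cf])
    show "compact S'"
      unfolding S'_def by (rule compact_continuous_image[OF cto S])
  next
    fix y assume y: "y \<in> S'"
    then have fy: "from_wo y \<in> S" using mem by blast
    show "0 \<le> f (from_wo (g' y))"
      using f0[OF fy] by (simp add: g'_def)
    show "transpose (- H' y) = - H' y \<and> nonneg_form (- H' y)" if "f (from_wo (g' y)) \<noteq> 0"
      using nsd[OF fy] that neg by (simp add: g'_def)
  qed
  have m1: "(\<lambda>p. ennreal (f p) * indicator (g ` S) p) \<in> borel_measurable borel"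
    by (rule borel_measurable_compact_indicator[OF compact_continuous_image[OF gc S] f])
  define E where "E = (\<lambda>x. fact CARD('n) * trace (- H x) ^ CARD('n) * f (g x))"
  have cE: "continuous_on S E"
    unfolding E_def by (intro continuous_intros continuous_on_trace H fg)
  have m2: "(\<lambda>x. ennreal (E x) * indicator S x) \<in> borel_measurable borel"
    by (rule borel_measurable_compact_indicator[OF S cE])
  have "(\<integral>\<^sup>+p\<in>g ` S. ennreal (f p) \<partial>lborel) =
      (\<integral>\<^sup>+p. ennreal (f (from_wo p)) * indicator (g ` S) (from_wo p) \<partial>lborel)"
    using nn_integral_from_wo[OF m1] by simp
  also have "\<dots> = (\<integral>\<^sup>+p\<in>g' ` S'. ennreal (f (from_wo p)) \<partial>lborel)"
    using memg by (intro nn_integral_cong) (auto simp: indicator_def)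
  also note main
  also have "(\<integral>\<^sup>+y\<in>S'. ennreal (fact CARD('n wo) * trace (- H' y) ^ CARD('n wo) * f (from_wo (g' y))) \<partial>lborel)
      = (\<integral>\<^sup>+y. ennreal (E (from_wo y)) * indicator S (from_wo y) \<partial>lborel)"
    by (intro nn_integral_cong) (auto simp: indicator_def mem E_def card_wo tr g'_def)
  also have "\<dots> = (\<integral>\<^sup>+x\<in>S. ennreal (E x) \<partial>lborel)"
    by (rule nn_integral_from_wo[OF m2])
  finally show ?thesis unfolding E_def .
qed

section \<open>The maximum principle in discrete time\<close>

primrec runmax :: "real \<Rightarrow> (nat \<Rightarrow> real) \<Rightarrow> nat \<Rightarrow> real" where
  "runmax l f 0 = max l (f 0)"
| "runmax l f (Suc k) = max (runmax l f k) (f (Suc k))"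

lemma runmax_step: "runmax l f k \<le> runmax l f (Suc k)"
  by simp

lemma runmax_ge_level: "l \<le> runmax l f k"
  by (induction k) auto

lemma runmax_ge: "j \<le> k \<Longrightarrow> f j \<le> runmax l f k"
  by (induction k) (auto simp: le_Suc_eq)

lemma runmax_le: "l \<le> u \<Longrightarrow> (\<And>j. j \<le> k \<Longrightarrow> f j \<le> u) \<Longrightarrow> runmax l f k \<le> u"
  by (induction k) auto

lemma sum_runmax_increments: "(\<Sum>k<N. runmax l f (Suc k) - runmax l f k) = runmax l f N - runmax l f 0"
  using sum_lessThan_telescope[of "runmax l f" N] .

lemma continuous_on_runmax:
  assumes "\<And>j. j \<le> k \<Longrightarrow> continuous_on S (f j)"
  shows "continuous_on S (\<lambda>p. runmax l (\<lambda>j. f j p) k)"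
  using assms by (induction k) (auto intro!: continuous_intros)

text \<open>The value at c of the lowest plane of slope p above the graph of v over the ball: a Legendre
  transform of v.\<close>

definition height :: "('a::real_inner \<Rightarrow> real) \<Rightarrow> 'a \<Rightarrow> real \<Rightarrow> 'a \<Rightarrow> real" where
  "height v c R p = (SUP x\<in>cball c R. v x - p \<bullet> (x - c))"

lemma height_attained:
  fixes v :: "'a::euclidean_space \<Rightarrow> real"
  assumes "continuous_on (cball c R) v" "0 \<le> R"
  obtains x where "x \<in> cball c R" "height v c R p = v x - p \<bullet> (x - c)"
proof -
  have "continuous_on (cball c R) (\<lambda>x. v x - p \<bullet> (x - c))"
    by (intro continuous_intros assms)
  from continuous_attains_sup[OF compact_cball _ this] assms(2)
  obtain x where x: "x \<in> cball c R" "\<forall>y\<in>cball c R. v y - p \<bullet> (y - c) \<le> v x - p \<bullet> (x - c)"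
    by auto
  then have "height v c R p = v x - p \<bullet> (x - c)"
    unfolding height_def by (intro cSup_eq_maximum) auto
  with x that show ?thesis by blast
qed

lemma height_upper:
  fixes v :: "'a::euclidean_space \<Rightarrow> real"
  assumes "continuous_on (cball c R) v" "y \<in> cball c R"
  shows "v y - p \<bullet> (y - c) \<le> height v c R p"
proof -
  have "continuous_on (cball c R) (\<lambda>x. v x - p \<bullet> (x - c))"
    by (intro continuous_intros assms)
  then have "bdd_above ((\<lambda>x. v x - p \<bullet> (x - c)) ` cball c R)"
    by (intro bounded_imp_bdd_above compact_imp_bounded compact_continuous_image compact_cball)
  then show ?thesis
    unfolding height_def by (rule cSUP_upper[OF assms(2)])
qed

lemma height_le_height:
  fixes v :: "'a::euclidean_space \<Rightarrow> real"
  assumes "continuous_on (cball c R) v" "0 \<le> R"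
  shows "height v c R p \<le> height v c R q + R * norm (p - q)"
proof -
  obtain x where x: "x \<in> cball c R" "height v c R p = v x - p \<bullet> (x - c)"
    using height_attained[OF assms] .
  have "- ((p - q) \<bullet> (x - c)) \<le> norm (p - q) * norm (x - c)"
    using Cauchy_Schwarz_ineq2[of "p - q" "x - c"] by linarith
  also have "\<dots> \<le> norm (p - q) * R"
    using x(1) by (intro mult_left_mono) (auto simp: dist_norm norm_minus_commute)
  finally show ?thesis
    using height_upper[OF assms(1) x(1), of q] x(2) by (simp add: inner_diff_left mult.commute)
qed

lemma continuous_on_height:
  fixes v :: "'a::euclidean_space \<Rightarrow> real"
  assumes "continuous_on (cball c R) v" "0 \<le> R"
  shows "continuous_on S (height v c R)"
proof -
  have "dist (height v c R p) (height v c R q) \<le> R * dist p q" for p q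
    using height_le_height[OF assms, of p q] height_le_height[OF assms, of q p]
    by (simp add: dist_norm norm_minus_commute abs_le_iff)
  then have "R-lipschitz_on S (height v c R)"
    using assms(2) by (intro lipschitz_onI) auto
  then show ?thesis by (rule lipschitz_on_continuous_on)
qed

text \<open>First and second derivative test at an interior point where the graph is touched from above by
  an affine function with slope p.\<close>

lemma touching_point_derivatives:
  fixes v :: "real ^ 'n \<Rightarrow> real"
  assumes x: "x \<in> ball c R"
    and grad: "\<And>y. y \<in> cball c R \<Longrightarrow> (v has_derivative (\<lambda>h. G y \<bullet> h)) (at y)"
    and hess: "(G has_derivative (\<lambda>h. H *v h)) (at x)"
    and max: "\<And>y. y \<in> cball c R \<Longrightarrow> v y - p \<bullet> (y - c) \<le> v x - p \<bullet> (x - c)"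
  shows "G x = p" "nonneg_form (- H)"
proof -
  have sub: "ball c R \<subseteq> cball c R" by (rule ball_subset_cball)
  have "((\<lambda>y. v y - p \<bullet> (y - c)) has_derivative (\<lambda>h. G x \<bullet> h - p \<bullet> h)) (at x)"
    using sub x by (auto intro!: derivative_eq_intros grad)
  then have "(\<lambda>h. G x \<bullet> h - p \<bullet> h) = (\<lambda>v. 0)"
    by (rule differential_zero_maxmin[OF x open_ball]) (use max sub in auto)
  then have "(G x - p) \<bullet> (G x - p) = 0"
    by (metis inner_diff_left)
  then show Gx: "G x = p" by simp
  show "nonneg_form (- H)"
    unfolding nonneg_form_def
  proof (rule allI, rule ccontr)
    fix \<xi> :: "real ^ 'n"
    assume "\<not> 0 \<le> \<xi> \<bullet> (- H *v \<xi>)"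
    then have pos: "(H *v \<xi>) \<bullet> \<xi> > 0"
      by (simp add: form_eq_sum sum_negf inner_commute)
    define \<phi> where "\<phi> = (\<lambda>s. v (x + s *\<^sub>R \<xi>) - p \<bullet> (x + s *\<^sub>R \<xi> - c))"
    define \<psi> where "\<psi> = (\<lambda>s. (G (x + s *\<^sub>R \<xi>) - p) \<bullet> \<xi>)"
    obtain d0 where d0: "d0 > 0" "\<And>s. \<bar>s\<bar> < d0 \<Longrightarrow> x + s *\<^sub>R \<xi> \<in> ball c R"
    proof -
      have "isCont (\<lambda>s. x + s *\<^sub>R \<xi>) (0::real)" by (intro continuous_intros)
      then have "(\<lambda>s. x + s *\<^sub>R \<xi>) \<midarrow>0\<rightarrow> x"
        by (simp add: isCont_def)
      then have "\<forall>\<^sub>F s in at (0::real). x + s *\<^sub>R \<xi> \<in> ball c R"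
        using x topological_tendstoD[OF _ open_ball] by blast
      then obtain d where "d > 0" "\<And>s. s \<noteq> 0 \<Longrightarrow> \<bar>s\<bar> < d \<Longrightarrow> x + s *\<^sub>R \<xi> \<in> ball c R"
        unfolding eventually_at by (auto simp: dist_norm)
      then show ?thesis using that[of d] x by (metis add.right_neutral scaleR_zero_left)
    qed
    have d\<phi>: "(\<phi> has_real_derivative \<psi> s) (at s)" if "\<bar>s\<bar> < d0" for s
    proof -
      have inn: "x + s *\<^sub>R \<xi> \<in> cball c R" using d0(2)[OF that] sub by blast
      have "((\<lambda>s. x + s *\<^sub>R \<xi>) has_derivative (\<lambda>h. h *\<^sub>R \<xi>)) (at s)"
        by (auto intro!: derivative_eq_intros)
      from has_derivative_compose[OF this grad[OF inn]]
      have "((\<lambda>s. v (x + s *\<^sub>R \<xi>)) has_derivative (\<lambda>h. G (x + s *\<^sub>R \<xi>) \<bullet> (h *\<^sub>R \<xi>))) (at s)" .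
      then have "(\<phi> has_derivative (\<lambda>h. G (x + s *\<^sub>R \<xi>) \<bullet> (h *\<^sub>R \<xi>) - p \<bullet> (h *\<^sub>R \<xi>))) (at s)"
        unfolding \<phi>_def by (auto intro!: derivative_eq_intros)
      then show ?thesis
        unfolding has_field_derivative_def \<psi>_def
        by (rule has_derivative_eq_rhs) (auto simp: inner_diff_left algebra_simps)
    qed
    have d\<psi>: "(\<psi> has_real_derivative (H *v \<xi>) \<bullet> \<xi>) (at 0)"
    proof -
      have 1: "((\<lambda>s. x + s *\<^sub>R \<xi>) has_derivative (\<lambda>h. h *\<^sub>R \<xi>)) (at (0::real))"
        by (auto intro!: derivative_eq_intros)
      have "((\<lambda>s. G (x + s *\<^sub>R \<xi>)) has_derivative (\<lambda>h. H *v (h *\<^sub>R \<xi>))) (at (0::real))"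
        using has_derivative_compose[OF 1, of G "\<lambda>h. H *v h"] hess by simp
      then have "(\<psi> has_derivative (\<lambda>h. (H *v (h *\<^sub>R \<xi>)) \<bullet> \<xi>)) (at 0)"
        unfolding \<psi>_def by (auto intro!: derivative_eq_intros)
      then show ?thesis
        unfolding has_field_derivative_def
        by (rule has_derivative_eq_rhs) (auto simp: matrix_vector_mult_scaleR)
    qed
    have \<psi>0: "\<psi> 0 = 0" by (simp add: \<psi>_def Gx)
    obtain d1 where d1: "d1 > 0" "\<And>h. 0 < h \<Longrightarrow> h < d1 \<Longrightarrow> \<psi> 0 < \<psi> (0 + h)"
      using DERIV_pos_inc_right[OF d\<psi> pos] by blast
    define s where "s = min d0 d1 / 2"
    have s: "0 < s" "s < d0" "s < d1" using d0 d1 by (auto simp: s_def)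
    have "\<phi> 0 < \<phi> s"
    proof (rule DERIV_pos_imp_increasing_open[OF s(1)])
      fix t assume t: "0 < t" "t < s"
      show "\<exists>y. DERIV \<phi> t :> y \<and> 0 < y"
        using d\<phi>[of t] d1(2)[of t] t s \<psi>0 by (intro exI[of _ "\<psi> t"]) auto
    next
      have "isCont \<phi> t" if "0 \<le> t" "t \<le> s" for t
        using d\<phi>[of t] that s DERIV_isCont by force
      then show "continuous_on {0..s} \<phi>"
        by (intro continuous_at_imp_continuous_on) auto
    qed
    moreover have "\<phi> s \<le> \<phi> 0"
      using max[of "x + s *\<^sub>R \<xi>"] d0(2)[of s] s sub by (auto simp: \<phi>_def)
    ultimately show False by simp
  qed
qed

lemma power_add_le: "0 \<le> a \<Longrightarrow> 0 \<le> b \<Longrightarrow> (a + b) ^ n \<le> 2 ^ n * (a ^ n + b ^ n)" for a b :: real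
proof -
  assume ab: "0 \<le> a" "0 \<le> b"
  have "(a + b) ^ n \<le> (2 * max a b) ^ n"
    using ab by (intro power_mono) auto
  also have "\<dots> = 2 ^ n * max a b ^ n" by (simp add: power_mult_distrib)
  also have "\<dots> \<le> 2 ^ n * (a ^ n + b ^ n)"
    using ab by (intro mult_left_mono) (auto simp: max_def)
  finally show ?thesis .
qed

text \<open>The two terms on the right correspond to the two regimes: either the drift dominates and the
  increment of the running maximum is kept as a factor, or the bounded source dominates, and then it
  bounds both the trace and the increment.\<close>

lemma trace_power_increment_le:
  fixes T F \<delta> \<tau> \<nu> g B \<gamma> w \<eta> \<kappa> :: real
  assumes "0 \<le> T" "0 \<le> F" "F \<le> \<delta>" "0 < \<tau>" "0 < \<nu>" "0 < \<kappa>" "\<kappa> \<le> g" "0 \<le> B" "0 \<le> \<gamma>" "0 \<le> w" "0 < \<eta>"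
    and le: "\<delta> / \<tau> + T / \<nu> \<le> B * (g + \<gamma> * w) + \<eta>"
  shows "T ^ n * (F / g ^ n) \<le> (2 * \<nu>) ^ n *
    (\<delta> * (2 ^ n * (B ^ n + (\<gamma> / \<kappa>) ^ n * (B * w) ^ n)) + 2 * \<tau> * \<eta> ^ Suc n / \<kappa> ^ n)"
proof -
  have g: "0 < g" using assms by linarith
  have \<delta>: "0 \<le> \<delta>" using assms by linarith
  define s where "s = B * (g + \<gamma> * w)"
  have s0: "0 \<le> s" using assms g by (simp add: s_def)
  have T: "T \<le> \<nu> * (s + \<eta>)"
  proof -
    have "0 \<le> \<delta> / \<tau>" using \<delta> assms(4) by simp
    then have "T / \<nu> \<le> s + \<eta>" using le s_def by linarith
    then show ?thesis using assms(5) by (simp add: field_simps)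
  qed
  have \<delta>le: "\<delta> \<le> \<tau> * (s + \<eta>)"
  proof -
    have "0 \<le> T / \<nu>" using assms by simp
    then have "\<delta> / \<tau> \<le> s + \<eta>" using le s_def by linarith
    then show ?thesis using assms(4) by (simp add: field_simps)
  qed
  define X where "X = \<delta> * (2 ^ n * (B ^ n + (\<gamma> / \<kappa>) ^ n * (B * w) ^ n))"
  define Z where "Z = 2 * \<tau> * \<eta> ^ Suc n / \<kappa> ^ n"
  have X0: "0 \<le> X" unfolding X_def using assms \<delta> by (intro mult_nonneg_nonneg add_nonneg_nonneg) auto
  have Z0: "0 \<le> Z" unfolding Z_def using assms by simp
  have "T ^ n * (F / g ^ n) \<le> (2 * \<nu>) ^ n * (X + Z)"
  proof (cases "\<eta> \<le> s")
    case True
    have "T \<le> 2 * \<nu> * s"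
    proof -
      have "\<nu> * (s + \<eta>) \<le> \<nu> * (2 * s)" using True assms(5) by (intro mult_left_mono) auto
      with T show ?thesis by simp
    qed
    then have "T ^ n \<le> (2 * \<nu> * s) ^ n" using assms(1) by (rule power_mono)
    then have "T ^ n * (F / g ^ n) \<le> (2 * \<nu> * s) ^ n * (\<delta> / g ^ n)"
      using assms g s0 by (intro mult_mono divide_right_mono zero_le_power mult_nonneg_nonneg) auto
    also have "\<dots> = (2 * \<nu>) ^ n * (\<delta> * (s / g) ^ n)"
      by (simp add: power_mult_distrib power_divide)
    also have "s / g = B + (\<gamma> / g) * (B * w)"
      using g by (simp add: s_def field_simps)
    also have "(2 * \<nu>) ^ n * (\<delta> * (B + (\<gamma> / g) * (B * w)) ^ n)
        \<le> (2 * \<nu>) ^ n * (\<delta> * (B + (\<gamma> / \<kappa>) * (B * w)) ^ n)"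
      using assms g \<delta> by (intro mult_left_mono power_mono add_left_mono mult_right_mono divide_left_mono) auto
    also have "\<dots> \<le> (2 * \<nu>) ^ n * X"
    proof -
      have "(B + (\<gamma> / \<kappa>) * (B * w)) ^ n \<le> 2 ^ n * (B ^ n + ((\<gamma> / \<kappa>) * (B * w)) ^ n)"
        using assms by (intro power_add_le) auto
      then show ?thesis
        unfolding X_def power_mult_distrib[of "\<gamma> / \<kappa>" "B * w"]
        using assms \<delta> by (intro mult_left_mono) auto
    qed
    also have "\<dots> \<le> (2 * \<nu>) ^ n * (X + Z)"
      using Z0 assms by (intro mult_left_mono) auto
    finally show ?thesis .
  next
    case False
    have "T \<le> 2 * \<nu> * \<eta>"
    proof -
      have "\<nu> * (s + \<eta>) \<le> \<nu> * (2 * \<eta>)" using False assms(5) by (intro mult_left_mono) auto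
      with T show ?thesis by simp
    qed
    then have 1: "T ^ n \<le> (2 * \<nu> * \<eta>) ^ n" using assms(1) by (rule power_mono)
    have 2: "\<delta> \<le> 2 * \<tau> * \<eta>"
    proof -
      have "\<tau> * (s + \<eta>) \<le> \<tau> * (2 * \<eta>)" using False assms(4) by (intro mult_left_mono) auto
      with \<delta>le show ?thesis by simp
    qed
    have "T ^ n * (F / g ^ n) \<le> (2 * \<nu> * \<eta>) ^ n * ((2 * \<tau> * \<eta>) / \<kappa> ^ n)"
      using assms g \<delta> by (intro mult_mono[OF 1] frac_le order_trans[OF assms(3) 2] power_mono) auto
    also have "\<dots> = (2 * \<nu>) ^ n * Z"
      by (simp add: Z_def power_mult_distrib)
    also have "\<dots> \<le> (2 * \<nu>) ^ n * (X + Z)"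
      using X0 assms by (intro mult_left_mono) auto
    finally show ?thesis .
  qed
  then show ?thesis unfolding X_def Z_def .
qed


text \<open>At every slope p in the annulus the height of the lowest plane of slope p above the graph has a
  running maximum that climbs from M/4 by at least M/2. It climbs only at times when the plane touches the current
  graph at an interior point with gradient p, by at most the increment of the running maximum of the
  positive part there. The area inequality turns this into an estimate in x, and the weight
  \<open>\<bar>p\<bar>\<^sup>-\<^sup>n\<close> makes the drift term, which is proportional to the gradient, scale invariant.\<close>

lemma discrete_maximum_principle:
  fixes v :: "nat \<Rightarrow> real ^ 'n \<Rightarrow> real" and G :: "nat \<Rightarrow> real ^ 'n \<Rightarrow> real ^ 'n"
    and H :: "nat \<Rightarrow> real ^ 'n \<Rightarrow> real ^ 'n ^ 'n" and B w :: "real ^ 'n \<Rightarrow> real"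
    and \<delta> :: "nat \<Rightarrow> real ^ 'n \<Rightarrow> real"
  defines "\<delta> \<equiv> \<lambda>k x. runmax 0 (\<lambda>j. v j x) (Suc k) - runmax 0 (\<lambda>j. v j x) k"
  assumes pos: "0 < R" "0 < \<tau>" "0 < M" "0 < \<kappa>" "0 < \<nu>" "0 \<le> \<gamma>" "0 < \<eta>"
    and grad: "\<And>k x. k \<le> N \<Longrightarrow> x \<in> cball c R \<Longrightarrow> (v k has_derivative (\<lambda>h. G k x \<bullet> h)) (at x)"
    and hess: "\<And>k x. k \<le> N \<Longrightarrow> x \<in> cball c R \<Longrightarrow> (G k has_derivative (\<lambda>h. H k x *v h)) (at x)"
    and sym: "\<And>k x. k \<le> N \<Longrightarrow> x \<in> cball c R \<Longrightarrow> transpose (H k x) = H k x"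
    and contH: "\<And>k. k \<le> N \<Longrightarrow> continuous_on (cball c R) (H k)"
    and init: "\<And>x. x \<in> cball c R \<Longrightarrow> v 0 x \<le> 0"
    and lateral: "\<And>k x. k \<le> N \<Longrightarrow> x \<in> sphere c R \<Longrightarrow> v k x \<le> 0"
    and bound: "\<And>k x. k \<le> N \<Longrightarrow> x \<in> cball c R \<Longrightarrow> v k x \<le> M"
    and top: "k0 \<le> N" "x0 \<in> cball c R" "v k0 x0 = M"
    and pde: "AE x in lborel. \<forall>k<N. x \<in> ball c R \<longrightarrow> 0 < v (Suc k) x \<longrightarrow> 0 < \<delta> k x \<longrightarrow>
        nonneg_form (- H (Suc k) x) \<longrightarrow>
        \<delta> k x / \<tau> + trace (- H (Suc k) x) / \<nu> \<le> B x * (norm (G (Suc k) x) + \<gamma> * w x) + \<eta>"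
    and meas: "B \<in> borel_measurable borel" "w \<in> borel_measurable borel"
    and nonneg: "\<And>x. 0 \<le> B x" "\<And>x. 0 \<le> w x"
  shows "ennreal (M / 2) * (\<integral>\<^sup>+p\<in>{p :: real ^ 'n. \<kappa> \<le> norm p \<and> norm p \<le> M / (4 * R)}. ennreal (1 / norm p ^ CARD('n)) \<partial>lborel)
    \<le> ennreal (fact CARD('n) * (2 * \<nu>) ^ CARD('n) * 2 ^ CARD('n) * M) *
        ((\<integral>\<^sup>+x\<in>cball c R. ennreal (B x ^ CARD('n)) \<partial>lborel) +
          ennreal ((\<gamma> / \<kappa>) ^ CARD('n)) * (\<integral>\<^sup>+x\<in>cball c R. ennreal ((B x * w x) ^ CARD('n)) \<partial>lborel))
      + ennreal (fact CARD('n) * (2 * \<nu>) ^ CARD('n) * (2 * \<tau> * \<eta> ^ Suc CARD('n) / \<kappa> ^ CARD('n))) *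
        (\<Sum>k<N. emeasure lborel {x \<in> ball c R. 0 < v (Suc k) x})"
proof -
  define n where "n = CARD('n)"
  define A where "A = {p :: real ^ 'n. \<kappa> \<le> norm p \<and> norm p \<le> M / (4 * R)}"
  \<comment> \<open>On the ball a plane of admissible slope varies by at most M/4 from its value at c. Starting the
    running maximum at M/4 discards the planes that touch where the function is not positive.\<close>
  define lev where "lev = (\<lambda>k p. runmax (M / 4) (\<lambda>j. height (v j) c R p) k)"
  define F where "F = (\<lambda>k p. lev (Suc k) p - lev k p)"
  define f where "f = (\<lambda>k p. F k p / norm p ^ n)"
  define \<Gamma> where "\<Gamma> = (\<lambda>k. {x \<in> cball c R. G (Suc k) x \<in> A \<and>
      v (Suc k) x - G (Suc k) x \<bullet> (x - c) = height (v (Suc k)) c R (G (Suc k) x)})"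
  define U where "U = (\<lambda>k. {x \<in> ball c R. 0 < v (Suc k) x})"
  define E where "E = (\<lambda>k x. fact n * trace (- H (Suc k) x) ^ n * f k (G (Suc k) x))"
  define C where "C = fact n * (2 * \<nu>) ^ n"
  define Z where "Z = 2 * \<tau> * \<eta> ^ Suc n / \<kappa> ^ n"
  define Q where "Q = (\<lambda>x. 2 ^ n * (B x ^ n + (\<gamma> / \<kappa>) ^ n * (B x * w x) ^ n))"
  have C0: "0 \<le> C" using pos by (simp add: C_def)
  have Z0: "0 \<le> Z" using pos by (simp add: Z_def)
  have Q0: "0 \<le> Q x" for x using pos nonneg by (simp add: Q_def)
  have sub: "ball c R \<subseteq> cball c R" by (rule ball_subset_cball)
  have R0: "0 \<le> R" using pos by simp
  have cv: "continuous_on (cball c R) (v k)" if "k \<le> N" for k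
    using grad[OF that] by (rule has_derivative_continuous_on[OF has_derivative_at_withinI])
  have cG: "continuous_on (cball c R) (G k)" if "k \<le> N" for k
    using hess[OF that] by (rule has_derivative_continuous_on[OF has_derivative_at_withinI])
  have clev: "continuous_on S (lev k)" if "k \<le> N" for k S
    unfolding lev_def
    by (intro continuous_on_runmax continuous_on_height cv R0) (use that in auto)
  have F0: "0 \<le> F k p" for k p
    unfolding F_def lev_def using runmax_step by simp
  have \<delta>0: "0 \<le> \<delta> k x" for k x
    unfolding \<delta>_def using runmax_step by simp
  have f0: "0 \<le> f k p" for k p using F0 by (simp add: f_def)
  have cA: "compact A"
  proof -
    have "A = cball 0 (M / (4 * R)) - ball 0 \<kappa>" by (auto simp: A_def)
    then show ?thesis by (simp add: compact_diff)
  qed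
  have slope: "\<bar>p \<bullet> (x - c)\<bar> \<le> M / 4" if "p \<in> A" "x \<in> cball c R" for p x
  proof -
    have "\<bar>p \<bullet> (x - c)\<bar> \<le> norm p * norm (x - c)" by (rule Cauchy_Schwarz_ineq2)
    also have "\<dots> \<le> M / (4 * R) * R"
      using that pos by (intro mult_mono) (auto simp: A_def dist_norm norm_minus_commute)
    finally show ?thesis using pos by simp
  qed
  have np: "norm p \<noteq> 0" if "p \<in> A" for p using that pos by (auto simp: A_def)
  have cf: "continuous_on A (f k)" if "k < N" for k
    unfolding f_def F_def using that np by (intro continuous_intros clev) auto
  have climb: "M / 2 \<le> (\<Sum>k<N. F k p)" if p: "p \<in> A" for p
  proof -
    have "(\<Sum>k<N. F k p) = lev N p - lev 0 p"
      unfolding F_def lev_def by (rule sum_runmax_increments)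
    moreover have "lev 0 p \<le> M / 4"
    proof -
      obtain x where "x \<in> cball c R" "height (v 0) c R p = v 0 x - p \<bullet> (x - c)"
        using height_attained[OF cv R0] by blast
      then show ?thesis using init[of x] slope[OF p, of x] by (auto simp: lev_def)
    qed
    moreover have "3 * M / 4 \<le> lev N p"
    proof -
      have "v k0 x0 - p \<bullet> (x0 - c) \<le> height (v k0) c R p"
        by (rule height_upper[OF cv[OF top(1)] top(2)])
      also have "\<dots> \<le> lev N p"
        unfolding lev_def by (rule runmax_ge[OF top(1)])
      finally show ?thesis using slope[OF p top(2)] top(3) by linarith
    qed
    ultimately show ?thesis by linarith
  qed
  \<comment> \<open>A climb at slope p happens at an interior contact point, where the value is positive.\<close>
  have contact: "x \<in> ball c R" "0 < v (Suc k) x" "F k (G (Suc k) x) \<le> \<delta> k x"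
      "G (Suc k) x = p" "nonneg_form (- H (Suc k) x)"
    if k: "k < N" and p: "p \<in> A" and x: "x \<in> cball c R" and Fp: "0 < F k p"
      and eq: "v (Suc k) x - p \<bullet> (x - c) = height (v (Suc k)) c R p" for k p x
  proof -
    have kN: "Suc k \<le> N" using k by simp
    have Feq: "F k p = height (v (Suc k)) c R p - lev k p"
      using Fp by (auto simp: F_def lev_def max_def split: if_splits)
    have "M / 4 \<le> lev k p" unfolding lev_def by (rule runmax_ge_level)
    then have "M / 4 < v (Suc k) x - p \<bullet> (x - c)" using Feq Fp eq by linarith
    then show vp: "0 < v (Suc k) x" using slope[OF p x] by linarith
    then have "x \<notin> sphere c R" using lateral[OF kN, of x] by force
    then show xb: "x \<in> ball c R" using x by auto
    have mx: "v (Suc k) y - p \<bullet> (y - c) \<le> v (Suc k) x - p \<bullet> (x - c)" if "y \<in> cball c R" for y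
      unfolding eq by (rule height_upper[OF cv[OF kN] that])
    show Gx: "G (Suc k) x = p"
      by (rule touching_point_derivatives(1)[OF xb grad[OF kN] hess[OF kN x] mx])
    show "nonneg_form (- H (Suc k) x)"
      by (rule touching_point_derivatives(2)[OF xb grad[OF kN] hess[OF kN x] mx])
    have "runmax 0 (\<lambda>j. v j x) k - p \<bullet> (x - c) \<le> lev k p"
    proof -
      have "runmax 0 (\<lambda>j. v j x) k \<le> lev k p + p \<bullet> (x - c)"
      proof (rule runmax_le)
        show "0 \<le> lev k p + p \<bullet> (x - c)"
          using slope[OF p x] runmax_ge_level[of "M / 4" "\<lambda>j. height (v j) c R p" k]
          unfolding lev_def by linarith
        fix j assume j: "j \<le> k"
        have "v j x - p \<bullet> (x - c) \<le> height (v j) c R p"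
          by (rule height_upper[OF cv x]) (use j k in simp)
        also have "\<dots> \<le> lev k p"
          unfolding lev_def by (rule runmax_ge[OF j])
        finally show "v j x \<le> lev k p + p \<bullet> (x - c)" by simp
      qed
      then show ?thesis by simp
    qed
    then have "F k p \<le> v (Suc k) x - runmax 0 (\<lambda>j. v j x) k"
      using Feq eq by linarith
    then show "F k (G (Suc k) x) \<le> \<delta> k x"
      unfolding Gx \<delta>_def by simp
  qed
  have c\<Gamma>: "compact (\<Gamma> k)" if "k < N" for k
  proof -
    have kN: "Suc k \<le> N" using that by simp
    have cl: "closed {x \<in> cball c R. G (Suc k) x \<in> A}"
      using continuous_closed_preimage[OF cG[OF kN] closed_cball compact_imp_closed[OF cA]]
      by (simp add: vimage_def Int_def)
    have ch: "continuous_on (cball c R) (\<lambda>x. v (Suc k) x - G (Suc k) x \<bullet> (x - c) - height (v (Suc k)) c R (G (Suc k) x))"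
      by (intro continuous_intros cv[OF kN] cG[OF kN]
          continuous_on_compose2[OF continuous_on_height[OF cv[OF kN] R0, of UNIV] cG[OF kN]]) auto
    have "closed {x \<in> cball c R. v (Suc k) x - G (Suc k) x \<bullet> (x - c) - height (v (Suc k)) c R (G (Suc k) x) \<in> {0}}"
      using continuous_closed_preimage[OF ch closed_cball closed_singleton[of 0]]
      by (simp add: vimage_def Int_def)
    from closed_Int[OF cl this] have "closed (\<Gamma> k)"
      by (rule back_subst[of closed]) (auto simp: \<Gamma>_def)
    moreover have "\<Gamma> k = cball c R \<inter> \<Gamma> k" by (auto simp: \<Gamma>_def)
    ultimately show ?thesis by (metis compact_Int_closed compact_cball)
  qed
  have \<Gamma>sub: "\<Gamma> k \<subseteq> cball c R" for k by (auto simp: \<Gamma>_def)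
  have \<Gamma>A: "G (Suc k) ` \<Gamma> k \<subseteq> A" for k by (auto simp: \<Gamma>_def)
  have cE: "continuous_on (\<Gamma> k) (E k)" if "k < N" for k
    unfolding E_def using that
    by (intro continuous_intros continuous_on_trace continuous_on_subset[OF contH \<Gamma>sub]
        continuous_on_compose2[OF cf continuous_on_subset[OF cG \<Gamma>sub] \<Gamma>A]) auto
  have area: "(\<integral>\<^sup>+p\<in>A. ennreal (f k p) \<partial>lborel) \<le> (\<integral>\<^sup>+x\<in>\<Gamma> k. ennreal (E k x) \<partial>lborel)" if k: "k < N" for k
  proof -
    have kN: "Suc k \<le> N" using k by simp
    have "(\<integral>\<^sup>+p\<in>A. ennreal (f k p) \<partial>lborel) \<le> (\<integral>\<^sup>+p\<in>G (Suc k) ` \<Gamma> k. ennreal (f k p) \<partial>lborel)"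
    proof (rule nn_integral_mono)
      fix p
      show "ennreal (f k p) * indicator A p \<le> ennreal (f k p) * indicator (G (Suc k) ` \<Gamma> k) p"
      proof (cases "p \<in> A \<and> 0 < F k p")
        case True
        obtain x where x: "x \<in> cball c R" "height (v (Suc k)) c R p = v (Suc k) x - p \<bullet> (x - c)"
          using height_attained[OF cv[OF kN] R0] by blast
        have "G (Suc k) x = p"
          using contact(4)[OF k _ x(1)] True x(2) by simp
        then have "p \<in> G (Suc k) ` \<Gamma> k"
          using x True by (auto simp: \<Gamma>_def intro!: image_eqI[of _ _ x])
        then show ?thesis by (simp add: indicator_def)
      next
        case False
        then show ?thesis using F0[of k p] by (auto simp: f_def indicator_def)
      qed
    qed
    also have "\<dots> \<le> (\<integral>\<^sup>+x\<in>\<Gamma> k. ennreal (E k x) \<partial>lborel)"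
      unfolding E_def n_def
    proof (rule gradient_image_le_trace[OF c\<Gamma>[OF k]])
      show "(G (Suc k) has_derivative (\<lambda>h. H (Suc k) x *v h)) (at x within \<Gamma> k)" if "x \<in> \<Gamma> k" for x
        using hess[OF kN] \<Gamma>sub that has_derivative_at_withinI by blast
      show "continuous_on (\<Gamma> k) (H (Suc k))"
        by (rule continuous_on_subset[OF contH[OF kN] \<Gamma>sub])
      show "continuous_on (G (Suc k) ` \<Gamma> k) (f k)"
        by (rule continuous_on_subset[OF cf[OF k] \<Gamma>A])
      show "0 \<le> f k (G (Suc k) x)" for x by (rule f0)
      show "transpose (- H (Suc k) x) = - H (Suc k) x \<and> nonneg_form (- H (Suc k) x)"
        if x: "x \<in> \<Gamma> k" and fx: "f k (G (Suc k) x) \<noteq> 0" for x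
      proof
        have "transpose (H (Suc k) x) = H (Suc k) x"
          using sym[OF kN] \<Gamma>sub x by blast
        then show "transpose (- H (Suc k) x) = - H (Suc k) x"
          by (simp add: transpose_def vec_eq_iff)
        have "0 < F k (G (Suc k) x)"
        proof -
          have "F k (G (Suc k) x) \<noteq> 0" using fx by (metis f_def div_0)
          then show ?thesis using F0[of k "G (Suc k) x"] by linarith
        qed
        then show "nonneg_form (- H (Suc k) x)"
          using contact(5)[OF k] x by (auto simp: \<Gamma>_def)
      qed
    qed
    finally show ?thesis .
  qed
  have pointwise: "AE x in lborel. \<forall>k<N. ennreal (E k x) * indicator (\<Gamma> k) x
      \<le> ennreal (C * Q x * \<delta> k x) * indicator (cball c R) x + ennreal (C * Z) * indicator (U k) x"
    using pde
  proof eventually_elim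
    fix x
    assume P: "\<forall>k<N. x \<in> ball c R \<longrightarrow> 0 < v (Suc k) x \<longrightarrow> 0 < \<delta> k x \<longrightarrow>
        nonneg_form (- H (Suc k) x) \<longrightarrow>
        \<delta> k x / \<tau> + trace (- H (Suc k) x) / \<nu> \<le> B x * (norm (G (Suc k) x) + \<gamma> * w x) + \<eta>"
    show "\<forall>k<N. ennreal (E k x) * indicator (\<Gamma> k) x
      \<le> ennreal (C * Q x * \<delta> k x) * indicator (cball c R) x + ennreal (C * Z) * indicator (U k) x"
    proof (intro allI impI)
      fix k assume k: "k < N"
      show "ennreal (E k x) * indicator (\<Gamma> k) x
        \<le> ennreal (C * Q x * \<delta> k x) * indicator (cball c R) x + ennreal (C * Z) * indicator (U k) x"
      proof (cases "x \<in> \<Gamma> k \<and> 0 < F k (G (Suc k) x)")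
        case True
        then have x: "x \<in> cball c R" "G (Suc k) x \<in> A"
            "v (Suc k) x - G (Suc k) x \<bullet> (x - c) = height (v (Suc k)) c R (G (Suc k) x)"
          and Fp: "0 < F k (G (Suc k) x)" by (auto simp: \<Gamma>_def)
        note con = contact[OF k x(2,1) Fp x(3)]
        have "trace (- H (Suc k) x) ^ n * (F k (G (Suc k) x) / norm (G (Suc k) x) ^ n) \<le>
            (2 * \<nu>) ^ n * (\<delta> k x * Q x + Z)"
          unfolding Q_def Z_def
        proof (rule trace_power_increment_le)
          show "\<delta> k x / \<tau> + trace (- H (Suc k) x) / \<nu> \<le> B x * (norm (G (Suc k) x) + \<gamma> * w x) + \<eta>"
            using P k con Fp by force
          show "\<kappa> \<le> norm (G (Suc k) x)" using x(2) by (simp add: A_def)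
        qed (use con(3) pos nonneg F0 trace_nonneg[OF con(5)] in simp_all)
        then have "fact n * (trace (- H (Suc k) x) ^ n * (F k (G (Suc k) x) / norm (G (Suc k) x) ^ n)) \<le>
            fact n * ((2 * \<nu>) ^ n * (\<delta> k x * Q x + Z))"
          by (rule mult_left_mono) simp
        then have "E k x \<le> C * Q x * \<delta> k x + C * Z"
          unfolding E_def f_def C_def by (simp add: algebra_simps)
        then have "ennreal (E k x) \<le> ennreal (C * Q x * \<delta> k x) + ennreal (C * Z)"
          using C0 Q0[of x] Z0 \<delta>0[of k x] ennreal_leI[of "E k x" "C * Q x * \<delta> k x + C * Z"]
          by (simp add: ennreal_plus)
        moreover have "x \<in> U k" using con by (simp add: U_def)
        ultimately show ?thesis using x True by simp
      next
        case False
        then show ?thesis using F0[of k "G (Suc k) x"]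
          by (auto simp: E_def f_def indicator_def)
      qed
    qed
  qed
  have sum_le: "AE x in lborel. (\<Sum>k<N. ennreal (E k x) * indicator (\<Gamma> k) x) \<le>
      ennreal (C * M) * (ennreal (Q x) * indicator (cball c R) x) + (\<Sum>k<N. ennreal (C * Z) * indicator (U k) x)"
    using pointwise
  proof eventually_elim
    fix x
    assume "\<forall>k<N. ennreal (E k x) * indicator (\<Gamma> k) x
      \<le> ennreal (C * Q x * \<delta> k x) * indicator (cball c R) x + ennreal (C * Z) * indicator (U k) x"
    then have "(\<Sum>k<N. ennreal (E k x) * indicator (\<Gamma> k) x) \<le>
       (\<Sum>k<N. ennreal (C * Q x * \<delta> k x) * indicator (cball c R) x + ennreal (C * Z) * indicator (U k) x)"
      by (intro sum_mono) auto
    also have "\<dots> = (\<Sum>k<N. ennreal (C * Q x * \<delta> k x)) * indicator (cball c R) x + (\<Sum>k<N. ennreal (C * Z) * indicator (U k) x)"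
      by (simp add: sum.distrib sum_distrib_right)
    also have "(\<Sum>k<N. ennreal (C * Q x * \<delta> k x)) * indicator (cball c R) x \<le>
        ennreal (C * M) * (ennreal (Q x) * indicator (cball c R) x)"
    proof (cases "x \<in> cball c R")
      case True
      have "(\<Sum>k<N. \<delta> k x) = runmax 0 (\<lambda>j. v j x) N - runmax 0 (\<lambda>j. v j x) 0"
        unfolding \<delta>_def by (rule sum_runmax_increments)
      also have "\<dots> \<le> M"
      proof -
        have "runmax 0 (\<lambda>j. v j x) N \<le> M"
          by (rule runmax_le) (use pos bound True in auto)
        then show ?thesis using runmax_ge_level[of 0 "\<lambda>j. v j x" 0] by linarith
      qed
      finally have "C * Q x * (\<Sum>k<N. \<delta> k x) \<le> C * Q x * M"
        using C0 Q0 by (intro mult_left_mono) auto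
      then have "ennreal (\<Sum>k<N. C * Q x * \<delta> k x) \<le> ennreal (C * M * Q x)"
        by (intro ennreal_leI) (simp add: sum_distrib_left mult_ac)
      then show ?thesis
        using True C0 Q0 \<delta>0 pos by (simp add: sum_ennreal ennreal_mult'[symmetric])
    qed simp
    finally show "(\<Sum>k<N. ennreal (E k x) * indicator (\<Gamma> k) x) \<le>
      ennreal (C * M) * (ennreal (Q x) * indicator (cball c R) x) + (\<Sum>k<N. ennreal (C * Z) * indicator (U k) x)"
      by (simp add: add_right_mono)
  qed
  have U_meas: "U k \<in> sets lborel" if "k < N" for k
  proof -
    have "open (ball c R \<inter> v (Suc k) -` {0<..})"
      using that continuous_on_subset[OF cv sub]
      by (intro continuous_open_preimage) auto
    moreover have "U k = ball c R \<inter> v (Suc k) -` {0<..}" by (auto simp: U_def)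
    ultimately show ?thesis by simp
  qed
  have m\<Gamma>: "(\<lambda>x. ennreal (E k x) * indicator (\<Gamma> k) x) \<in> borel_measurable lborel" if "k < N" for k
    using borel_measurable_compact_indicator[OF c\<Gamma>[OF that] cE[OF that]] by simp
  have mf: "(\<lambda>p. ennreal (f k p) * indicator A p) \<in> borel_measurable lborel" if "k < N" for k
    using borel_measurable_compact_indicator[OF cA cf[OF that]] by simp
  have cw: "continuous_on A (\<lambda>p. 1 / norm p ^ n)"
    using np by (intro continuous_intros) auto
  have mw: "(\<lambda>p. ennreal (1 / norm p ^ n) * indicator A p) \<in> borel_measurable lborel"
    using borel_measurable_compact_indicator[OF cA cw] by simp
  have [measurable]: "cball c R \<in> sets borel" by simp
  note [measurable] = meas
  have mQ: "(\<lambda>x. ennreal (C * M) * (ennreal (Q x) * indicator (cball c R) x)) \<in> borel_measurable lborel"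
    unfolding Q_def by measurable
  have "ennreal (M / 2) * (\<integral>\<^sup>+p\<in>A. ennreal (1 / norm p ^ n) \<partial>lborel)
      = (\<integral>\<^sup>+p. ennreal (M / 2) * (ennreal (1 / norm p ^ n) * indicator A p) \<partial>lborel)"
    by (rule nn_integral_cmult[OF mw, symmetric])
  also have "\<dots> \<le> (\<integral>\<^sup>+p. (\<Sum>k<N. ennreal (f k p) * indicator A p) \<partial>lborel)"
  proof (rule nn_integral_mono)
    fix p
    show "ennreal (M / 2) * (ennreal (1 / norm p ^ n) * indicator A p) \<le> (\<Sum>k<N. ennreal (f k p) * indicator A p)"
    proof (cases "p \<in> A")
      case True
      have "M / 2 * (1 / norm p ^ n) \<le> (\<Sum>k<N. F k p) * (1 / norm p ^ n)"
        using climb[OF True] by (intro mult_right_mono) auto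
      also have "\<dots> = (\<Sum>k<N. f k p)"
        by (simp add: f_def sum_divide_distrib)
      finally have "ennreal (M / 2 * (1 / norm p ^ n)) \<le> ennreal (\<Sum>k<N. f k p)"
        by (rule ennreal_leI)
      then show ?thesis
        using True f0 pos by (simp add: sum_ennreal ennreal_mult'[symmetric])
    qed simp
  qed
  also have "\<dots> = (\<Sum>k<N. \<integral>\<^sup>+p\<in>A. ennreal (f k p) \<partial>lborel)"
    by (rule nn_integral_sum) (use mf in simp)
  also have "\<dots> \<le> (\<Sum>k<N. \<integral>\<^sup>+x\<in>\<Gamma> k. ennreal (E k x) \<partial>lborel)"
    by (rule sum_mono) (use area in simp)
  also have "\<dots> = (\<integral>\<^sup>+x. (\<Sum>k<N. ennreal (E k x) * indicator (\<Gamma> k) x) \<partial>lborel)"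
    by (rule nn_integral_sum[symmetric]) (use m\<Gamma> in simp)
  also have "\<dots> \<le> (\<integral>\<^sup>+x. ennreal (C * M) * (ennreal (Q x) * indicator (cball c R) x)
      + (\<Sum>k<N. ennreal (C * Z) * indicator (U k) x) \<partial>lborel)"
    by (rule nn_integral_mono_AE[OF sum_le])
  also have "\<dots> = (\<integral>\<^sup>+x. ennreal (C * M) * (ennreal (Q x) * indicator (cball c R) x) \<partial>lborel)
      + (\<integral>\<^sup>+x. (\<Sum>k<N. ennreal (C * Z) * indicator (U k) x) \<partial>lborel)"
    using U_meas by (intro nn_integral_add mQ borel_measurable_sum) auto
  also have "(\<integral>\<^sup>+x. (\<Sum>k<N. ennreal (C * Z) * indicator (U k) x) \<partial>lborel)
      = (\<Sum>k<N. ennreal (C * Z) * emeasure lborel (U k))"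
    using U_meas by (subst nn_integral_sum) (auto simp: nn_integral_cmult_indicator)
  also have "\<dots> = ennreal (C * Z) * (\<Sum>k<N. emeasure lborel (U k))"
    by (simp add: sum_distrib_left)
  also have "(\<integral>\<^sup>+x. ennreal (C * M) * (ennreal (Q x) * indicator (cball c R) x) \<partial>lborel)
      = (\<integral>\<^sup>+x. ennreal (C * 2 ^ n * M) * (ennreal (B x ^ n) * indicator (cball c R) x +
          ennreal ((\<gamma> / \<kappa>) ^ n) * (ennreal ((B x * w x) ^ n) * indicator (cball c R) x)) \<partial>lborel)"
  proof (rule nn_integral_cong)
    fix x
    have "ennreal (C * M) * ennreal (Q x) = ennreal (C * 2 ^ n * M * (B x ^ n + (\<gamma> / \<kappa>) ^ n * (B x * w x) ^ n))"
      using C0 pos Q0 by (subst ennreal_mult[symmetric]) (auto simp: Q_def mult_ac)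
    also have "\<dots> = ennreal (C * 2 ^ n * M) * (ennreal (B x ^ n) + ennreal ((\<gamma> / \<kappa>) ^ n) * ennreal ((B x * w x) ^ n))"
      using C0 pos nonneg by (simp add: ennreal_mult ennreal_plus)
    finally show "ennreal (C * M) * (ennreal (Q x) * indicator (cball c R) x) =
       ennreal (C * 2 ^ n * M) * (ennreal (B x ^ n) * indicator (cball c R) x +
          ennreal ((\<gamma> / \<kappa>) ^ n) * (ennreal ((B x * w x) ^ n) * indicator (cball c R) x))"
      by (auto simp: indicator_def)
  qed
  also have "\<dots> = ennreal (C * 2 ^ n * M) * ((\<integral>\<^sup>+x\<in>cball c R. ennreal (B x ^ n) \<partial>lborel) +
          ennreal ((\<gamma> / \<kappa>) ^ n) * (\<integral>\<^sup>+x\<in>cball c R. ennreal ((B x * w x) ^ n) \<partial>lborel))"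
    by (simp add: nn_integral_cmult nn_integral_add)
  finally show ?thesis
    unfolding A_def C_def Z_def U_def n_def .
qed

section \<open>Functions with continuous partial derivatives\<close>

lemma partial_derivative_on_line:
  fixes f :: "'a::real_normed_vector \<Rightarrow> real"
  assumes "((\<lambda>h. f ((x + a *\<^sub>R e) + h *\<^sub>R e)) has_real_derivative D) (at 0)"
  shows "((\<lambda>s. f (x + s *\<^sub>R e)) has_real_derivative D) (at a)"
  using DERIV_shift[of "\<lambda>s. f (x + s *\<^sub>R e)" D 0 a] assms
  by (simp add: scaleR_add_left add_ac)

definition coords_part :: "'n set \<Rightarrow> real ^ 'n \<Rightarrow> real ^ 'n" where
  "coords_part S h = (\<chi> j. if j \<in> S then h $ j else 0)"

lemma coords_part_UNIV [simp]: "coords_part UNIV h = h"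
  by (simp add: coords_part_def vec_eq_iff)

lemma coords_part_insert:
  "i \<notin> S \<Longrightarrow> coords_part (insert i S) h = coords_part S h + h $ i *\<^sub>R axis i 1"
  by (auto simp: coords_part_def vec_eq_iff axis_def)

lemma norm_coords_part_le:
  assumes "i \<notin> S" "\<bar>s\<bar> \<le> \<bar>h $ i\<bar>"
  shows "norm (coords_part S h + s *\<^sub>R axis i 1) \<le> norm h"
  using assms by (intro norm_le_componentwise_cart) (auto simp: coords_part_def axis_def)

text \<open>The coordinates of the increment are switched on one at a time, with the mean value inequality
  along each coordinate direction.\<close>

lemma has_derivative_continuous_partials:
  fixes f :: "real ^ 'n \<Rightarrow> real"
  assumes W: "open W" and x: "x \<in> W"
    and d: "\<And>i y. y \<in> W \<Longrightarrow> ((\<lambda>h. f (y + h *\<^sub>R axis i 1)) has_real_derivative g i y) (at 0)"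
    and c: "\<And>i. continuous_on W (g i)"
  shows "(f has_derivative (\<lambda>h. \<Sum>i\<in>UNIV. g i x * h $ i)) (at x)"
proof -
  have main: "\<forall>e>0. \<exists>\<delta>>0. \<forall>h. norm h < \<delta> \<longrightarrow>
      \<bar>f (x + coords_part S h) - f x - (\<Sum>i\<in>S. g i x * h $ i)\<bar> \<le> e * norm h" if "finite S" for S
    using that
  proof (induction S rule: finite_induct)
    case empty
    show ?case
      by (intro allI impI exI[of _ 1]) (simp add: coords_part_def vec_eq_iff zero_vec_def[symmetric])
  next
    case (insert i S)
    show ?case
    proof (intro allI impI)
      fix e :: real
      assume e: "e > 0"
      obtain \<delta>1 where \<delta>1: "\<delta>1 > 0" "\<And>h. norm h < \<delta>1 \<Longrightarrow>
          \<bar>f (x + coords_part S h) - f x - (\<Sum>i\<in>S. g i x * h $ i)\<bar> \<le> e / 2 * norm h"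
        using insert.IH e by (metis half_gt_zero)
      obtain \<delta>2 where \<delta>2: "\<delta>2 > 0" "ball x \<delta>2 \<subseteq> W"
        using W x open_contains_ball by blast
      obtain \<delta>3 where \<delta>3: "\<delta>3 > 0" "\<And>y. y \<in> W \<Longrightarrow> dist y x < \<delta>3 \<Longrightarrow> dist (g i y) (g i x) < e / 2"
        using c[of i] x e unfolding continuous_on_iff by (metis half_gt_zero)
      define \<delta> where "\<delta> = min \<delta>1 (min \<delta>2 \<delta>3)"
      have "\<bar>f (x + coords_part (insert i S) h) - f x - (\<Sum>j\<in>insert i S. g j x * h $ j)\<bar> \<le> e * norm h"
        if h: "norm h < \<delta>" for h
      proof -
        define z where "z = x + coords_part S h"
        have close: "z + s *\<^sub>R axis i 1 \<in> W" "\<bar>g i (z + s *\<^sub>R axis i 1) - g i x\<bar> \<le> e / 2"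
          if s: "\<bar>s\<bar> \<le> \<bar>h $ i\<bar>" for s
        proof -
          have "dist (z + s *\<^sub>R axis i 1) x < \<delta>"
            using norm_coords_part_le[OF insert.hyps(2) s] h by (simp add: z_def dist_norm add.assoc)
          then show W': "z + s *\<^sub>R axis i 1 \<in> W"
            using \<delta>2 by (auto simp: \<delta>_def subset_iff dist_commute)
          show "\<bar>g i (z + s *\<^sub>R axis i 1) - g i x\<bar> \<le> e / 2"
            using \<delta>3(2)[OF W'] \<open>dist _ x < \<delta>\<close> by (simp add: \<delta>_def dist_norm)
        qed
        define I where "I = {s. \<bar>s\<bar> \<le> \<bar>h $ i\<bar>}"
        have "I = {-\<bar>h $ i\<bar>..\<bar>h $ i\<bar>}" by (auto simp: I_def)
        then have cI: "convex I" by simp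
        have "norm ((f (z + (h $ i) *\<^sub>R axis i 1) - g i x * h $ i) - (f (z + 0 *\<^sub>R axis i 1) - g i x * 0))
            \<le> e / 2 * norm (h $ i - 0)"
        proof (rule field_differentiable_bound[OF cI])
          fix s assume "s \<in> I"
          then have s: "\<bar>s\<bar> \<le> \<bar>h $ i\<bar>" by (simp add: I_def)
          have "((\<lambda>s. f (z + s *\<^sub>R axis i 1)) has_real_derivative g i (z + s *\<^sub>R axis i 1)) (at s)"
            by (rule partial_derivative_on_line[OF d[OF close(1)[OF s]]])
          then have "((\<lambda>s. f (z + s *\<^sub>R axis i 1) - g i x * s) has_real_derivative
              g i (z + s *\<^sub>R axis i 1) - g i x) (at s)"
            by (auto intro!: derivative_eq_intros)
          then show "((\<lambda>s. f (z + s *\<^sub>R axis i 1) - g i x * s) has_real_derivative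
              g i (z + s *\<^sub>R axis i 1) - g i x) (at s within I)"
            by (rule has_field_derivative_at_within)
          show "norm (g i (z + s *\<^sub>R axis i 1) - g i x) \<le> e / 2"
            using close(2)[OF s] by simp
        qed (auto simp: I_def)
        then have A: "\<bar>f (z + (h $ i) *\<^sub>R axis i 1) - f z - g i x * h $ i\<bar> \<le> e / 2 * \<bar>h $ i\<bar>"
          by (simp add: algebra_simps)
        have B: "\<bar>f z - f x - (\<Sum>j\<in>S. g j x * h $ j)\<bar> \<le> e / 2 * norm h"
          using \<delta>1(2)[of h] h by (simp add: z_def \<delta>_def)
        have "e / 2 * \<bar>h $ i\<bar> \<le> e / 2 * norm h"
          using e component_le_norm_cart[of h i] by (intro mult_left_mono) auto
        moreover have "f (x + coords_part (insert i S) h) = f (z + (h $ i) *\<^sub>R axis i 1)"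
          by (simp add: coords_part_insert[OF insert.hyps(2)] z_def add.assoc)
        moreover have "e * norm h = e / 2 * norm h + e / 2 * norm h" by simp
        ultimately show ?thesis
          using A B insert.hyps unfolding sum.insert[OF insert.hyps] by linarith
      qed
      moreover have "\<delta> > 0" using \<delta>1 \<delta>2 \<delta>3 by (simp add: \<delta>_def)
      ultimately show "\<exists>\<delta>>0. \<forall>h. norm h < \<delta> \<longrightarrow>
          \<bar>f (x + coords_part (insert i S) h) - f x - (\<Sum>j\<in>insert i S. g j x * h $ j)\<bar> \<le> e * norm h"
        by blast
    qed
  qed
  have lin: "bounded_linear (\<lambda>h::real ^ 'n. \<Sum>i\<in>UNIV. g i x * h $ i)"
    by (intro bounded_linear_sum bounded_linear_const_mult bounded_linear_vec_nth)
  show ?thesis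
    unfolding has_derivative_at_alt
  proof (intro conjI lin allI impI)
    fix e :: real
    assume "e > 0"
    with main[OF finite_class.finite_UNIV] obtain \<delta> where "\<delta> > 0" and \<delta>: "\<And>h. norm h < \<delta> \<Longrightarrow>
      \<bar>f (x + h) - f x - (\<Sum>i\<in>UNIV. g i x * h $ i)\<bar> \<le> e * norm h"
      by auto
    show "\<exists>\<delta>>0. \<forall>y. norm (y - x) < \<delta> \<longrightarrow>
        norm (f y - f x - (\<Sum>i\<in>UNIV. g i x * (y - x) $ i)) \<le> e * norm (y - x)"
    proof (intro exI[of _ \<delta>] conjI allI impI \<open>\<delta> > 0\<close>)
      fix y assume "norm (y - x) < \<delta>"
      from \<delta>[OF this]
      show "norm (f y - f x - (\<Sum>i\<in>UNIV. g i x * (y - x) $ i)) \<le> e * norm (y - x)"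
        by simp
    qed
  qed
qed

text \<open>A mixed second difference is a value of the mixed second derivative nearby. It is symmetric in the
  two directions, which makes continuous mixed derivatives commute.\<close>

lemma mixed_difference_mean_value:
  fixes f :: "'a::real_normed_vector \<Rightarrow> real"
  assumes s: "0 < s"
    and in_W: "\<And>a b. 0 \<le> a \<Longrightarrow> a \<le> s \<Longrightarrow> 0 \<le> b \<Longrightarrow> b \<le> s \<Longrightarrow> x + a *\<^sub>R p + b *\<^sub>R q \<in> W"
    and d: "\<And>y. y \<in> W \<Longrightarrow> ((\<lambda>h. f (y + h *\<^sub>R p)) has_real_derivative g y) (at 0)"
    and dd: "\<And>y. y \<in> W \<Longrightarrow> ((\<lambda>h. g (y + h *\<^sub>R q)) has_real_derivative k y) (at 0)"
  obtains a b where "0 \<le> a" "a \<le> s" "0 \<le> b" "b \<le> s"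
    "f (x + s *\<^sub>R p + s *\<^sub>R q) - f (x + s *\<^sub>R p) - f (x + s *\<^sub>R q) + f x = s * s * k (x + a *\<^sub>R p + b *\<^sub>R q)"
proof -
  define \<phi> where "\<phi> = (\<lambda>a. f (x + a *\<^sub>R p + s *\<^sub>R q) - f (x + a *\<^sub>R p))"
  have d1: "((\<lambda>a. f (x + b *\<^sub>R q + a *\<^sub>R p)) has_real_derivative g (x + b *\<^sub>R q + a *\<^sub>R p)) (at a)"
    if "0 \<le> a" "a \<le> s" "0 \<le> b" "b \<le> s" for a b
    by (rule partial_derivative_on_line[OF d]) (use in_W[OF that] in \<open>simp add: add_ac\<close>)
  have d\<phi>: "(\<phi> has_real_derivative g (x + a *\<^sub>R p + s *\<^sub>R q) - g (x + a *\<^sub>R p)) (at a)"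
    if "0 \<le> a" "a \<le> s" for a
    using d1[of a s] d1[of a 0] that s unfolding \<phi>_def
    by (auto intro!: DERIV_diff simp: add_ac)
  obtain a where a: "0 < a" "a < s" "\<phi> s - \<phi> 0 = (s - 0) * (g (x + a *\<^sub>R p + s *\<^sub>R q) - g (x + a *\<^sub>R p))"
    using MVT2[OF s, of \<phi> "\<lambda>a. g (x + a *\<^sub>R p + s *\<^sub>R q) - g (x + a *\<^sub>R p)"] d\<phi> by blast
  define \<zeta> where "\<zeta> = (\<lambda>b. g (x + a *\<^sub>R p + b *\<^sub>R q))"
  have d\<zeta>: "(\<zeta> has_real_derivative k (x + a *\<^sub>R p + b *\<^sub>R q)) (at b)" if "0 \<le> b" "b \<le> s" for b
    unfolding \<zeta>_def by (rule partial_derivative_on_line[OF dd]) (use in_W[of a b] a that in auto)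
  obtain b where b: "0 < b" "b < s" "\<zeta> s - \<zeta> 0 = (s - 0) * k (x + a *\<^sub>R p + b *\<^sub>R q)"
    using MVT2[OF s, of \<zeta> "\<lambda>b. k (x + a *\<^sub>R p + b *\<^sub>R q)"] d\<zeta> by blast
  show ?thesis
    by (rule that[of a b]) (use a b in \<open>auto simp: \<phi>_def \<zeta>_def algebra_simps\<close>)
qed

lemma second_partials_commute:
  fixes f :: "'a::real_normed_vector \<Rightarrow> real"
  assumes W: "open W" and x: "x \<in> W"
    and dp: "\<And>y. y \<in> W \<Longrightarrow> ((\<lambda>h. f (y + h *\<^sub>R p)) has_real_derivative gp y) (at 0)"
    and dq: "\<And>y. y \<in> W \<Longrightarrow> ((\<lambda>h. f (y + h *\<^sub>R q)) has_real_derivative gq y) (at 0)"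
    and dpq: "\<And>y. y \<in> W \<Longrightarrow> ((\<lambda>h. gp (y + h *\<^sub>R q)) has_real_derivative gpq y) (at 0)"
    and dqp: "\<And>y. y \<in> W \<Longrightarrow> ((\<lambda>h. gq (y + h *\<^sub>R p)) has_real_derivative gqp y) (at 0)"
    and c: "continuous_on W gpq" "continuous_on W gqp"
  shows "gpq x = gqp x"
proof (rule ccontr)
  assume ne: "gpq x \<noteq> gqp x"
  define e where "e = \<bar>gpq x - gqp x\<bar> / 2"
  have e: "e > 0" using ne by (simp add: e_def)
  obtain \<delta>1 where \<delta>1: "\<delta>1 > 0" "\<And>y. y \<in> W \<Longrightarrow> dist y x < \<delta>1 \<Longrightarrow> dist (gpq y) (gpq x) < e"
    using c(1) x e unfolding continuous_on_iff by metis
  obtain \<delta>2 where \<delta>2: "\<delta>2 > 0" "\<And>y. y \<in> W \<Longrightarrow> dist y x < \<delta>2 \<Longrightarrow> dist (gqp y) (gqp x) < e"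
    using c(2) x e unfolding continuous_on_iff by metis
  obtain \<delta>3 where \<delta>3: "\<delta>3 > 0" "ball x \<delta>3 \<subseteq> W"
    using W x open_contains_ball by blast
  define \<delta> where "\<delta> = min \<delta>1 (min \<delta>2 \<delta>3)"
  have \<delta>: "\<delta> > 0" using \<delta>1 \<delta>2 \<delta>3 by (simp add: \<delta>_def)
  define s where "s = \<delta> / (2 * (norm p + norm q + 1))"
  have np: "0 < norm p + norm q + 1" by (simp add: add_nonneg_pos)
  have s: "s > 0" using \<delta> np by (simp add: s_def)
  have close: "dist (x + a *\<^sub>R p + b *\<^sub>R q) x < \<delta>" if "0 \<le> a" "a \<le> s" "0 \<le> b" "b \<le> s" for a b
  proof -
    have "dist (x + a *\<^sub>R p + b *\<^sub>R q) x = norm (a *\<^sub>R p + b *\<^sub>R q)" by (simp add: dist_norm add.assoc)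
    also have "\<dots> \<le> norm (a *\<^sub>R p) + norm (b *\<^sub>R q)" by (rule norm_triangle_ineq)
    also have "\<dots> = a * norm p + b * norm q" using that by simp
    also have "\<dots> \<le> s * norm p + s * norm q" using that by (intro add_mono mult_right_mono) auto
    also have "\<dots> \<le> s * (norm p + norm q + 1)" using s by (simp add: algebra_simps)
    also have "\<dots> = \<delta> / 2" using np unfolding s_def by (simp only: times_divide_eq_left mult.commute[of 2]
        mult.commute[of \<delta>]) (simp add: field_simps)
    finally show ?thesis using \<delta> by simp
  qed
  have in_W: "x + a *\<^sub>R p + b *\<^sub>R q \<in> W" if "0 \<le> a" "a \<le> s" "0 \<le> b" "b \<le> s" for a b
    using close[OF that] \<delta>3 by (auto simp: \<delta>_def subset_iff dist_commute)
  have in_W': "x + a *\<^sub>R q + b *\<^sub>R p \<in> W" if "0 \<le> a" "a \<le> s" "0 \<le> b" "b \<le> s" for a b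
    using in_W[OF that(3,4,1,2)] by (simp add: add_ac)
  obtain a b where ab: "0 \<le> a" "a \<le> s" "0 \<le> b" "b \<le> s"
    "f (x + s *\<^sub>R p + s *\<^sub>R q) - f (x + s *\<^sub>R p) - f (x + s *\<^sub>R q) + f x = s * s * gpq (x + a *\<^sub>R p + b *\<^sub>R q)"
    using mixed_difference_mean_value[OF s in_W dp dpq] by blast
  obtain b' a' where ab': "0 \<le> b'" "b' \<le> s" "0 \<le> a'" "a' \<le> s"
    "f (x + s *\<^sub>R q + s *\<^sub>R p) - f (x + s *\<^sub>R q) - f (x + s *\<^sub>R p) + f x = s * s * gqp (x + b' *\<^sub>R q + a' *\<^sub>R p)"
    using mixed_difference_mean_value[OF s in_W' dq dqp] by blast
  have "s * s * gpq (x + a *\<^sub>R p + b *\<^sub>R q) = s * s * gqp (x + a' *\<^sub>R p + b' *\<^sub>R q)"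
  proof -
    have "x + s *\<^sub>R q + s *\<^sub>R p = x + s *\<^sub>R p + s *\<^sub>R q"
      "x + b' *\<^sub>R q + a' *\<^sub>R p = x + a' *\<^sub>R p + b' *\<^sub>R q" by (simp_all add: add_ac)
    then show ?thesis using ab(5) ab'(5) by (simp only:)
  qed
  then have eq: "gpq (x + a *\<^sub>R p + b *\<^sub>R q) = gqp (x + a' *\<^sub>R p + b' *\<^sub>R q)"
    using s by simp
  have "dist (gpq (x + a *\<^sub>R p + b *\<^sub>R q)) (gpq x) < e"
    by (rule \<delta>1(2)[OF in_W[OF ab(1-4)]]) (use close[OF ab(1-4)] in \<open>simp add: \<delta>_def\<close>)
  moreover have "dist (gqp (x + a' *\<^sub>R p + b' *\<^sub>R q)) (gqp x) < e"
    by (rule \<delta>2(2)[OF in_W[OF ab'(3,4,1,2)]]) (use close[OF ab'(3,4,1,2)] in \<open>simp add: \<delta>_def\<close>)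
  ultimately show False
    unfolding eq dist_real_def e_def by (simp add: abs_if split: if_splits)
qed

section \<open>Spatial gradient and Hessian on a cylinder\<close>

definition gradx :: "((real ^ 'n) \<times> real \<Rightarrow> real) \<Rightarrow> (real ^ 'n) \<times> real \<Rightarrow> real ^ 'n" where
  "gradx u X = (\<chi> i. dx i u X)"

definition hessx :: "((real ^ 'n) \<times> real \<Rightarrow> real) \<Rightarrow> (real ^ 'n) \<times> real \<Rightarrow> real ^ 'n ^ 'n" where
  "hessx u X = (\<chi> i j. dx i (dx j u) X)"

lemma open_cylinder: "open (cylinder Y r)"
  unfolding cylinder_def by (intro open_Times) auto

lemma mem_cylinder: "(x, t) \<in> cylinder Y r \<longleftrightarrow> x \<in> ball (fst Y) r \<and> t \<in> {snd Y - r\<^sup>2 <..< snd Y}"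
  by (simp add: cylinder_def)

lemma extends_continuously_imp_continuous_on: "extends_continuously U f \<Longrightarrow> continuous_on U f"
  unfolding extends_continuously_def
  by (metis continuous_on_cong continuous_on_subset closure_subset)

context
  fixes u :: "(real ^ 'n) \<times> real \<Rightarrow> real" and Y r
  assumes u: "C21_closure (cylinder Y r) u"
begin

lemma cylinder_continuous:
  "continuous_on (cylinder Y r) u"
  "continuous_on (cylinder Y r) (dt u)"
  "continuous_on (cylinder Y r) (dx i u)"
  "continuous_on (cylinder Y r) (dx i (dx j u))"
  using u extends_continuously_imp_continuous_on[of "cylinder Y r"]
    continuous_on_subset[OF _ closure_subset[of "cylinder Y r"], where f=u]
  unfolding C21_closure_def by simp_all

lemma cylinder_slice_continuous:
  assumes "continuous_on (cylinder Y r) f" "t \<in> {snd Y - r\<^sup>2 <..< snd Y}"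
  shows "continuous_on (ball (fst Y) r) (\<lambda>x. f (x, t))"
  by (rule continuous_on_compose2[OF assms(1)]) (use assms(2) in \<open>auto intro!: continuous_intros simp: mem_cylinder\<close>)

lemma cylinder_dt:
  assumes "(x, t) \<in> cylinder Y r"
  shows "((\<lambda>t. u (x, t)) has_real_derivative dt u (x, t)) (at t)"
proof -
  have "dt_exists u (x, t)" using u assms unfolding C21_closure_def by blast
  then show ?thesis
    unfolding dt_exists_def dt_def by (simp add: DERIV_deriv_iff_field_differentiable)
qed

lemma cylinder_dx:
  assumes "(x, t) \<in> cylinder Y r"
  shows "((\<lambda>h. u (x + h *\<^sub>R axis i 1, t)) has_real_derivative dx i u (x, t)) (at 0)"
proof -
  have "dx_exists i u (x, t)" using u assms unfolding C21_closure_def by blast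
  then show ?thesis
    unfolding dx_exists_def dx_def by (simp add: DERIV_deriv_iff_field_differentiable)
qed

lemma cylinder_dxdx:
  assumes "(x, t) \<in> cylinder Y r"
  shows "((\<lambda>h. dx j u (x + h *\<^sub>R axis i 1, t)) has_real_derivative dx i (dx j u) (x, t)) (at 0)"
proof -
  have "dx_exists i (dx j u) (x, t)" using u assms unfolding C21_closure_def by blast
  then show ?thesis
    unfolding dx_exists_def dx_def[of i "dx j u"] by (simp add: DERIV_deriv_iff_field_differentiable)
qed

lemma cylinder_hess_sym:
  assumes X: "(x, t) \<in> cylinder Y r"
  shows "dx i (dx j u) (x, t) = dx j (dx i u) (x, t)"
proof -
  have t: "t \<in> {snd Y - r\<^sup>2 <..< snd Y}" and x: "x \<in> ball (fst Y) r"
    using X by (auto simp: mem_cylinder)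
  have mem: "(y, t) \<in> cylinder Y r" if "y \<in> ball (fst Y) r" for y
    using that t by (simp add: mem_cylinder)
  show ?thesis
    by (rule second_partials_commute[OF open_ball x, where f="\<lambda>x. u (x, t)" and p="axis j 1" and q="axis i 1"
          and gp="\<lambda>x. dx j u (x, t)" and gq="\<lambda>x. dx i u (x, t)"])
      (auto intro!: cylinder_dx cylinder_dxdx mem cylinder_slice_continuous[OF _ t] cylinder_continuous simp del: mem_ball)
qed

lemma transpose_hessx: "(x, t) \<in> cylinder Y r \<Longrightarrow> transpose (hessx u (x, t)) = hessx u (x, t)"
  by (simp add: transpose_def hessx_def vec_eq_iff cylinder_hess_sym)

lemma has_derivative_gradx:
  assumes X: "(x, t) \<in> cylinder Y r"
  shows "((\<lambda>x. u (x, t)) has_derivative (\<lambda>h. gradx u (x, t) \<bullet> h)) (at x)"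
proof -
  have t: "t \<in> {snd Y - r\<^sup>2 <..< snd Y}" and x: "x \<in> ball (fst Y) r"
    using X by (auto simp: mem_cylinder)
  have mem: "(y, t) \<in> cylinder Y r" if "y \<in> ball (fst Y) r" for y
    using that t by (simp add: mem_cylinder)
  have "((\<lambda>x. u (x, t)) has_derivative (\<lambda>h. \<Sum>i\<in>UNIV. dx i u (x, t) * h $ i)) (at x)"
    by (rule has_derivative_continuous_partials[OF open_ball x, where g="\<lambda>i x. dx i u (x, t)"])
      (auto intro!: cylinder_dx mem cylinder_slice_continuous[OF _ t] cylinder_continuous simp del: mem_ball)
  then show ?thesis by (simp add: gradx_def inner_vec_def)
qed

lemma has_derivative_hessx:
  assumes X: "(x, t) \<in> cylinder Y r"
  shows "((\<lambda>x. gradx u (x, t)) has_derivative (\<lambda>h. hessx u (x, t) *v h)) (at x)"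
proof -
  have t: "t \<in> {snd Y - r\<^sup>2 <..< snd Y}" and x: "x \<in> ball (fst Y) r"
    using X by (auto simp: mem_cylinder)
  have mem: "(y, t) \<in> cylinder Y r" if "y \<in> ball (fst Y) r" for y
    using that t by (simp add: mem_cylinder)
  have j: "((\<lambda>x. dx j u (x, t)) has_derivative (\<lambda>h. \<Sum>i\<in>UNIV. dx i (dx j u) (x, t) * h $ i)) (at x)" for j
    by (rule has_derivative_continuous_partials[OF open_ball x, where g="\<lambda>i x. dx i (dx j u) (x, t)"])
      (auto intro!: cylinder_dxdx mem cylinder_slice_continuous[OF _ t] cylinder_continuous simp del: mem_ball)
  have "((\<lambda>x. \<chi> j. dx j u (x, t)) has_derivative (\<lambda>h. \<chi> j. \<Sum>i\<in>UNIV. dx i (dx j u) (x, t) * h $ i)) (at x)"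
    using j by (subst has_derivative_componentwise_within) (auto simp: Basis_vec_def inner_axis)
  moreover have "(\<lambda>h. \<chi> j. \<Sum>i\<in>UNIV. dx i (dx j u) (x, t) * h $ i) = (\<lambda>h. hessx u (x, t) *v h)"
    by (simp add: fun_eq_iff hessx_def matrix_vector_mult_def vec_eq_iff cylinder_hess_sym[OF X])
  ultimately show ?thesis unfolding gradx_def by simp
qed

lemma continuous_on_hessx: "continuous_on (cylinder Y r) (hessx u)"
  unfolding hessx_def by (intro continuous_intros cylinder_continuous)

end

section \<open>A measurable majorant of the drift\<close>

lemma sets_lborel_pair:
  "sets ((lborel :: 'a::euclidean_space measure) \<Otimes>\<^sub>M (lborel :: 'b::euclidean_space measure)) = sets borel"
  by (simp only: lborel_prod sets_lborel)

lemma AE_lborel_pair_commute: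
  fixes P :: "'a::euclidean_space \<Rightarrow> 'b::euclidean_space \<Rightarrow> bool"
  assumes "AE x in lborel. AE y in lborel. P x y"
    and "{z. P (fst z) (snd z)} \<in> sets borel"
  shows "AE y in lborel. AE x in lborel. P x y"
proof -
  have "{z \<in> space (lborel \<Otimes>\<^sub>M lborel). P (fst z) (snd z)} \<in> sets (lborel \<Otimes>\<^sub>M lborel)"
    unfolding sets_lborel_pair using assms(2) by (simp add: space_pair_measure)
  then show ?thesis
    using lborel_pair.AE_commute[of P] assms(1) by simp
qed

lemma AE_lborel_sections:
  fixes P :: "'a::euclidean_space \<times> 'b::euclidean_space \<Rightarrow> bool"
  assumes "AE z in lborel. P z"
  shows "AE x in lborel. AE y in lborel. P (x, y)" "AE y in lborel. AE x in lborel. P (x, y)"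
proof -
  obtain N where N: "{z. \<not> P z} \<subseteq> N" "N \<in> null_sets lborel"
    using assms unfolding eventually_ae_filter by auto
  have "AE z in lborel. z \<notin> N" by (rule AE_not_in[OF N(2)])
  then have "AE z in lborel \<Otimes>\<^sub>M lborel. z \<notin> N" by (simp only: lborel_prod)
  then have 1: "AE x in lborel. AE y in lborel. (x, y) \<notin> N"
    by (rule lborel_pair.AE_pair)
  have "- N \<in> sets borel" using null_setsD2[OF N(2)] by (simp add: borel_comp)
  moreover have "{z. (fst z, snd z) \<notin> N} = - N" by auto
  ultimately have 2: "AE y in lborel. AE x in lborel. (x, y) \<notin> N"
    by (intro AE_lborel_pair_commute[OF 1]) simp
  show "AE x in lborel. AE y in lborel. P (x, y)"
    using 1
  proof eventually_elim
    case (elim z)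
    then show ?case by eventually_elim (use N(1) in auto)
  qed
  show "AE y in lborel. AE x in lborel. P (x, y)"
    using 2
  proof eventually_elim
    case (elim z)
    then show ?case by eventually_elim (use N(1) in auto)
  qed
qed

text \<open>The least essential upper bound of each section, formed with rational levels only: an infimum over a
  countable set of levels depends measurably on x.\<close>

lemma measurable_sectional_bound:
  fixes g :: "'a::euclidean_space \<times> 'b::euclidean_space \<Rightarrow> real"
  assumes g: "g \<in> borel_measurable borel"
  obtains \<beta> :: "'a \<Rightarrow> ennreal" where "\<beta> \<in> borel_measurable borel"
    "\<And>x. AE t in lborel. ennreal (g (x, t)) \<le> \<beta> x"
    "\<And>x z. AE t in lborel. ennreal (g (x, t)) \<le> z \<Longrightarrow> \<beta> x \<le> z"
proof -
  define L where "L = (\<lambda>q::rat. \<lambda>x. emeasure lborel {t. real_of_rat q < g (x, t)})"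
  define \<beta> where "\<beta> = (\<lambda>x. INF q\<in>{0..}. if L q x = 0 then ennreal (real_of_rat q) else \<infinity>)"
  have Lm: "L q \<in> borel_measurable borel" for q
  proof -
    have "{z. real_of_rat q < g z} \<in> sets borel"
      using g borel_measurable_less[of "\<lambda>_. real_of_rat q" borel g] by simp
    then have "{z. real_of_rat q < g z} \<in> sets ((lborel :: 'a measure) \<Otimes>\<^sub>M (lborel :: 'b measure))"
      by (simp only: sets_lborel_pair)
    from lborel.measurable_emeasure_Pair[OF this]
    show ?thesis by (simp add: L_def vimage_def)
  qed
  have sec: "{t. real_of_rat q < g (x, t)} \<in> sets borel" for q x
  proof -
    have "(\<lambda>t. g (x, t)) \<in> borel_measurable borel"
      using g by (rule measurable_compose[rotated]) (auto intro!: borel_measurable_continuous_onI continuous_intros)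
    then show ?thesis
      using borel_measurable_less[of "\<lambda>_. real_of_rat q" borel "\<lambda>t. g (x, t)"] by simp
  qed
  have L0: "L q x = 0 \<longleftrightarrow> (AE t in lborel. g (x, t) \<le> real_of_rat q)" for q x
    unfolding L_def using sec[of q x] by (subst AE_iff_measurable[OF _ refl]) (auto simp: not_le)
  show ?thesis
  proof (rule that[of \<beta>])
    have "countable {0::rat..}" by (rule countable_subset[OF subset_UNIV]) simp
    then show "\<beta> \<in> borel_measurable borel"
      unfolding \<beta>_def
      by (intro borel_measurable_INF measurable_If borel_measurable_const)
         (use borel_measurable_eq[OF Lm borel_measurable_const[of 0]] in auto)
    show "AE t in lborel. ennreal (g (x, t)) \<le> \<beta> x" for x
    proof -
      have "AE t in lborel. \<forall>q::rat. L q x = 0 \<longrightarrow> g (x, t) \<le> real_of_rat q"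
        using L0 by (auto simp: AE_all_countable)
      then show ?thesis
        unfolding \<beta>_def
        by eventually_elim (intro INF_greatest, simp add: ennreal_leI)
    qed
    show "\<beta> x \<le> z" if z: "AE t in lborel. ennreal (g (x, t)) \<le> z" for x z
    proof (rule ennreal_le_epsilon)
      fix e :: real
      assume fin: "z < top" and e: "0 < e"
      then obtain z' where z': "z = ennreal z'" "0 \<le> z'"
        by (cases z) auto
      obtain q where q: "z' < real_of_rat q" "real_of_rat q < z' + e"
        using of_rat_dense[of z' "z' + e"] e by auto
      have "AE t in lborel. g (x, t) \<le> real_of_rat q"
        using z
      proof eventually_elim
        case (elim t)
        then have "g (x, t) \<le> z'" unfolding z'(1) by (simp only: ennreal_le_iff[OF z'(2)])
        then show ?case using q by linarith
      qed
      then have "L q x = 0" using L0 by simp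
      moreover have "0 \<le> q" using q(1) z'(2) by (metis le_less_trans less_imp_le zero_le_of_rat_iff)
      ultimately have "\<beta> x \<le> ennreal (real_of_rat q)"
        unfolding \<beta>_def by (intro INF_lower2[of q]) auto
      also have "\<dots> \<le> z + ennreal e"
        using q z' e by (simp add: ennreal_plus[symmetric] ennreal_leI del: ennreal_plus)
      finally show "\<beta> x \<le> z + ennreal e" .
    qed
  qed
qed

text \<open>A Borel representative of \<open>\<bar>b\<bar>\<close> has the same essential suprema on almost every line parallel to the
  time axis, and these depend measurably on x. Exchanging the order of the two almost everywhere
  quantifiers makes the bound available at almost every fixed time.\<close>

lemma drift_majorant:
  fixes b :: "(real ^ 'n) \<times> real \<Rightarrow> real ^ 'n"
  assumes Q: "open Q"
    and b: "\<And>i. (\<lambda>X. b X $ i) \<in> borel_measurable (lebesgue_on Q)"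
    and S: "drift_integral Q b = ennreal S"
  obtains B :: "real ^ 'n \<Rightarrow> real" where "B \<in> borel_measurable borel" "\<And>x. 0 \<le> B x"
    "(\<integral>\<^sup>+x. ennreal (B x ^ CARD('n)) \<partial>lborel) \<le> ennreal S"
    "AE t in lborel. AE x in lborel. (x, t) \<in> Q \<longrightarrow> norm (b (x, t)) \<le> B x"
proof -
  define h where "h = (\<lambda>X. if X \<in> Q then norm (b X) else 0)"
  have Ql: "Q \<in> sets lebesgue" using Q by simp
  have "(\<lambda>X. sqrt (\<Sum>i\<in>UNIV. (b X $ i)\<^sup>2)) \<in> borel_measurable (lebesgue_on Q)"
    using b by measurable
  then have "(\<lambda>X. norm (b X)) \<in> borel_measurable (lebesgue_on Q)"
    by (simp add: norm_vec_def L2_set_def)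
  then have "h \<in> borel_measurable lebesgue"
    unfolding h_def by (rule borel_measurable_if[OF Ql, THEN iffD2])
  then obtain g where g: "g \<in> borel_measurable lborel" "AE X in lborel. h X = g X"
    using completion_ex_borel_measurable_real by blast
  then obtain \<beta> where \<beta>: "\<beta> \<in> borel_measurable borel"
    "\<And>x. AE t in lborel. ennreal (g (x, t)) \<le> \<beta> x"
    "\<And>x z. AE t in lborel. ennreal (g (x, t)) \<le> z \<Longrightarrow> \<beta> x \<le> z"
    using measurable_sectional_bound[of g] by auto
  have le: "AE x in lborel. \<beta> x \<le> esssup (lebesgue_on {t. (x, t) \<in> Q}) (\<lambda>t. ennreal (norm (b (x, t))))"
    using AE_lborel_sections(1)[OF g(2)]
  proof eventually_elim
    fix x
    assume eq: "AE t in lborel. h (x, t) = g (x, t)"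
    define T where "T = {t. (x, t) \<in> Q}"
    define z where "z = esssup (lebesgue_on T) (\<lambda>t. ennreal (norm (b (x, t))))"
    have "open ((\<lambda>t. (x, t)) -` Q)"
      by (rule open_vimage[OF Q]) (intro continuous_intros)
    then have T: "T \<in> sets lebesgue" by (simp add: T_def vimage_def)
    have "AE t in lebesgue_on T. ennreal (norm (b (x, t))) \<le> z"
      unfolding z_def by (rule esssup_AE)
    then have "AE t in lebesgue. t \<in> T \<longrightarrow> ennreal (norm (b (x, t))) \<le> z"
      using T by (subst (asm) AE_restrict_space_iff) auto
    then have "AE t in lborel. t \<in> T \<longrightarrow> ennreal (norm (b (x, t))) \<le> z"
      by (simp add: AE_completion_iff)
    with eq have "AE t in lborel. ennreal (g (x, t)) \<le> z"
      by eventually_elim (auto simp: h_def T_def split: if_splits)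
    then show "\<beta> x \<le> esssup (lebesgue_on {t. (x, t) \<in> Q}) (\<lambda>t. ennreal (norm (b (x, t))))"
      using \<beta>(3) unfolding z_def T_def by blast
  qed
  have "(\<integral>\<^sup>+x. \<beta> x ^ CARD('n) \<partial>lborel) \<le>
      (\<integral>\<^sup>+x. esssup (lebesgue_on {t. (x, t) \<in> Q}) (\<lambda>t. ennreal (norm (b (x, t)))) ^ CARD('n) \<partial>lborel)"
  proof (rule nn_integral_mono_AE)
    show "AE x in lborel. \<beta> x ^ CARD('n) \<le>
        esssup (lebesgue_on {t. (x, t) \<in> Q}) (\<lambda>t. ennreal (norm (b (x, t)))) ^ CARD('n)"
      using le by eventually_elim (rule power_mono, simp_all)
  qed
  also have "\<dots> = ennreal S"
    using S unfolding drift_integral_def nn_integral_completion .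
  finally have int: "(\<integral>\<^sup>+x. \<beta> x ^ CARD('n) \<partial>lborel) \<le> ennreal S" .
  have m\<beta>: "(\<lambda>x. \<beta> x ^ CARD('n)) \<in> borel_measurable lborel"
    using \<beta>(1) by measurable
  have "(\<integral>\<^sup>+x. \<beta> x ^ CARD('n) \<partial>lborel) \<noteq> \<infinity>"
    using int by (auto simp: top_unique)
  from nn_integral_PInf_AE[OF m\<beta> this]
  have fin: "AE x in lborel. \<beta> x < \<infinity>"
    by eventually_elim (auto simp: less_top power_eq_top_ennreal)
  define B where "B = (\<lambda>x. enn2real (\<beta> x))"
  have g\<beta>: "AE t in lborel. AE x in lborel. ennreal (g (x, t)) \<le> \<beta> x"
  proof (rule AE_lborel_pair_commute)
    show "AE x in lborel. AE t in lborel. ennreal (g (x, t)) \<le> \<beta> x" using \<beta>(2) by simp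
    have "(\<lambda>z. ennreal (g z)) \<in> borel_measurable borel" using g(1) by measurable
    moreover have "(\<lambda>z. \<beta> (fst z)) \<in> borel_measurable (borel :: (_ \<times> real) measure)"
      using \<beta>(1) by (rule measurable_compose[rotated]) (auto intro!: borel_measurable_continuous_onI continuous_intros)
    ultimately show "{z. ennreal (g (fst z, snd z)) \<le> \<beta> (fst z)} \<in> sets borel"
      using borel_measurable_le[of "\<lambda>z. ennreal (g z)" borel "\<lambda>z. \<beta> (fst z)"] by simp
  qed
  show ?thesis
  proof (rule that[of B])
    show "B \<in> borel_measurable borel" unfolding B_def using \<beta>(1) by measurable
    show "0 \<le> B x" for x by (simp add: B_def)
    have "(\<integral>\<^sup>+x. ennreal (B x ^ CARD('n)) \<partial>lborel) \<le> (\<integral>\<^sup>+x. \<beta> x ^ CARD('n) \<partial>lborel)"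
      by (rule nn_integral_mono_AE, use fin in eventually_elim)
        (simp add: B_def ennreal_power[symmetric] ennreal_enn2real_if less_top)
    with int show "(\<integral>\<^sup>+x. ennreal (B x ^ CARD('n)) \<partial>lborel) \<le> ennreal S" by simp
    show "AE t in lborel. AE x in lborel. (x, t) \<in> Q \<longrightarrow> norm (b (x, t)) \<le> B x"
      using g\<beta> AE_lborel_sections(2)[OF g(2)]
    proof eventually_elim
      fix t
      assume "AE x in lborel. ennreal (g (x, t)) \<le> \<beta> x" "AE x in lborel. h (x, t) = g (x, t)"
      with fin show "AE x in lborel. (x, t) \<in> Q \<longrightarrow> norm (b (x, t)) \<le> B x"
      proof eventually_elim
        fix x
        assume *: "\<beta> x < \<infinity>" "ennreal (g (x, t)) \<le> \<beta> x" "h (x, t) = g (x, t)"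
        then have "ennreal (g (x, t)) \<le> ennreal (B x)"
          by (simp add: B_def ennreal_enn2real_if less_top)
        then have "g (x, t) \<le> B x"
          by (subst (asm) ennreal_le_iff) (auto simp: B_def)
        then show "(x, t) \<in> Q \<longrightarrow> norm (b (x, t)) \<le> B x"
          using *(3) by (auto simp: h_def)
      qed
    qed
  qed
qed

section \<open>Choice of scale and of time grid\<close>

lemma sum_truncated_powers_of_two:
  fixes y :: real
  assumes "0 \<le> y"
  shows "(\<Sum>i=1..K. if y * 2 ^ i \<le> 1 then y * 2 ^ i else 0) \<le> 2 * min 1 (y * 2 ^ K)"
proof (induction K)
  case 0
  then show ?case using assms by simp
next
  case (Suc K)
  have "y * 2 ^ K \<le> y * 2 ^ Suc K" using assms by simp
  then show ?case using Suc by (auto simp: min_def split: if_splits)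
qed

lemma weighted_scales_sum:
  fixes x x0 :: "real ^ 'n"
  assumes "0 < r"
  shows "(\<Sum>i=1..K. if x \<in> cball x0 (r / 2 ^ i) then (norm (x - x0) / (r / 2 ^ i)) ^ CARD('n) else 0) \<le> 2"
proof -
  define y where "y = norm (x - x0) / r"
  have y0: "0 \<le> y" using assms by (simp add: y_def)
  have "(\<Sum>i=1..K. if x \<in> cball x0 (r / 2 ^ i) then (norm (x - x0) / (r / 2 ^ i)) ^ CARD('n) else 0)
      \<le> (\<Sum>i=1..K. if y * 2 ^ i \<le> 1 then y * 2 ^ i else 0)"
  proof (rule sum_mono)
    fix i
    have eq: "norm (x - x0) / (r / 2 ^ i) = y * 2 ^ i" using assms by (simp add: y_def)
    have mem: "x \<in> cball x0 (r / 2 ^ i) \<longleftrightarrow> y * 2 ^ i \<le> 1"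
      using assms by (simp add: y_def dist_norm norm_minus_commute field_simps)
    show "(if x \<in> cball x0 (r / 2 ^ i) then (norm (x - x0) / (r / 2 ^ i)) ^ CARD('n) else 0)
        \<le> (if y * 2 ^ i \<le> 1 then y * 2 ^ i else 0)"
      unfolding eq mem using y0 power_le_one_iff power_decreasing[of 1 "CARD('n)" "y * 2 ^ i"]
      by (auto simp: Suc_leI)
  qed
  also have "\<dots> \<le> 2 * min 1 (y * 2 ^ K)" by (rule sum_truncated_powers_of_two[OF y0])
  also have "\<dots> \<le> 2" by simp
  finally show ?thesis .
qed

text \<open>The weights at the dyadic scales add up to at most 2 at every point, so on one of K scales the
  weighted drift has at most the fraction 2/K of the total.\<close>

lemma scale_selection:
  fixes B :: "real ^ 'n \<Rightarrow> real"
  assumes B: "B \<in> borel_measurable borel" "\<And>x. 0 \<le> B x"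
    and S: "(\<integral>\<^sup>+x. ennreal (B x ^ CARD('n)) \<partial>lborel) \<le> ennreal S" "0 \<le> S"
    and r: "0 < r" and K: "1 \<le> K"
  obtains i where "1 \<le> i" "i \<le> K"
    "(\<integral>\<^sup>+x\<in>cball x0 (r / 2 ^ i). ennreal ((B x * (norm (x - x0) / (r / 2 ^ i))) ^ CARD('n)) \<partial>lborel) \<le> ennreal (2 * S / K)"
proof -
  define J where "J = (\<lambda>i. \<integral>\<^sup>+x\<in>cball x0 (r / 2 ^ i). ennreal ((B x * (norm (x - x0) / (r / 2 ^ i))) ^ CARD('n)) \<partial>lborel)"
  define m where "m = Min (J ` {1..K})"
  have ne: "J ` {1..K} \<noteq> {}" using K by auto
  have "m \<in> J ` {1..K}" unfolding m_def by (rule Min_in) (use ne in auto)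
  then obtain i where i: "1 \<le> i" "i \<le> K" "m = J i" by auto
  note [measurable] = B(1)
  have [measurable]: "cball x0 s \<in> sets borel" for s :: real by simp
  have "of_nat K * m = (\<Sum>i=1..K. m)" by simp
  also have "\<dots> \<le> (\<Sum>i=1..K. J i)" by (intro sum_mono) (simp add: m_def)
  also have "\<dots> = (\<integral>\<^sup>+x. (\<Sum>i=1..K. ennreal ((B x * (norm (x - x0) / (r / 2 ^ i))) ^ CARD('n)) *
      indicator (cball x0 (r / 2 ^ i)) x) \<partial>lborel)"
    unfolding J_def by (rule nn_integral_sum[symmetric]) measurable
  also have "\<dots> \<le> (\<integral>\<^sup>+x. ennreal 2 * ennreal (B x ^ CARD('n)) \<partial>lborel)"
  proof (rule nn_integral_mono)
    fix x
    have "(\<Sum>i=1..K. ennreal ((B x * (norm (x - x0) / (r / 2 ^ i))) ^ CARD('n)) * indicator (cball x0 (r / 2 ^ i)) x)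
       = (\<Sum>i=1..K. ennreal (B x ^ CARD('n) * (if x \<in> cball x0 (r / 2 ^ i) then (norm (x - x0) / (r / 2 ^ i)) ^ CARD('n) else 0)))"
      by (intro sum.cong) (auto simp: indicator_def power_mult_distrib power_divide)
    also have "\<dots> = ennreal (B x ^ CARD('n) * (\<Sum>i=1..K. if x \<in> cball x0 (r / 2 ^ i) then (norm (x - x0) / (r / 2 ^ i)) ^ CARD('n) else 0))"
      unfolding sum_distrib_left using B(2) r by (intro sum_ennreal) auto
    also have "\<dots> \<le> ennreal (B x ^ CARD('n) * 2)"
      using weighted_scales_sum[OF r, of x x0 K] B(2) by (intro ennreal_leI mult_left_mono) auto
    also have "\<dots> = ennreal 2 * ennreal (B x ^ CARD('n))"
      using B(2) by (subst ennreal_mult[symmetric]) (auto simp: mult.commute)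
    finally show "(\<Sum>i=1..K. ennreal ((B x * (norm (x - x0) / (r / 2 ^ i))) ^ CARD('n)) * indicator (cball x0 (r / 2 ^ i)) x)
        \<le> ennreal 2 * ennreal (B x ^ CARD('n))" .
  qed
  also have "\<dots> = ennreal 2 * (\<integral>\<^sup>+x. ennreal (B x ^ CARD('n)) \<partial>lborel)"
    by (rule nn_integral_cmult) measurable
  also have "\<dots> \<le> ennreal 2 * ennreal S" by (rule mult_left_mono[OF S(1)]) simp
  also have "\<dots> = ennreal (2 * S)" using S(2) by (simp add: ennreal_mult)
  finally have le: "of_nat K * m \<le> ennreal (2 * S)" .
  have "m \<le> ennreal (2 * S / K)"
  proof (cases m)
    case (real m')
    have "of_nat K * m = ennreal (real K * m')"
      using real by (simp add: ennreal_mult ennreal_of_nat_eq_real_of_nat)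
    then have "real K * m' \<le> 2 * S" using le S(2) by (simp add: ennreal_le_iff)
    then have "m' \<le> 2 * S / K" using K by (simp add: field_simps)
    then show ?thesis using real by (simp add: ennreal_leI)
  next
    case top
    then show ?thesis using le K by (simp add: ennreal_mult_top top_unique)
  qed
  then show ?thesis using that[OF i(1,2)] i(3) unfolding J_def by simp
qed

lemma AE_lborel_translate:
  fixes P :: "real \<Rightarrow> bool"
  assumes "AE t in lborel. P t"
  shows "AE t in lborel. P (t + c)"
proof -
  obtain N where N: "{t. \<not> P t} \<subseteq> N" "N \<in> null_sets lborel"
    using assms unfolding eventually_ae_filter by auto
  have "AE t in distr lborel borel ((+) c). t \<notin> N"
    unfolding lborel_distr_plus by (rule AE_not_in[OF N(2)])
  then have "AE t in lborel. c + t \<notin> N"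
    using N(2) by (subst (asm) AE_distr_iff) (auto dest: null_setsD2)
  then show ?thesis
    by eventually_elim (use N(1) in \<open>auto simp: add.commute\<close>)
qed

text \<open>Averaging the Riemann sums over the shift of the grid gives the integral over time, so some
  generic shift has a Riemann sum of at most twice the average.\<close>

lemma grid_selection:
  fixes E :: "('a::euclidean_space \<times> real) set"
  assumes P: "AE t in lborel. P t" and E: "E \<in> sets borel" "emeasure lborel E \<le> ennreal m"
    and m: "0 < m" and \<tau>: "0 < \<tau>"
  obtains \<theta> where "t1 - \<tau> < \<theta>" "\<theta> < t1" "\<And>k. P (\<theta> + real k * \<tau>)"
    "ennreal \<tau> * (\<Sum>k<N. emeasure lborel {x. (x, \<theta> + real (Suc k) * \<tau>) \<in> E}) \<le> ennreal (2 * m)"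
proof -
  define g where "g = (\<lambda>t. emeasure lborel {x. (x, t) \<in> E})"
  have E': "E \<in> sets ((lborel :: 'a measure) \<Otimes>\<^sub>M (lborel :: real measure))"
    using E(1) by (simp only: sets_lborel_pair)
  have g[measurable]: "g \<in> borel_measurable borel"
    using lborel_pair.measurable_emeasure_Pair2[OF E'] by (simp add: g_def vimage_def)
  have gint: "(\<integral>\<^sup>+t. g t \<partial>lborel) \<le> ennreal m"
    using lborel_pair.emeasure_pair_measure_alt2[OF E'] E(2)
    by (simp add: g_def vimage_def lborel_prod)
  define f where "f = (\<lambda>\<theta>. \<Sum>k<N. g (\<theta> + real (Suc k) * \<tau>))"
  define I where "I = {t1 - \<tau><..<t1}"
  have "(\<integral>\<^sup>+\<theta>\<in>I. f \<theta> \<partial>lborel) = (\<integral>\<^sup>+\<theta>. (\<Sum>k<N. g (\<theta> + real (Suc k) * \<tau>) * indicator I \<theta>) \<partial>lborel)"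
    by (simp add: f_def sum_distrib_right)
  also have "\<dots> = (\<Sum>k<N. \<integral>\<^sup>+\<theta>. g (\<theta> + real (Suc k) * \<tau>) * indicator I \<theta> \<partial>lborel)"
    by (rule nn_integral_sum) (simp add: I_def)
  also have "\<dots> = (\<Sum>k<N. \<integral>\<^sup>+s. g s * indicator I (s - real (Suc k) * \<tau>) \<partial>lborel)"
  proof (rule sum.cong[OF refl])
    fix k
    show "(\<integral>\<^sup>+\<theta>. g (\<theta> + real (Suc k) * \<tau>) * indicator I \<theta> \<partial>lborel) =
        (\<integral>\<^sup>+s. g s * indicator I (s - real (Suc k) * \<tau>) \<partial>lborel)"
      by (subst nn_integral_real_affine[of "\<lambda>s. g s * indicator I (s - real (Suc k) * \<tau>)" 1 "real (Suc k) * \<tau>"])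
        (simp_all add: I_def add.commute)
  qed
  also have "\<dots> = (\<integral>\<^sup>+s. (\<Sum>k<N. g s * indicator I (s - real (Suc k) * \<tau>)) \<partial>lborel)"
    by (rule nn_integral_sum[symmetric]) (simp add: I_def)
  also have "\<dots> \<le> (\<integral>\<^sup>+s. g s \<partial>lborel)"
  proof (rule nn_integral_mono)
    fix s
    have "(\<Sum>k<N. indicator I (s - real (Suc k) * \<tau>)) \<le> (1 :: ennreal)"
    proof (cases "\<exists>k<N. s - real (Suc k) * \<tau> \<in> I")
      case True
      then obtain k where k: "k < N" "s - real (Suc k) * \<tau> \<in> I" by blast
      have "s - real (Suc j) * \<tau> \<notin> I" if jk: "j \<noteq> k" for j
      proof
        assume j: "s - real (Suc j) * \<tau> \<in> I"
        consider "Suc j \<le> k" | "Suc k \<le> j" using jk by (metis Suc_leI linorder_neqE_nat)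
        then show False
        proof cases
          case 1
          then have "(real j + 1) * \<tau> \<le> real k * \<tau>" using \<tau> by (intro mult_right_mono) auto
          then show False using j k by (simp add: I_def algebra_simps)
        next
          case 2
          then have "(real k + 1) * \<tau> \<le> real j * \<tau>" using \<tau> by (intro mult_right_mono) auto
          then show False using j k by (simp add: I_def algebra_simps)
        qed
      qed
      then have "(\<Sum>j<N. indicator I (s - real (Suc j) * \<tau>) :: ennreal) = (\<Sum>j<N. if j = k then 1 else 0)"
        using k by (intro sum.cong) (auto simp: indicator_def)
      then show ?thesis by (simp add: sum.delta)
    qed (simp add: indicator_def)
    then show "(\<Sum>k<N. g s * indicator I (s - real (Suc k) * \<tau>)) \<le> g s"
      unfolding sum_distrib_left[symmetric] using mult_left_mono[of _ 1 "g s"] by simp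
  qed
  also note gint
  finally have fint: "(\<integral>\<^sup>+\<theta>\<in>I. f \<theta> \<partial>lborel) \<le> ennreal m" .
  have AEP: "AE \<theta> in lborel. \<forall>k. P (\<theta> + real k * \<tau>)"
    using AE_lborel_translate[OF P] by (simp add: AE_all_countable)
  have "\<exists>\<theta>\<in>I. (\<forall>k. P (\<theta> + real k * \<tau>)) \<and> f \<theta> \<le> ennreal (2 * m / \<tau>)"
  proof (rule ccontr)
    assume no: "\<not> ?thesis"
    have "AE \<theta> in lborel. ennreal (2 * m / \<tau>) * indicator I \<theta> \<le> f \<theta> * indicator I \<theta>"
      using AEP by eventually_elim (use no in \<open>auto simp: indicator_def\<close>)
    then have "(\<integral>\<^sup>+\<theta>. ennreal (2 * m / \<tau>) * indicator I \<theta> \<partial>lborel) \<le> (\<integral>\<^sup>+\<theta>\<in>I. f \<theta> \<partial>lborel)"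
      by (rule nn_integral_mono_AE)
    also have "(\<integral>\<^sup>+\<theta>. ennreal (2 * m / \<tau>) * indicator I \<theta> \<partial>lborel) = ennreal (2 * m / \<tau>) * ennreal \<tau>"
      using \<tau> by (subst nn_integral_cmult_indicator) (auto simp: I_def)
    also have "\<dots> = ennreal (2 * m)"
      using \<tau> m by (subst ennreal_mult[symmetric]) auto
    finally have "ennreal (2 * m) \<le> ennreal m" using fint by (rule order_trans)
    then show False using m by (simp add: ennreal_le_iff)
  qed
  then obtain \<theta> where \<theta>: "\<theta> \<in> I" "\<And>k. P (\<theta> + real k * \<tau>)" "f \<theta> \<le> ennreal (2 * m / \<tau>)" by blast
  have "ennreal \<tau> * f \<theta> \<le> ennreal \<tau> * ennreal (2 * m / \<tau>)"
    by (rule mult_left_mono[OF \<theta>(3)]) simp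
  also have "\<dots> = ennreal (2 * m)"
    using \<tau> m by (subst ennreal_mult[symmetric]) auto
  finally show ?thesis
    using that[of \<theta>] \<theta>(1,2) by (auto simp: I_def f_def g_def)
qed

text \<open>By scaling, every dyadic annulus contributes the same amount.\<close>

lemma annulus_integral_ge:
  assumes "0 < \<kappa>"
  shows "ennreal (real m * unit_ball_vol (CARD('n)) / 2) \<le>
    (\<integral>\<^sup>+p\<in>{p :: real ^ 'n. \<kappa> \<le> norm p \<and> norm p \<le> 2 ^ m * \<kappa>}. ennreal (1 / norm p ^ CARD('n)) \<partial>lborel)"
proof (induction m)
  case 0
  then show ?case by simp
next
  case (Suc m)
  let ?A = "\<lambda>m. {p :: real ^ 'n. \<kappa> \<le> norm p \<and> norm p \<le> 2 ^ m * \<kappa>}"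
  let ?w = "\<lambda>p :: real ^ 'n. ennreal (1 / norm p ^ CARD('n))"
  define R where "R = 2 ^ m * \<kappa>"
  define \<omega> where "\<omega> = unit_ball_vol (CARD('n))"
  define D where "D = cball (0 :: real ^ 'n) (2 * R) - cball 0 R"
  have R: "0 < R" using assms by (simp add: R_def)
  have \<omega>: "0 < \<omega>" by (simp add: \<omega>_def)
  have [measurable]: "?A m \<in> sets borel" for m
  proof -
    have "?A m = cball 0 (2 ^ m * \<kappa>) - ball 0 \<kappa>" by auto
    then show ?thesis by simp
  qed
  have D[measurable]: "D \<in> sets borel" by (simp add: D_def)
  have "emeasure lborel D = emeasure lborel (cball (0 :: real ^ 'n) (2 * R)) - emeasure lborel (cball (0 :: real ^ 'n) R)"
    unfolding D_def using R by (intro emeasure_Diff) (auto simp: emeasure_cball)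
  also have "\<dots> = ennreal (\<omega> * (2 * R) ^ CARD('n) - \<omega> * R ^ CARD('n))"
    using R \<omega> by (simp add: emeasure_cball \<omega>_def ennreal_minus)
  finally have eD: "emeasure lborel D = ennreal (\<omega> * (2 * R) ^ CARD('n) - \<omega> * R ^ CARD('n))" .
  have "\<omega> / 2 \<le> 1 / (2 * R) ^ CARD('n) * (\<omega> * (2 * R) ^ CARD('n) - \<omega> * R ^ CARD('n))"
  proof -
    have "1 / (2 * R) ^ CARD('n) * (\<omega> * (2 * R) ^ CARD('n) - \<omega> * R ^ CARD('n)) = \<omega> * (1 - 1 / 2 ^ CARD('n))"
      using R by (simp add: power_mult_distrib field_simps)
    moreover have "1 / 2 ^ CARD('n) \<le> (1 / 2 :: real)"
      using self_le_power[of "2 :: real" "CARD('n)"] by (simp add: field_simps)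
    then have "\<omega> * (1 / 2) \<le> \<omega> * (1 - 1 / 2 ^ CARD('n))"
      using \<omega> by (intro mult_left_mono) auto
    ultimately show ?thesis by simp
  qed
  then have "ennreal (\<omega> / 2) \<le> ennreal (1 / (2 * R) ^ CARD('n) * (\<omega> * (2 * R) ^ CARD('n) - \<omega> * R ^ CARD('n)))"
    by (rule ennreal_leI)
  also have "\<dots> = (\<integral>\<^sup>+p. ennreal (1 / (2 * R) ^ CARD('n)) * indicator D p \<partial>lborel)"
    using R by (subst nn_integral_cmult_indicator) (auto simp: eD ennreal_mult'[symmetric])
  also have "\<dots> \<le> (\<integral>\<^sup>+p\<in>D. ?w p \<partial>lborel)"
  proof (rule nn_integral_mono)
    fix p :: "real ^ 'n"
    have "1 / (2 * R) ^ CARD('n) \<le> 1 / norm p ^ CARD('n)" if "p \<in> D"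
    proof -
      have "R < norm p" "norm p \<le> 2 * R" using that by (auto simp: D_def)
      then show ?thesis using R by (intro divide_left_mono power_mono mult_pos_pos zero_less_power) auto
    qed
    then show "ennreal (1 / (2 * R) ^ CARD('n)) * indicator D p \<le> ?w p * indicator D p"
      by (auto simp: indicator_def intro!: ennreal_leI)
  qed
  finally have D_int: "ennreal (\<omega> / 2) \<le> (\<integral>\<^sup>+p\<in>D. ?w p \<partial>lborel)" .
  have "ennreal (real (Suc m) * \<omega> / 2) = ennreal (real m * \<omega> / 2) + ennreal (\<omega> / 2)"
    using \<omega> by (subst ennreal_plus[symmetric]) (auto simp: algebra_simps add_divide_distrib)
  also have "\<dots> \<le> (\<integral>\<^sup>+p\<in>?A m. ?w p \<partial>lborel) + (\<integral>\<^sup>+p\<in>D. ?w p \<partial>lborel)"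
    using Suc D_int unfolding \<omega>_def by (rule add_mono)
  also have "\<dots> = (\<integral>\<^sup>+p. ?w p * indicator (?A m) p + ?w p * indicator D p \<partial>lborel)"
    by (rule nn_integral_add[symmetric]) measurable
  also have "\<dots> \<le> (\<integral>\<^sup>+p\<in>?A (Suc m). ?w p \<partial>lborel)"
  proof (rule nn_integral_mono)
    fix p :: "real ^ 'n"
    have "\<kappa> \<le> R" using assms by (simp add: R_def)
    then show "?w p * indicator (?A m) p + ?w p * indicator D p \<le> ?w p * indicator (?A (Suc m)) p"
      using R by (auto simp: indicator_def D_def R_def)
  qed
  finally show ?case unfolding \<omega>_def .
qed

section \<open>The growth estimate at a point\<close>

lemma measure_cylinder:
  fixes Y :: "(real ^ 'n) \<times> real"
  assumes "0 < r"
  shows "emeasure lborel (cylinder Y r) = ennreal (unit_ball_vol CARD('n) * r ^ (CARD('n) + 2))"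
    "measure lebesgue (cylinder Y r) = unit_ball_vol CARD('n) * r ^ (CARD('n) + 2)"
proof -
  have "emeasure lborel (cylinder Y r) = emeasure (lborel \<Otimes>\<^sub>M lborel) (ball (fst Y) r \<times> {snd Y - r\<^sup>2<..<snd Y})"
    unfolding cylinder_def by (simp only: lborel_prod)
  also have "\<dots> = emeasure lborel (ball (fst Y) r) * emeasure lborel {snd Y - r\<^sup>2<..<snd Y}"
    by (rule lborel.emeasure_pair_measure_Times) auto
  also have "\<dots> = ennreal (unit_ball_vol CARD('n) * r ^ CARD('n)) * ennreal (r\<^sup>2)"
    using assms by (simp add: emeasure_ball)
  also have "\<dots> = ennreal (unit_ball_vol CARD('n) * r ^ (CARD('n) + 2))"
    using assms by (subst ennreal_mult[symmetric]) (auto simp: power_add mult.assoc power2_eq_square)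
  finally show 1: "emeasure lborel (cylinder Y r) = ennreal (unit_ball_vol CARD('n) * r ^ (CARD('n) + 2))" .
  have "measure lebesgue (cylinder Y r) = measure lborel (cylinder Y r)"
    using open_cylinder[of Y r] by (simp add: measure_completion)
  then show "measure lebesgue (cylinder Y r) = unit_ball_vol CARD('n) * r ^ (CARD('n) + 2)"
    unfolding measure_def 1 using assms by simp
qed

lemma C21_closure_bounded:
  assumes "C21_closure (cylinder Y r) u"
  shows "bounded (u ` cylinder Y r)"
proof -
  have "bounded (cylinder Y r)"
    unfolding cylinder_def by (intro bounded_Times bounded_ball bounded_subset[OF bounded_closed_interval[of "snd Y - r\<^sup>2" "snd Y"]]) auto
  then have "compact (closure (cylinder Y r))" by simp
  then have "bounded (u ` closure (cylinder Y r))"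
    using assms by (intro compact_imp_bounded compact_continuous_image) (auto simp: C21_closure_def)
  then show ?thesis
    by (rule bounded_subset) (intro image_mono closure_subset)
qed

lemma sup_pos_upper:
  assumes "C21_closure (cylinder Y r) u" "X \<in> cylinder Y r"
  shows "max (u X) 0 \<le> sup_pos u Y r"
proof -
  obtain c where c: "\<And>X. X \<in> cylinder Y r \<Longrightarrow> \<bar>u X\<bar> \<le> c"
    using C21_closure_bounded[OF assms(1)] by (auto simp: bounded_iff)
  then have "bdd_above ((\<lambda>X. max (u X) 0) ` cylinder Y r)"
    by (intro bdd_aboveI2[of _ _ "max c 0"]) (smt (verit, best))
  then show ?thesis
    unfolding sup_pos_def by (rule cSUP_upper[OF assms(2)])
qed

lemma cylinder_nonempty: "0 < r \<Longrightarrow> cylinder Y r \<noteq> {}"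
proof -
  assume "0 < r"
  then have "(fst Y, snd Y - r\<^sup>2 / 2) \<in> cylinder Y r"
    by (simp add: mem_cylinder)
  then show ?thesis by blast
qed

lemma sup_pos_le:
  assumes "0 < r" "0 \<le> c" "\<And>X. X \<in> cylinder Y r \<Longrightarrow> u X \<le> c"
  shows "sup_pos u Y r \<le> c"
  unfolding sup_pos_def
  by (rule cSUP_least[OF cylinder_nonempty[OF assms(1)]]) (simp add: assms)

text \<open>At least M1 on the lateral boundary and at the bottom of the cylinder of size \<open>\<rho>\<close> with top centre
  \<open>(x0, t0)\<close>, and 0 at \<open>(x0, t0)\<close>.\<close>

definition barrier :: "real \<Rightarrow> real \<Rightarrow> real ^ 'n \<Rightarrow> real \<Rightarrow> (real ^ 'n) \<times> real \<Rightarrow> real" where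
  "barrier M1 \<rho> x0 t0 X = M1 / \<rho>\<^sup>2 * ((norm (fst X - x0))\<^sup>2 + (t0 - snd X))"

lemma has_derivative_barrier:
  fixes x x0 :: "real ^ 'n"
  shows "((\<lambda>x. barrier M1 \<rho> x0 t0 (x, t)) has_derivative (\<lambda>h. ((2 * M1 / \<rho>\<^sup>2) *\<^sub>R (x - x0)) \<bullet> h)) (at x)"
proof -
  have "((\<lambda>x. d * ((x - x0) \<bullet> (x - x0) + (t0 - t))) has_derivative (\<lambda>h. ((2 * d) *\<^sub>R (x - x0)) \<bullet> h)) (at x)" for d
    by (auto intro!: derivative_eq_intros simp: inner_commute algebra_simps)
  from this[of "M1 / \<rho>\<^sup>2"] show ?thesis
    by (simp add: barrier_def power2_norm_eq_inner)
qed

text \<open>The operator applied to the difference of a subsolution and the barrier, at a point where the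
  difference has a nonpositive Hessian.\<close>

lemma trace_bound_at_contact:
  fixes u :: "(real ^ 'n) \<times> real \<Rightarrow> real" and c \<nu> :: real
  assumes \<nu>: "1 \<le> \<nu>" and c: "0 \<le> c"
    and ell: "\<And>\<xi> :: real ^ 'n. (norm \<xi>)\<^sup>2 / \<nu> \<le> (\<Sum>i\<in>UNIV. \<Sum>j\<in>UNIV. a X $ i $ j * \<xi> $ i * \<xi> $ j)"
    and bdd: "(\<Sum>i\<in>UNIV. \<Sum>j\<in>UNIV. (a X $ i $ j)\<^sup>2) \<le> \<nu>\<^sup>2"
    and pde: "0 \<le> - dt u X + elliptic_op a b u X"
    and H: "transpose (hessx u X - mat c) = hessx u X - mat c" "nonneg_form (- (hessx u X - mat c))"
  shows "dt u X + trace (- (hessx u X - mat c)) / \<nu> \<le> b X \<bullet> gradx u X + CARD('n) * \<nu> * c"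
proof -
  have diag: "a X $ i $ i \<le> \<nu>" for i
  proof -
    have "(a X $ i $ i)\<^sup>2 \<le> (\<Sum>j\<in>UNIV. (a X $ i $ j)\<^sup>2)"
      by (intro member_le_sum) auto
    also have "\<dots> \<le> (\<Sum>i\<in>UNIV. \<Sum>j\<in>UNIV. (a X $ i $ j)\<^sup>2)"
      by (rule member_le_sum[where f="\<lambda>i. \<Sum>j\<in>UNIV. (a X $ i $ j)\<^sup>2"]) (auto intro: sum_nonneg)
    finally have "(a X $ i $ i)\<^sup>2 \<le> \<nu>\<^sup>2" using bdd by linarith
    then show ?thesis by (rule power2_le_imp_le) (use \<nu> in simp)
  qed
  have "transpose (- (hessx u X - mat c)) = - (hessx u X - mat c)"
  proof -
    have "transpose (- A) = - transpose A" for A :: "real ^ 'n ^ 'n"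
      by (simp add: transpose_def vec_eq_iff)
    then show ?thesis by (simp only: H(1))
  qed
  then have "trace (- (hessx u X - mat c)) / \<nu> \<le> (\<Sum>i\<in>UNIV. \<Sum>j\<in>UNIV. a X $ i $ j * (- (hessx u X - mat c)) $ i $ j)"
    using \<nu> by (intro elliptic_contraction_ge_trace ell H(2)) auto
  also have "\<dots> = (\<Sum>i\<in>UNIV. \<Sum>j\<in>UNIV. a X $ i $ j * (if i = j then c else 0)) -
      (\<Sum>i\<in>UNIV. \<Sum>j\<in>UNIV. a X $ i $ j * dx i (dx j u) X)"
    unfolding sum_subtractf[symmetric]
    by (intro sum.cong refl) (simp add: hessx_def mat_def right_diff_distrib)
  also have "(\<Sum>i\<in>UNIV. \<Sum>j\<in>UNIV. a X $ i $ j * (if i = j then c else 0)) = (\<Sum>i\<in>UNIV. a X $ i $ i * c)"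
    by (simp add: if_distrib[where f="\<lambda>z. _ * z"] sum.delta cong: if_cong)
  also have "\<dots> \<le> (\<Sum>i\<in>(UNIV :: 'n set). \<nu> * c)"
    using diag c by (intro sum_mono mult_right_mono) auto
  also have "\<dots> = CARD('n) * \<nu> * c" by simp
  finally have 1: "trace (- (hessx u X - mat c)) / \<nu> \<le> CARD('n) * \<nu> * c -
      (\<Sum>i\<in>UNIV. \<Sum>j\<in>UNIV. a X $ i $ j * dx i (dx j u) X)" by simp
  have "b X \<bullet> gradx u X = (\<Sum>i\<in>UNIV. b X $ i * dx i u X)"
    by (simp add: inner_vec_def gradx_def)
  then show ?thesis using 1 pde unfolding elliptic_op_def by linarith
qed

text \<open>The discrete maximum principle applied to u minus the barrier on a small cylinder with top
  centre \<open>(x0, t0)\<close>, whose size is picked among K dyadic scales, on a time grid fine enough for the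
  difference quotients in time to be close to the derivative.\<close>

lemma estimate_near_point:
  fixes Q :: "((real ^ 'n) \<times> real) set" and u :: "(real ^ 'n) \<times> real \<Rightarrow> real" and \<nu> S M1 \<mu> :: real and K m :: nat
  assumes \<nu>: "1 \<le> \<nu>" and S: "0 \<le> S" and Q: "open Q" and adm: "admissible_coeffs \<nu> S Q a b"
    and r: "0 < r" and sub: "cylinder Y r \<subseteq> Q" and u: "C21_closure (cylinder Y r) u"
    and pde: "\<And>X. X \<in> cylinder Y r \<Longrightarrow> 0 \<le> - dt u X + elliptic_op a b u X"
    and small: "measure lebesgue ({X. u X > 0} \<inter> cylinder Y r) \<le> \<mu> * measure lebesgue (cylinder Y r)"
    and \<mu>: "0 < \<mu>" and M1: "0 < M1" "\<And>X. X \<in> cylinder Y r \<Longrightarrow> u X \<le> M1"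
    and X0: "(x0, t0) \<in> cylinder Y (r / 2)" and pos: "0 < u (x0, t0)" and K: "1 \<le> K"
  obtains i M \<rho> \<kappa> \<gamma> \<eta> where "1 \<le> i" "i \<le> K" "u (x0, t0) / 2 \<le> M"
    "\<rho> = r / 2 ^ i" "\<kappa> = M / (4 * \<rho>) / 2 ^ m" "\<gamma> = 2 * M1 / \<rho>"
    "\<eta> = M1 * (2 + 2 * CARD('n) * \<nu>) / \<rho>\<^sup>2"
    "M / 2 * (real m * unit_ball_vol CARD('n) / 2) \<le>
      fact CARD('n) * (2 * \<nu>) ^ CARD('n) * 2 ^ CARD('n) * M * (S + (\<gamma> / \<kappa>) ^ CARD('n) * (2 * S / K)) +
      fact CARD('n) * (2 * \<nu>) ^ CARD('n) * (2 * \<eta> ^ Suc CARD('n) / \<kappa> ^ CARD('n)) *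
        (2 * (\<mu> * (unit_ball_vol CARD('n) * r ^ (CARD('n) + 2))))"
proof -
  have bm: "\<And>i. (\<lambda>X. b X $ i) \<in> borel_measurable (lebesgue_on Q)"
    and ell: "\<And>X \<xi>. X \<in> Q \<Longrightarrow> (norm \<xi>)\<^sup>2 / \<nu> \<le> (\<Sum>i\<in>UNIV. \<Sum>j\<in>UNIV. a X $ i $ j * \<xi> $ i * \<xi> $ j)"
    and bdd: "\<And>X. X \<in> Q \<Longrightarrow> (\<Sum>i\<in>UNIV. \<Sum>j\<in>UNIV. (a X $ i $ j)\<^sup>2) \<le> \<nu>\<^sup>2"
    and dS: "drift_integral Q b = ennreal S"
    using adm unfolding admissible_coeffs_def by auto
  obtain B where B: "B \<in> borel_measurable borel" "\<And>x. 0 \<le> B x"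
    "(\<integral>\<^sup>+x. ennreal (B x ^ CARD('n)) \<partial>lborel) \<le> ennreal S"
    "AE t in lborel. AE x in lborel. (x, t) \<in> Q \<longrightarrow> norm (b (x, t)) \<le> B x"
    by (rule drift_majorant[OF Q bm dS]) (rule that)
  obtain i where i: "1 \<le> i" "i \<le> K"
    and iS: "(\<integral>\<^sup>+x\<in>cball x0 (r / 2 ^ i). ennreal ((B x * (norm (x - x0) / (r / 2 ^ i))) ^ CARD('n)) \<partial>lborel) \<le> ennreal (2 * S / K)"
    using scale_selection[OF B(1,2,3) S r K, of x0] by blast
  define \<rho> where "\<rho> = r / 2 ^ i"
  have \<rho>: "0 < \<rho>" using r by (simp add: \<rho>_def)
  have \<rho>r: "\<rho> \<le> r / 2"
  proof -
    have "(2::real) ^ 1 \<le> 2 ^ i" using i by (intro power_increasing) auto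
    then show ?thesis unfolding \<rho>_def using r by (intro divide_left_mono) auto
  qed
  have \<rho>2: "\<rho>\<^sup>2 \<le> r\<^sup>2 / 4"
  proof -
    have "\<rho>\<^sup>2 \<le> (r / 2)\<^sup>2" using \<rho> \<rho>r by (intro power_mono) auto
    then show ?thesis by (simp add: power_divide)
  qed
  have x0: "dist (fst Y) x0 < r / 2" and t0: "snd Y - r\<^sup>2 / 4 < t0" "t0 < snd Y"
    using X0 by (auto simp: mem_cylinder power_divide)
  have inside: "(x, t) \<in> cylinder Y r" if "x \<in> cball x0 \<rho>" "t0 - 2 * \<rho>\<^sup>2 \<le> t" "t \<le> t0" for x t
  proof -
    have "dist (fst Y) x \<le> dist (fst Y) x0 + dist x0 x" by (rule dist_triangle)
    then have "dist (fst Y) x < r" using that(1) x0 \<rho>r by simp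
    moreover have "snd Y - r\<^sup>2 < t"
    proof -
      have "0 < r\<^sup>2" using r by simp
      then show ?thesis using that(2) t0(1) \<rho>2 by linarith
    qed
    ultimately show ?thesis using that(3) t0(2) by (simp add: mem_cylinder)
  qed
  define D where "D = cball x0 \<rho> \<times> {t0 - 2 * \<rho>\<^sup>2..t0}"
  have D: "D \<subseteq> cylinder Y r" "compact D"
    using inside by (auto simp: D_def compact_Times)
  have "uniformly_continuous_on D (dt u)"
    by (intro compact_uniformly_continuous continuous_on_subset[OF cylinder_continuous(2)[OF u] D(1)] D(2))
  moreover have "0 < M1 / \<rho>\<^sup>2" using M1 \<rho> by simp
  ultimately obtain d1 where d1: "d1 > 0"
    "\<And>X X'. X \<in> D \<Longrightarrow> X' \<in> D \<Longrightarrow> dist X' X < d1 \<Longrightarrow> dist (dt u X') (dt u X) < M1 / \<rho>\<^sup>2"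
    unfolding uniformly_continuous_on_def by metis
  define w where "w = (\<lambda>X. u X - barrier M1 \<rho> x0 t0 X)"
  have wX0: "w (x0, t0) = u (x0, t0)" by (simp add: w_def barrier_def)
  have x0t0: "(x0, t0) \<in> cylinder Y r" using inside[of x0 t0] \<rho> by simp
  have "((\<lambda>t. w (x0, t)) \<longlongrightarrow> w (x0, t0)) (at t0)"
  proof -
    have "isCont (\<lambda>t. u (x0, t)) t0" using cylinder_dt[OF u x0t0] by (rule DERIV_isCont)
    then have "isCont (\<lambda>t. w (x0, t)) t0"
      unfolding w_def barrier_def using \<rho> by (intro continuous_intros) auto
    then show ?thesis by (simp add: isCont_def)
  qed
  then have "\<forall>\<^sub>F t in at t0. u (x0, t0) / 2 < w (x0, t)"
    using pos wX0 by (intro order_tendstoD(1)) auto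
  then obtain d2 where d2: "d2 > 0" "\<And>t. t \<noteq> t0 \<Longrightarrow> \<bar>t - t0\<bar> < d2 \<Longrightarrow> u (x0, t0) / 2 < w (x0, t)"
    unfolding eventually_at by (auto simp: dist_real_def)
  \<comment> \<open>The mesh is finer than both moduli of continuity.\<close>
  obtain N :: nat where N: "N \<ge> 1" "\<rho>\<^sup>2 / N < min d1 d2"
  proof -
    define d where "d = min d1 d2"
    have d: "0 < d" using d1(1) d2(1) by (simp add: d_def)
    obtain N :: nat where "\<rho>\<^sup>2 / d < N" using reals_Archimedean2 by blast
    then have "\<rho>\<^sup>2 < N * d" using d by (simp add: pos_divide_less_eq)
    also have "\<dots> \<le> Suc N * d" using d by (intro mult_right_mono) auto
    finally have "\<rho>\<^sup>2 / Suc N < d" by (simp add: pos_divide_less_eq mult.commute)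
    then have "\<rho>\<^sup>2 / Suc N < min d1 d2" by (simp only: d_def)
    then show ?thesis using that[of "Suc N"] by simp
  qed
  define \<tau> where "\<tau> = \<rho>\<^sup>2 / N"
  have \<tau>: "0 < \<tau>" "\<tau> \<le> \<rho>\<^sup>2" "N * \<tau> = \<rho>\<^sup>2" "\<tau> < d1" "\<tau> < d2"
    using N \<rho> by (auto simp: \<tau>_def divide_le_eq)
  define E where "E = {X. u X > 0} \<inter> cylinder Y r"
  have Eopen: "open E"
  proof -
    have "open (cylinder Y r \<inter> u -` {0<..})"
      by (intro continuous_open_preimage cylinder_continuous(1)[OF u] open_cylinder) auto
    moreover have "E = cylinder Y r \<inter> u -` {0<..}" by (auto simp: E_def)
    ultimately show ?thesis by simp
  qed
  define V where "V = unit_ball_vol CARD('n) * r ^ (CARD('n) + 2)"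
  have V: "0 < V" using r by (simp add: V_def)
  have Em: "emeasure lborel E \<le> ennreal (\<mu> * V)"
  proof -
    have "emeasure lborel E \<le> emeasure lborel (cylinder Y r)"
      using open_cylinder[of Y r] by (intro emeasure_mono) (auto simp: E_def)
    then have "emeasure lborel E \<noteq> top"
      using measure_cylinder(1)[OF r, of Y] by (auto simp: top_unique)
    then have "emeasure lborel E = ennreal (measure lborel E)"
      by (rule emeasure_eq_ennreal_measure)
    also have "measure lborel E = measure lebesgue E"
      using Eopen by (simp add: measure_completion)
    also have "ennreal (measure lebesgue E) \<le> ennreal (\<mu> * V)"
      using small measure_cylinder(2)[OF r, of Y] unfolding E_def V_def by (intro ennreal_leI) simp
    finally show ?thesis .
  qed
  \<comment> \<open>The grid starts just below the bottom of the cylinder, where the barrier is already above M1, and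
    ends just before \<open>t0\<close>, where the value at \<open>x0\<close> is still above half of that at \<open>t0\<close>.\<close>
  obtain \<theta> where \<theta>: "t0 - \<rho>\<^sup>2 - \<tau> < \<theta>" "\<theta> < t0 - \<rho>\<^sup>2"
    and \<theta>b: "\<And>k. AE x in lborel. (x, \<theta> + real k * \<tau>) \<in> Q \<longrightarrow> norm (b (x, \<theta> + real k * \<tau>)) \<le> B x"
    and \<theta>E: "ennreal \<tau> * (\<Sum>k<N. emeasure lborel {x. (x, \<theta> + real (Suc k) * \<tau>) \<in> E}) \<le> ennreal (2 * (\<mu> * V))"
    by (rule grid_selection[OF B(4) borel_open[OF Eopen] Em mult_pos_pos[OF \<mu> V] \<tau>(1)]) (rule that)
  define T where "T = (\<lambda>k. \<theta> + real k * \<tau>)"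
  have Tle: "T k < t0" "t0 - 2 * \<rho>\<^sup>2 < T k" if "k \<le> N" for k
  proof -
    have "real k * \<tau> \<le> real N * \<tau>" using that \<tau> by (intro mult_right_mono) auto
    then show "T k < t0" using \<theta>(2) \<tau>(3) by (simp add: T_def)
    have "0 \<le> real k * \<tau>" using \<tau> by simp
    then show "t0 - 2 * \<rho>\<^sup>2 < T k" using \<theta>(1) \<tau>(2) by (simp add: T_def)
  qed
  have Tin: "(x, T k) \<in> cylinder Y r" if "x \<in> cball x0 \<rho>" "k \<le> N" for x k
    using inside[OF that(1)] Tle[OF that(2)] by simp
  define v where "v = (\<lambda>k x. w (x, T k))"
  define c where "c = 2 * M1 / \<rho>\<^sup>2"
  define G where "G = (\<lambda>k x. gradx u (x, T k) - c *\<^sub>R (x - x0))"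
  define H where "H = (\<lambda>k x. hessx u (x, T k) - mat c)"
  have matc: "mat c *v h = c *\<^sub>R h" for h :: "real ^ 'n"
    by (simp add: vec_eq_iff matrix_vector_mult_def mat_def if_distrib[where f="\<lambda>z. z * _"] cong: if_cong)
  have grad: "(v k has_derivative (\<lambda>h. G k x \<bullet> h)) (at x)" if "k \<le> N" "x \<in> cball x0 \<rho>" for k x
    using has_derivative_diff[OF has_derivative_gradx[OF u Tin[OF that(2,1)]]
        has_derivative_barrier[of M1 \<rho> x0 t0 "T k" x]]
    unfolding v_def w_def G_def c_def inner_diff_left .
  have hess: "(G k has_derivative (\<lambda>h. H k x *v h)) (at x)" if "k \<le> N" "x \<in> cball x0 \<rho>" for k x
  proof -
    have "((\<lambda>x. c *\<^sub>R (x - x0)) has_derivative (\<lambda>h. c *\<^sub>R h)) (at x)"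
      by (auto intro!: derivative_eq_intros)
    from has_derivative_diff[OF has_derivative_hessx[OF u Tin[OF that(2,1)]] this]
    show ?thesis
      unfolding G_def H_def by (simp add: matrix_vector_mult_diff_rdistrib matc)
  qed
  have symH: "transpose (H k x) = H k x" if "k \<le> N" "x \<in> cball x0 \<rho>" for k x
    using transpose_hessx[OF u Tin[OF that(2,1)]]
    by (simp add: H_def transpose_def vec_eq_iff mat_def)
  have contH: "continuous_on (cball x0 \<rho>) (H k)" if "k \<le> N" for k
  proof -
    have "continuous_on (cball x0 \<rho>) (\<lambda>x. hessx u (x, T k))"
      by (rule continuous_on_compose2[OF continuous_on_hessx[OF u]])
        (use Tin that in \<open>auto intro!: continuous_intros simp del: mem_cball\<close>)
    then show ?thesis unfolding H_def by (intro continuous_intros)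
  qed
  have w_le: "w (x, T k) \<le> M1 - M1 / \<rho>\<^sup>2 * ((norm (x - x0))\<^sup>2 + (t0 - T k))" if "x \<in> cball x0 \<rho>" "k \<le> N" for x k
    using M1(2)[OF Tin[OF that]] by (simp add: w_def barrier_def)
  have outside: "w (x, T k) \<le> 0" if "x \<in> cball x0 \<rho>" "k \<le> N" "\<rho>\<^sup>2 \<le> (norm (x - x0))\<^sup>2 + (t0 - T k)" for x k
  proof -
    have "M1 = M1 / \<rho>\<^sup>2 * \<rho>\<^sup>2" using \<rho> by simp
    also have "\<dots> \<le> M1 / \<rho>\<^sup>2 * ((norm (x - x0))\<^sup>2 + (t0 - T k))"
      using that(3) M1(1) by (intro mult_left_mono) auto
    finally show ?thesis using w_le[OF that(1,2)] by linarith
  qed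
  have init: "v 0 x \<le> 0" if "x \<in> cball x0 \<rho>" for x
    unfolding v_def by (rule outside[OF that]) (use \<theta> in \<open>auto simp: T_def intro: add_increasing\<close>)
  have lateral: "v k x \<le> 0" if "k \<le> N" "x \<in> sphere x0 \<rho>" for k x
    unfolding v_def
    by (rule outside) (use that Tle[OF that(1)] in \<open>auto simp: dist_norm norm_minus_commute\<close>)
  have cv: "continuous_on (cball x0 \<rho>) (v k)" if "k \<le> N" for k
    using grad[OF that] by (rule has_derivative_continuous_on[OF has_derivative_at_withinI])
  obtain k0 y0 where top: "k0 \<le> N" "y0 \<in> cball x0 \<rho>"
      and bound: "\<And>k x. k \<le> N \<Longrightarrow> x \<in> cball x0 \<rho> \<Longrightarrow> v k x \<le> v k0 y0"
  proof -
    have "\<exists>y\<in>cball x0 \<rho>. \<forall>x\<in>cball x0 \<rho>. v k x \<le> v k y" if "k \<le> N" for k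
      using \<rho> by (intro continuous_attains_sup compact_cball cv[OF that]) auto
    then obtain y where y: "\<And>k. k \<le> N \<Longrightarrow> y k \<in> cball x0 \<rho>"
        "\<And>k x. k \<le> N \<Longrightarrow> x \<in> cball x0 \<rho> \<Longrightarrow> v k x \<le> v k (y k)"
      by metis
    define A where "A = (\<lambda>k. v k (y k)) ` {..N}"
    define top where "top = Max A"
    have "top \<in> A" unfolding top_def A_def by (rule Max_in) auto
    then obtain k0 where k0: "k0 \<le> N" "v k0 (y k0) = top" by (auto simp: A_def)
    have max: "v k (y k) \<le> v k0 (y k0)" if "k \<le> N" for k
      unfolding k0(2) top_def using that by (intro Max_ge) (auto simp: A_def)
    show ?thesis
    proof (rule that[OF k0(1) y(1)[OF k0(1)]])
      show "v k x \<le> v k0 (y k0)" if "k \<le> N" "x \<in> cball x0 \<rho>" for k x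
        using y(2)[OF that] max[OF that(1)] by linarith
    qed
  qed
  define M where "M = v k0 y0"
  have M: "u (x0, t0) / 2 \<le> M"
  proof -
    have "T N \<noteq> t0" "\<bar>T N - t0\<bar> < d2"
      using Tle(1)[of N] \<theta>(1) \<tau> by (auto simp: T_def)
    then have "u (x0, t0) / 2 < v N x0" unfolding v_def by (rule d2(2))
    also have "\<dots> \<le> M" unfolding M_def using \<rho> by (intro bound) auto
    finally show ?thesis by simp
  qed
  then have M0: "0 < M" using pos by linarith
  define \<kappa> where "\<kappa> = M / (4 * \<rho>) / 2 ^ m"
  define \<gamma> where "\<gamma> = 2 * M1 / \<rho>"
  define \<eta> where "\<eta> = M1 * (2 + 2 * CARD('n) * \<nu>) / \<rho>\<^sup>2"
  have \<kappa>: "0 < \<kappa>" using M0 \<rho> by (simp add: \<kappa>_def)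
  have \<gamma>: "0 \<le> \<gamma>" using M1 \<rho> by (simp add: \<gamma>_def)
  have \<eta>: "0 < \<eta>" unfolding \<eta>_def using M1 \<rho> \<nu> by (intro divide_pos_pos mult_pos_pos add_pos_nonneg) auto
  define \<delta> where "\<delta> = (\<lambda>k x. runmax 0 (\<lambda>j. v j x) (Suc k) - runmax 0 (\<lambda>j. v j x) k)"
  have eqn: "AE x in lborel. \<forall>k<N. x \<in> ball x0 \<rho> \<longrightarrow> 0 < v (Suc k) x \<longrightarrow> 0 < \<delta> k x \<longrightarrow>
      nonneg_form (- H (Suc k) x) \<longrightarrow>
      \<delta> k x / \<tau> + trace (- H (Suc k) x) / \<nu> \<le> B x * (norm (G (Suc k) x) + \<gamma> * (norm (x - x0) / \<rho>)) + \<eta>"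
  proof -
    have "AE x in lborel. \<forall>k. (x, T k) \<in> Q \<longrightarrow> norm (b (x, T k)) \<le> B x"
      unfolding AE_all_countable T_def using \<theta>b by simp
    then show ?thesis
    proof eventually_elim
      fix x
      assume bB: "\<forall>k. (x, T k) \<in> Q \<longrightarrow> norm (b (x, T k)) \<le> B x"
      show "\<forall>k<N. x \<in> ball x0 \<rho> \<longrightarrow> 0 < v (Suc k) x \<longrightarrow> 0 < \<delta> k x \<longrightarrow>
        nonneg_form (- H (Suc k) x) \<longrightarrow>
        \<delta> k x / \<tau> + trace (- H (Suc k) x) / \<nu> \<le> B x * (norm (G (Suc k) x) + \<gamma> * (norm (x - x0) / \<rho>)) + \<eta>"
      proof (intro allI impI)
        fix k
        assume k: "k < N" and xb: "x \<in> ball x0 \<rho>" and dpos: "0 < \<delta> k x"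
          and nf: "nonneg_form (- H (Suc k) x)"
        have kN: "Suc k \<le> N" using k by simp
        have x: "x \<in> cball x0 \<rho>" using xb by simp
        let ?X = "(x, T (Suc k))"
        have XQ: "?X \<in> cylinder Y r" "?X \<in> Q" using Tin[OF x kN] sub by auto
        have Tstep: "T (Suc k) = T k + \<tau>" by (simp add: T_def algebra_simps)
        have "\<delta> k x \<le> v (Suc k) x - v k x"
          using dpos runmax_ge[of k k "\<lambda>j. v j x" 0] by (auto simp: \<delta>_def max_def split: if_splits)
        also have "\<dots> = u ?X - u (x, T k) + M1 * \<tau> / \<rho>\<^sup>2"
          using \<rho> by (simp add: v_def w_def barrier_def Tstep field_simps)
        also have "u ?X - u (x, T k) \<le> \<tau> * (dt u ?X + M1 / \<rho>\<^sup>2)"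
        proof -
          have ders: "((\<lambda>t. u (x, t)) has_real_derivative dt u (x, t)) (at t)"
            if "T k \<le> t" "t \<le> T (Suc k)" for t
            using that Tle[of k] Tle[OF kN] k by (intro cylinder_dt[OF u] inside[OF x]) auto
          obtain z where z: "T k < z" "z < T (Suc k)"
              "u ?X - u (x, T k) = (T (Suc k) - T k) * dt u (x, z)"
            using MVT2[of "T k" "T (Suc k)" "\<lambda>t. u (x, t)" "\<lambda>t. dt u (x, t)"] ders \<tau>(1) Tstep by auto
          have "dist (dt u (x, z)) (dt u ?X) < M1 / \<rho>\<^sup>2"
          proof (rule d1(2))
            show "?X \<in> D" "(x, z) \<in> D"
              using z Tle[OF kN] Tle[of k] k x by (auto simp: D_def)
            show "dist (x, z) ?X < d1"
              using z Tstep \<tau>(4) by (simp add: dist_Pair_Pair dist_real_def)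
          qed
          then have "dt u (x, z) \<le> dt u ?X + M1 / \<rho>\<^sup>2" by (simp add: dist_real_def abs_if split: if_splits)
          then show ?thesis using z(3) Tstep \<tau>(1) by (simp add: mult_left_mono)
        qed
        finally have "\<delta> k x \<le> \<tau> * (dt u ?X + c)"
          using \<tau>(1) by (simp add: c_def field_simps)
        then have 1: "\<delta> k x / \<tau> \<le> dt u ?X + c"
          using \<tau>(1) by (simp add: field_simps)
        have 2: "dt u ?X + trace (- H (Suc k) x) / \<nu> \<le> b ?X \<bullet> gradx u ?X + CARD('n) * \<nu> * c"
          unfolding H_def
          by (rule trace_bound_at_contact[OF \<nu> _ ell[OF XQ(2)] bdd[OF XQ(2)] pde[OF XQ(1)]])
            (use symH[OF kN x] nf M1 \<rho> in \<open>auto simp: H_def c_def\<close>)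
        have "b ?X \<bullet> gradx u ?X \<le> norm (b ?X) * norm (gradx u ?X)" by (rule norm_cauchy_schwarz)
        also have "\<dots> \<le> B x * (norm (G (Suc k) x) + \<gamma> * (norm (x - x0) / \<rho>))"
        proof (rule mult_mono)
          show "norm (b ?X) \<le> B x" using bB XQ(2) by blast
          have "gradx u ?X = G (Suc k) x + c *\<^sub>R (x - x0)" by (simp add: G_def)
          then have "norm (gradx u ?X) \<le> norm (G (Suc k) x) + norm (c *\<^sub>R (x - x0))"
            by (metis norm_triangle_ineq)
          also have "norm (c *\<^sub>R (x - x0)) = \<gamma> * (norm (x - x0) / \<rho>)"
            using M1 \<rho> by (simp add: c_def \<gamma>_def power2_eq_square)
          finally show "norm (gradx u ?X) \<le> norm (G (Suc k) x) + \<gamma> * (norm (x - x0) / \<rho>)" .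
        qed (use B(2) in auto)
        finally have 3: "b ?X \<bullet> gradx u ?X \<le> B x * (norm (G (Suc k) x) + \<gamma> * (norm (x - x0) / \<rho>))" .
        have "\<eta> = c + CARD('n) * \<nu> * c" by (simp add: \<eta>_def c_def add_divide_distrib distrib_left mult_ac)
        then show "\<delta> k x / \<tau> + trace (- H (Suc k) x) / \<nu> \<le> B x * (norm (G (Suc k) x) + \<gamma> * (norm (x - x0) / \<rho>)) + \<eta>"
          using 1 2 3 by linarith
      qed
    qed
  qed
  define C where "C = fact CARD('n) * (2 * \<nu>) ^ CARD('n)"
  define Z where "Z = 2 * \<eta> ^ Suc CARD('n) / \<kappa> ^ CARD('n)"
  have C0: "0 \<le> C" using \<nu> by (simp add: C_def)
  have Z0: "0 \<le> Z" using \<eta> \<kappa> by (simp add: Z_def)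
  have wm: "(\<lambda>x. norm (x - x0) / \<rho>) \<in> borel_measurable borel" by measurable
  have \<nu>0: "0 < \<nu>" using \<nu> by simp
  have w0: "0 \<le> norm (x - x0) / \<rho>" for x using \<rho> by simp
  have bound': "v k x \<le> M" if "k \<le> N" "x \<in> cball x0 \<rho>" for k x
    unfolding M_def using bound[OF that] .
  have main: "ennreal (M / 2) * (\<integral>\<^sup>+p\<in>{p :: real ^ 'n. \<kappa> \<le> norm p \<and> norm p \<le> M / (4 * \<rho>)}. ennreal (1 / norm p ^ CARD('n)) \<partial>lborel)
    \<le> ennreal (C * 2 ^ CARD('n) * M) *
        ((\<integral>\<^sup>+x\<in>cball x0 \<rho>. ennreal (B x ^ CARD('n)) \<partial>lborel) +
          ennreal ((\<gamma> / \<kappa>) ^ CARD('n)) * (\<integral>\<^sup>+x\<in>cball x0 \<rho>. ennreal ((B x * (norm (x - x0) / \<rho>)) ^ CARD('n)) \<partial>lborel))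
      + ennreal (C * (2 * \<tau> * \<eta> ^ Suc CARD('n) / \<kappa> ^ CARD('n))) *
        (\<Sum>k<N. emeasure lborel {x \<in> ball x0 \<rho>. 0 < v (Suc k) x})"
    unfolding C_def
    by (rule discrete_maximum_principle[OF \<rho> \<tau>(1) M0 \<kappa> \<nu>0 \<gamma> \<eta> grad hess symH contH init lateral bound' top M_def[symmetric]
          eqn[unfolded \<delta>_def] B(1) wm B(2) w0])
  have "ennreal (M / 2 * (real m * unit_ball_vol CARD('n) / 2)) =
      ennreal (M / 2) * ennreal (real m * unit_ball_vol CARD('n) / 2)"
    using M0 by (intro ennreal_mult) auto
  also have "\<dots> \<le> ennreal (M / 2) * (\<integral>\<^sup>+p\<in>{p :: real ^ 'n. \<kappa> \<le> norm p \<and> norm p \<le> M / (4 * \<rho>)}. ennreal (1 / norm p ^ CARD('n)) \<partial>lborel)"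
    using annulus_integral_ge[OF \<kappa>, of m] by (intro mult_left_mono) (simp_all add: \<kappa>_def)
  also note main
  finally have est: "ennreal (M / 2 * (real m * unit_ball_vol CARD('n) / 2)) \<le>
      ennreal (C * 2 ^ CARD('n) * M) *
        ((\<integral>\<^sup>+x\<in>cball x0 \<rho>. ennreal (B x ^ CARD('n)) \<partial>lborel) +
          ennreal ((\<gamma> / \<kappa>) ^ CARD('n)) * (\<integral>\<^sup>+x\<in>cball x0 \<rho>. ennreal ((B x * (norm (x - x0) / \<rho>)) ^ CARD('n)) \<partial>lborel))
      + ennreal (C * (2 * \<tau> * \<eta> ^ Suc CARD('n) / \<kappa> ^ CARD('n))) *
        (\<Sum>k<N. emeasure lborel {x \<in> ball x0 \<rho>. 0 < v (Suc k) x})" .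
  have b1: "(\<integral>\<^sup>+x\<in>cball x0 \<rho>. ennreal (B x ^ CARD('n)) \<partial>lborel) \<le> ennreal S"
  proof -
    have "(\<integral>\<^sup>+x\<in>cball x0 \<rho>. ennreal (B x ^ CARD('n)) \<partial>lborel) \<le> (\<integral>\<^sup>+x. ennreal (B x ^ CARD('n)) \<partial>lborel)"
      by (intro nn_integral_mono) (auto simp: indicator_def)
    with B(3) show ?thesis by simp
  qed
  have b2: "(\<integral>\<^sup>+x\<in>cball x0 \<rho>. ennreal ((B x * (norm (x - x0) / \<rho>)) ^ CARD('n)) \<partial>lborel) \<le> ennreal (2 * S / K)"
    using iS unfolding \<rho>_def .
  have b3: "ennreal (C * (2 * \<tau> * \<eta> ^ Suc CARD('n) / \<kappa> ^ CARD('n))) *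
      (\<Sum>k<N. emeasure lborel {x \<in> ball x0 \<rho>. 0 < v (Suc k) x}) \<le> ennreal (C * Z * (2 * (\<mu> * V)))"
  proof -
    have "(\<Sum>k<N. emeasure lborel {x \<in> ball x0 \<rho>. 0 < v (Suc k) x})
        \<le> (\<Sum>k<N. emeasure lborel {x. (x, \<theta> + real (Suc k) * \<tau>) \<in> E})"
    proof (rule sum_mono)
      fix k assume "k \<in> {..<N}"
      then have kN: "Suc k \<le> N" by simp
      have "open ((\<lambda>x. (x, T (Suc k))) -` E)"
        by (rule open_vimage[OF Eopen]) (intro continuous_intros)
      then have "{x. (x, T (Suc k)) \<in> E} \<in> sets lborel" by (simp add: vimage_def)
      moreover have "{x \<in> ball x0 \<rho>. 0 < v (Suc k) x} \<subseteq> {x. (x, T (Suc k)) \<in> E}"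
      proof safe
        fix x assume x: "x \<in> ball x0 \<rho>" and vx: "0 < v (Suc k) x"
        have "0 \<le> barrier M1 \<rho> x0 t0 (x, T (Suc k))"
          unfolding barrier_def using M1 Tle(1)[OF kN] by (intro divide_nonneg_nonneg mult_nonneg_nonneg add_nonneg_nonneg) auto
        then show "(x, T (Suc k)) \<in> E"
          using vx Tin[of x, OF _ kN] x by (auto simp: E_def v_def w_def)
      qed
      ultimately show "emeasure lborel {x \<in> ball x0 \<rho>. 0 < v (Suc k) x}
          \<le> emeasure lborel {x. (x, \<theta> + real (Suc k) * \<tau>) \<in> E}"
        unfolding T_def by (intro emeasure_mono)
    qed
    then have "ennreal \<tau> * (\<Sum>k<N. emeasure lborel {x \<in> ball x0 \<rho>. 0 < v (Suc k) x}) \<le> ennreal (2 * (\<mu> * V))"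
      using \<theta>E by (meson mult_left_mono order_trans zero_le)
    then have "ennreal (C * Z) * (ennreal \<tau> * (\<Sum>k<N. emeasure lborel {x \<in> ball x0 \<rho>. 0 < v (Suc k) x}))
        \<le> ennreal (C * Z) * ennreal (2 * (\<mu> * V))"
      by (intro mult_left_mono) auto
    also have "\<dots> = ennreal (C * Z * (2 * (\<mu> * V)))"
      using C0 Z0 \<mu> V by (intro ennreal_mult[symmetric]) auto
    also have "ennreal (C * Z) * (ennreal \<tau> * (\<Sum>k<N. emeasure lborel {x \<in> ball x0 \<rho>. 0 < v (Suc k) x}))
       = ennreal (C * (2 * \<tau> * \<eta> ^ Suc CARD('n) / \<kappa> ^ CARD('n))) * (\<Sum>k<N. emeasure lborel {x \<in> ball x0 \<rho>. 0 < v (Suc k) x})"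
    proof -
      have "ennreal (C * Z) * ennreal \<tau> = ennreal (C * (2 * \<tau> * \<eta> ^ Suc CARD('n) / \<kappa> ^ CARD('n)))"
      proof -
        have "0 \<le> C * Z" using C0 Z0 by simp
        then have "ennreal (C * Z) * ennreal \<tau> = ennreal (C * Z * \<tau>)"
          using \<tau>(1) by (intro ennreal_mult[symmetric]) auto
        also have "C * Z * \<tau> = C * (2 * \<tau> * \<eta> ^ Suc CARD('n) / \<kappa> ^ CARD('n))"
          by (simp add: Z_def mult_ac)
        finally show ?thesis .
      qed
      then show ?thesis by (simp only: mult.assoc[symmetric])
    qed
    finally show ?thesis .
  qed
  have "ennreal (M / 2 * (real m * unit_ball_vol CARD('n) / 2)) \<le>
      ennreal (C * 2 ^ CARD('n) * M) * (ennreal S + ennreal ((\<gamma> / \<kappa>) ^ CARD('n)) * ennreal (2 * S / K)) +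
      ennreal (C * Z * (2 * (\<mu> * V)))"
    by (rule order_trans[OF est], intro add_mono mult_left_mono b1 b2 b3) auto
  also have "\<dots> = ennreal (C * 2 ^ CARD('n) * M * (S + (\<gamma> / \<kappa>) ^ CARD('n) * (2 * S / K)) + C * Z * (2 * (\<mu> * V)))"
  proof -
    define s where "s = (\<gamma> / \<kappa>) ^ CARD('n) * (2 * S / K)"
    have s: "0 \<le> s" using S \<gamma> \<kappa> by (simp add: s_def)
    have "ennreal ((\<gamma> / \<kappa>) ^ CARD('n)) * ennreal (2 * S / K) = ennreal s"
      unfolding s_def using S \<gamma> \<kappa> by (intro ennreal_mult[symmetric]) auto
    moreover have "ennreal S + ennreal s = ennreal (S + s)"
      using S s by (intro ennreal_plus[symmetric])
    moreover have "ennreal (C * 2 ^ CARD('n) * M) * ennreal (S + s) = ennreal (C * 2 ^ CARD('n) * M * (S + s))"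
      using C0 M0 S s by (intro ennreal_mult[symmetric]) auto
    moreover have "ennreal (C * 2 ^ CARD('n) * M * (S + s)) + ennreal (C * Z * (2 * (\<mu> * V))) =
        ennreal (C * 2 ^ CARD('n) * M * (S + s) + C * Z * (2 * (\<mu> * V)))"
      using C0 M0 S s Z0 \<mu> V by (intro ennreal_plus[symmetric]) auto
    ultimately show ?thesis unfolding s_def by simp
  qed
  finally have "M / 2 * (real m * unit_ball_vol CARD('n) / 2) \<le>
      C * 2 ^ CARD('n) * M * (S + (\<gamma> / \<kappa>) ^ CARD('n) * (2 * S / K)) + C * Z * (2 * (\<mu> * V))"
    using C0 Z0 M0 S \<gamma> \<kappa> \<mu> V by (subst (asm) ennreal_le_iff) auto
  then show ?thesis
    by (intro that[OF i M \<rho>_def \<kappa>_def \<gamma>_def \<eta>_def]) (simp add: C_def Z_def V_def)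
qed

section \<open>Choice of the constants\<close>

text \<open>First m is taken large against S, then the number K of scales large against m, and finally
  \<open>\<mu>\<close> small against both. Then the maximum M cannot be as large as half of \<open>\<beta> M1\<close>.\<close>

lemma smallness_contradiction:
  fixes n m i K :: nat and r \<beta> M1 M C S \<omega> \<mu> E \<rho> \<kappa> \<gamma> \<eta> :: real
  assumes r: "0 < r" and \<beta>: "0 < \<beta>" and M1: "0 < M1" and M: "\<beta> * M1 \<le> 2 * M"
    and C: "0 \<le> C" and S: "0 \<le> S" and \<omega>: "0 < \<omega>" and \<mu>: "0 < \<mu>" and E: "0 < E"
    and def: "\<rho> = r / 2 ^ i" "\<kappa> = M / (4 * \<rho>) / 2 ^ m" "\<gamma> = 2 * M1 / \<rho>" "\<eta> = M1 * E / \<rho>\<^sup>2"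
    and i: "i \<le> K"
    and m: "C * 2 ^ n * S + 3 \<le> real m * \<omega> / 4"
    and K: "C * 2 ^ n * ((16 * 2 ^ m / \<beta>) ^ n * (2 * S / K)) \<le> 1"
    and small: "C * (4 * (E * (2 / \<beta>) * (4 * 2 ^ m * E * (2 / \<beta>)) ^ n * (2 ^ K) ^ (n + 2))) * (\<mu> * \<omega>) \<le> 1"
    and est: "M / 2 * (real m * \<omega> / 2) \<le>
      C * 2 ^ n * M * (S + (\<gamma> / \<kappa>) ^ n * (2 * S / K)) + C * (2 * \<eta> ^ Suc n / \<kappa> ^ n) * (2 * (\<mu> * (\<omega> * r ^ (n + 2))))"
  shows False
proof -
  have "0 < \<beta> * M1" using \<beta> M1 by simp
  then have M0: "0 < M" using M by linarith
  define q where "q = M1 / M"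
  have q: "0 < q" "q \<le> 2 / \<beta>"
    using M M0 M1 \<beta> by (auto simp: q_def field_simps)
  have M1q: "M1 = q * M" using M0 by (simp add: q_def)
  have \<rho>: "0 < \<rho>" using r def(1) by simp
  have \<kappa>: "0 < \<kappa>" using M0 \<rho> def(2) by simp
  have rq: "r = 2 ^ i * \<rho>" by (simp add: def(1))
  have g1: "\<gamma> / \<kappa> = 8 * 2 ^ m * q"
    using M0 \<rho> by (simp add: def(2,3) M1q field_simps)
  have g2: "\<eta> / \<kappa> = 4 * 2 ^ m * E * q / \<rho>"
    using M0 \<rho> by (simp add: def(2,4) M1q field_simps power2_eq_square)
  have A: "(\<gamma> / \<kappa>) ^ n \<le> (16 * 2 ^ m / \<beta>) ^ n"
  proof (rule power_mono)
    have "8 * 2 ^ m * q \<le> 8 * 2 ^ m * (2 / \<beta>)" using q by (intro mult_left_mono) auto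
    then show "\<gamma> / \<kappa> \<le> 16 * 2 ^ m / \<beta>" by (simp add: g1)
    show "0 \<le> \<gamma> / \<kappa>" using q by (simp add: g1)
  qed
  have "C * 2 ^ n * ((\<gamma> / \<kappa>) ^ n * (2 * S / K)) \<le> C * 2 ^ n * ((16 * 2 ^ m / \<beta>) ^ n * (2 * S / K))"
    using A C S by (intro mult_left_mono mult_right_mono) auto
  then have B: "C * 2 ^ n * ((\<gamma> / \<kappa>) ^ n * (2 * S / K)) \<le> 1" using K by linarith
  have "\<eta> ^ Suc n / \<kappa> ^ n * r ^ (n + 2) = \<eta> * (\<eta> / \<kappa>) ^ n * ((2 ^ i) ^ (n + 2) * (\<rho> ^ n * \<rho>\<^sup>2))"
    by (simp add: rq power_mult_distrib power_divide power_add power2_eq_square)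
  also have "\<dots> = (\<eta> * \<rho>\<^sup>2) * ((\<eta> / \<kappa>) * \<rho>) ^ n * (2 ^ i) ^ (n + 2)"
    by (simp only: power_mult_distrib mult_ac)
  also have "\<eta> * \<rho>\<^sup>2 = M * (E * q)" using \<rho> by (simp add: def(4) M1q)
  also have "(\<eta> / \<kappa>) * \<rho> = 4 * 2 ^ m * E * q" using \<rho> by (simp add: g2)
  finally have D: "\<eta> ^ Suc n / \<kappa> ^ n * r ^ (n + 2) = M * (E * q * (4 * 2 ^ m * E * q) ^ n * (2 ^ i) ^ (n + 2))"
    by (simp add: mult.assoc)
  have F: "E * q * (4 * 2 ^ m * E * q) ^ n * (2 ^ i) ^ (n + 2)
      \<le> E * (2 / \<beta>) * (4 * 2 ^ m * E * (2 / \<beta>)) ^ n * (2 ^ K) ^ (n + 2)"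
    using q E i \<beta> by (intro mult_mono power_mono mult_left_mono power_increasing mult_nonneg_nonneg) auto
  have "C * (4 * (E * q * (4 * 2 ^ m * E * q) ^ n * (2 ^ i) ^ (n + 2))) * (\<mu> * \<omega>) \<le>
      C * (4 * (E * (2 / \<beta>) * (4 * 2 ^ m * E * (2 / \<beta>)) ^ n * (2 ^ K) ^ (n + 2))) * (\<mu> * \<omega>)"
    using C \<mu> \<omega> by (intro mult_right_mono mult_left_mono F) auto
  with small have "C * (4 * (E * q * (4 * 2 ^ m * E * q) ^ n * (2 ^ i) ^ (n + 2))) * (\<mu> * \<omega>) \<le> 1"
    by linarith
  then have "M * (C * (4 * (E * q * (4 * 2 ^ m * E * q) ^ n * (2 ^ i) ^ (n + 2))) * (\<mu> * \<omega>)) \<le> M * 1"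
    using M0 by (intro mult_left_mono) auto
  moreover have "C * (2 * \<eta> ^ Suc n / \<kappa> ^ n) * (2 * (\<mu> * (\<omega> * r ^ (n + 2))))
      = C * 4 * (\<eta> ^ Suc n / \<kappa> ^ n * r ^ (n + 2)) * (\<mu> * \<omega>)"
    by (simp add: mult_ac)
  ultimately have G: "C * (2 * \<eta> ^ Suc n / \<kappa> ^ n) * (2 * (\<mu> * (\<omega> * r ^ (n + 2)))) \<le> M"
    unfolding D by (simp add: mult_ac)
  define x where "x = M * (C * 2 ^ n * S)"
  define y where "y = M * (C * 2 ^ n * ((\<gamma> / \<kappa>) ^ n * (2 * S / K)))"
  define z where "z = M * (real m * \<omega> / 4)"
  have "C * 2 ^ n * M * (S + (\<gamma> / \<kappa>) ^ n * (2 * S / K)) = x + y"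
    by (simp add: x_def y_def algebra_simps)
  moreover have "M / 2 * (real m * \<omega> / 2) = z" by (simp add: z_def)
  ultimately have "z \<le> x + y + M" using est G by linarith
  moreover have "y \<le> M * 1" unfolding y_def using B M0 by (intro mult_left_mono) auto
  moreover have "M * (C * 2 ^ n * S + 3) \<le> z" unfolding z_def using m M0 by (intro mult_left_mono) auto
  then have "x + 3 * M \<le> z" by (simp add: x_def distrib_left)
  ultimately show False using M0 by linarith
qed

lemma growth_estimate:
  fixes \<nu> S \<beta> :: real
  assumes \<nu>: "1 \<le> \<nu>" and S: "0 \<le> S" and \<beta>: "0 < \<beta>"
  shows "\<exists>\<mu>\<in>{0<..<1}. \<forall>(Q :: ((real ^ 'n) \<times> real) set) a b Y r u.
    open Q \<and> admissible_coeffs \<nu> S Q a b \<and>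
    0 < r \<and> cylinder Y r \<subseteq> Q \<and> C21_closure (cylinder Y r) u \<and>
    (\<forall>X\<in>cylinder Y r. - dt u X + elliptic_op a b u X \<ge> 0) \<and>
    measure lebesgue ({X. u X > 0} \<inter> cylinder Y r) \<le> \<mu> * measure lebesgue (cylinder Y r)
    \<longrightarrow> sup_pos u Y (r / 2) \<le> \<beta> * sup_pos u Y r"
proof -
  define n where "n = CARD('n)"
  define \<omega> where "\<omega> = unit_ball_vol (real n)"
  define C where "C = fact n * (2 * \<nu>) ^ n"
  define E where "E = 2 + 2 * n * \<nu>"
  have \<omega>: "0 < \<omega>" by (simp add: \<omega>_def)
  have C: "0 \<le> C" using \<nu> by (simp add: C_def)
  have E: "0 < E" using \<nu> by (simp add: E_def add_pos_nonneg)
  obtain m :: nat where m: "4 * (C * 2 ^ n * S + 3) / \<omega> < m" using reals_Archimedean2 by blast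
  then have m: "C * 2 ^ n * S + 3 \<le> real m * \<omega> / 4"
    using \<omega> by (simp add: pos_divide_less_eq)
  define g where "g = (16 * 2 ^ m / \<beta>) ^ n"
  have g: "0 \<le> g" using \<beta> by (simp add: g_def)
  obtain K :: nat where K: "C * 2 ^ n * (g * (2 * S)) + 1 < K" using reals_Archimedean2 by blast
  have "0 \<le> C * 2 ^ n * (g * (2 * S))" using C g S by simp
  then have K1: "1 \<le> K" using K by linarith
  have K2: "C * 2 ^ n * (g * (2 * S / K)) \<le> 1"
    using K K1 by (simp add: field_simps)
  define L where "L = C * (4 * (E * (2 / \<beta>) * (4 * 2 ^ m * E * (2 / \<beta>)) ^ n * (2 ^ K) ^ (n + 2))) * \<omega>"
  have L: "0 \<le> L" using C E \<beta> \<omega> by (simp add: L_def)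
  define \<mu> where "\<mu> = 1 / (2 + L)"
  have \<mu>: "0 < \<mu>" "\<mu> < 1" using L by (auto simp: \<mu>_def)
  have "L * \<mu> \<le> 1" using L by (simp add: \<mu>_def)
  then have small: "C * (4 * (E * (2 / \<beta>) * (4 * 2 ^ m * E * (2 / \<beta>)) ^ n * (2 ^ K) ^ (n + 2))) * (\<mu> * \<omega>) \<le> 1"
    by (simp add: L_def mult_ac)
  have "sup_pos u Y (r / 2) \<le> \<beta> * sup_pos u Y r"
    if Q: "open Q" and adm: "admissible_coeffs \<nu> S Q a b"
      and r: "0 < r" and sub: "cylinder Y r \<subseteq> Q" and u: "C21_closure (cylinder Y r) u"
      and pde: "\<forall>X\<in>cylinder Y r. - dt u X + elliptic_op a b u X \<ge> 0"
      and meas: "measure lebesgue ({X. u X > 0} \<inter> cylinder Y r) \<le> \<mu> * measure lebesgue (cylinder Y r)"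
    for Q :: "((real ^ 'n) \<times> real) set" and a b Y r u
  proof -
    define M1 where "M1 = sup_pos u Y r"
    have M1: "u X \<le> M1" "0 \<le> M1" if "X \<in> cylinder Y r" for X
      using sup_pos_upper[OF u that] by (auto simp: M1_def)
    have M1_0: "0 \<le> M1" using M1(2) cylinder_nonempty[OF r, of Y] by blast
    have "u X \<le> \<beta> * M1" if X: "X \<in> cylinder Y (r / 2)" for X
    proof (rule ccontr)
      assume "\<not> ?thesis"
      then have big: "\<beta> * M1 < u X" by simp
      obtain x0 t0 where Xe: "X = (x0, t0)" by (cases X)
      have "r\<^sup>2 / 4 \<le> r\<^sup>2" by simp
      then have "X \<in> cylinder Y r"
        using X r unfolding Xe by (auto simp: mem_cylinder power_divide)
      then have "u X \<le> M1" by (rule M1(1))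
      moreover have "0 \<le> \<beta> * M1" using \<beta> M1_0 by simp
      ultimately have M1p: "0 < M1" and pos: "0 < u (x0, t0)" using big Xe by auto
      have pde': "\<And>X. X \<in> cylinder Y r \<Longrightarrow> 0 \<le> - dt u X + elliptic_op a b u X" using pde by blast
      obtain i M \<rho> \<kappa> \<gamma> \<eta> where e: "1 \<le> i" "i \<le> K" "u (x0, t0) / 2 \<le> M"
        "\<rho> = r / 2 ^ i" "\<kappa> = M / (4 * \<rho>) / 2 ^ m" "\<gamma> = 2 * M1 / \<rho>"
        "\<eta> = M1 * (2 + 2 * CARD('n) * \<nu>) / \<rho>\<^sup>2"
        "M / 2 * (real m * unit_ball_vol CARD('n) / 2) \<le>
          fact CARD('n) * (2 * \<nu>) ^ CARD('n) * 2 ^ CARD('n) * M * (S + (\<gamma> / \<kappa>) ^ CARD('n) * (2 * S / K)) +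
          fact CARD('n) * (2 * \<nu>) ^ CARD('n) * (2 * \<eta> ^ Suc CARD('n) / \<kappa> ^ CARD('n)) *
            (2 * (\<mu> * (unit_ball_vol CARD('n) * r ^ (CARD('n) + 2))))"
        by (rule estimate_near_point[OF \<nu> S Q adm r sub u pde' meas \<mu>(1) M1p M1(1) X[unfolded Xe] pos K1, of m])
          (assumption | rule that)+
      show False
      proof (rule smallness_contradiction[OF r \<beta> M1p _ C S \<omega> \<mu>(1) E e(4,5,6) _ e(2) m K2[unfolded g_def] small])
        show "\<beta> * M1 \<le> 2 * M" using big e(3) unfolding Xe by linarith
        show "\<eta> = M1 * E / \<rho>\<^sup>2" using e(7) by (simp add: E_def n_def)
        show "M / 2 * (real m * \<omega> / 2) \<le>
          C * 2 ^ n * M * (S + (\<gamma> / \<kappa>) ^ n * (2 * S / K)) + C * (2 * \<eta> ^ Suc n / \<kappa> ^ n) * (2 * (\<mu> * (\<omega> * r ^ (n + 2))))"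
          using e(8) unfolding C_def \<omega>_def n_def .
      qed
    qed
    then show ?thesis
      unfolding M1_def[symmetric] using \<beta> M1_0 r by (intro sup_pos_le) auto
  qed
  then show ?thesis using \<mu> by (intro bexI[of _ \<mu>]) auto
qed

lemma sup_pos_nonneg:
  assumes "C21_closure (cylinder Y r) u" "0 < r"
  shows "0 \<le> sup_pos u Y r"
proof -
  obtain X where "X \<in> cylinder Y r" using cylinder_nonempty[OF assms(2), of Y] by blast
  from sup_pos_upper[OF assms(1) this] show ?thesis by simp
qed

lemma sup_pos_half_le:
  assumes "C21_closure (cylinder Y r) u" "0 < r"
  shows "sup_pos u Y (r / 2) \<le> sup_pos u Y r"
proof (rule sup_pos_le)
  fix X assume X: "X \<in> cylinder Y (r / 2)"
  obtain x t where Xe: "X = (x, t)" by (cases X)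
  have "r\<^sup>2 / 4 \<le> r\<^sup>2" by simp
  then have "X \<in> cylinder Y r"
    using X assms(2) unfolding Xe by (auto simp: mem_cylinder power_divide)
  from sup_pos_upper[OF assms(1) this] show "u X \<le> sup_pos u Y r" by simp
qed (use assms(2) sup_pos_nonneg[OF assms] in auto)

text \<open>By monotonicity the best constant, the infimum of the admissible ones, tends to 0 with \<open>\<mu>\<close>. The
  summand \<open>\<mu>\<close> keeps the constant positive and above the infimum, which need not be attained.\<close>

lemma vanishing_constant:
  fixes P :: "real \<Rightarrow> real \<Rightarrow> bool"
  assumes ex: "\<And>\<beta>. 0 < \<beta> \<Longrightarrow> \<exists>\<mu>\<in>{0<..<1}. P \<mu> \<beta>"
    and mono: "\<And>\<mu> \<mu>' \<beta> \<beta>'. P \<mu> \<beta> \<Longrightarrow> \<mu>' \<le> \<mu> \<Longrightarrow> \<beta> \<le> \<beta>' \<Longrightarrow> P \<mu>' \<beta>'"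
    and one: "\<And>\<mu>. P \<mu> 1"
  shows "\<exists>\<beta>\<^sub>1 :: real \<Rightarrow> real. filterlim \<beta>\<^sub>1 (at_right 0) (at_right 0) \<and> (\<forall>\<mu>\<in>{0<..<1}. P \<mu> (\<beta>\<^sub>1 \<mu>))"
proof -
  define A where "A = (\<lambda>\<mu>. {\<beta>. 0 < \<beta> \<and> P \<mu> \<beta>})"
  define \<beta>1 where "\<beta>1 = (\<lambda>\<mu>. Inf (A \<mu>) + \<mu>)"
  have ne: "A \<mu> \<noteq> {}" for \<mu> using one by (auto simp: A_def intro: exI[of _ 1])
  have bdd: "bdd_below (A \<mu>)" for \<mu> by (intro bdd_belowI[of _ 0]) (auto simp: A_def)
  have Inf0: "0 \<le> Inf (A \<mu>)" for \<mu> using ne by (intro cInf_greatest) (auto simp: A_def)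
  have holds: "P \<mu> (\<beta>1 \<mu>)" if "0 < \<mu>" for \<mu>
  proof -
    have "Inf (A \<mu>) < \<beta>1 \<mu>" using that by (simp add: \<beta>1_def)
    then obtain \<beta> where "\<beta> \<in> A \<mu>" "\<beta> < \<beta>1 \<mu>" using cInf_lessD[OF ne] by blast
    then show ?thesis using mono[of \<mu> \<beta> \<mu> "\<beta>1 \<mu>"] by (auto simp: A_def)
  qed
  have lim: "(\<beta>1 \<longlongrightarrow> 0) (at_right 0)"
  proof (rule tendstoI)
    fix e :: real
    assume e: "0 < e"
    then obtain \<mu> where \<mu>: "0 < \<mu>" "P \<mu> (e / 2)" using ex[of "e / 2"] by auto
    have "\<forall>\<^sub>F \<mu>' in at_right 0. 0 < \<mu>' \<and> \<mu>' < min \<mu> (e / 2)"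
      using e \<mu> eventually_at_right_less[of 0] eventually_at_right_field[of _ 0]
      by (auto intro!: exI[of _ "min \<mu> (e / 2)"] simp: eventually_at_right_field)
    then show "\<forall>\<^sub>F \<mu>' in at_right 0. dist (\<beta>1 \<mu>') 0 < e"
    proof eventually_elim
      case (elim \<mu>')
      then have "P \<mu>' (e / 2)" using mono[OF \<mu>(2), of \<mu>' "e / 2"] by simp
      then have "Inf (A \<mu>') \<le> e / 2" using e by (intro cInf_lower bdd) (simp add: A_def)
      then show ?case using elim Inf0[of \<mu>'] by (simp add: \<beta>1_def)
    qed
  qed
  have "\<forall>\<^sub>F \<mu> in at_right (0::real). 0 < \<mu>" by (rule eventually_at_right_less)
  then have pos: "\<forall>\<^sub>F \<mu> in at_right 0. \<beta>1 \<mu> \<in> {0<..} \<and> \<beta>1 \<mu> \<noteq> 0"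
  proof eventually_elim
    case (elim \<mu>)
    then show ?case using Inf0[of \<mu>] by (simp add: \<beta>1_def)
  qed
  have "filterlim \<beta>1 (at_right 0) (at_right 0)"
    unfolding filterlim_at using lim pos by (auto elim: eventually_mono)
  then show ?thesis using holds by (intro exI[of _ \<beta>1]) auto
qed

theorem theorem12:
  fixes \<nu> S :: real
  assumes "1 \<le> \<nu>" and "0 \<le> S"
  shows "(\<forall>\<beta>\<^sub>1\<in>{0<..<1}. \<exists>\<mu>\<in>{0<..<1}.
           \<forall>(Q :: ((real ^ 'n) \<times> real) set) a b Y r u.
             open Q \<and> admissible_coeffs \<nu> S Q a b \<and>
             0 < r \<and> cylinder Y r \<subseteq> Q \<and> C21_closure (cylinder Y r) u \<and>
             (\<forall>X\<in>cylinder Y r. - dt u X + elliptic_op a b u X \<ge> 0) \<and>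
             measure lebesgue ({X. u X > 0} \<inter> cylinder Y r) \<le> \<mu> * measure lebesgue (cylinder Y r)
             \<longrightarrow> sup_pos u Y (r / 2) \<le> \<beta>\<^sub>1 * sup_pos u Y r) \<and>
         (\<exists>\<beta>\<^sub>1 :: real \<Rightarrow> real. filterlim \<beta>\<^sub>1 (at_right 0) (at_right 0) \<and>
           (\<forall>\<mu>\<in>{0<..<1}.
             \<forall>(Q :: ((real ^ 'n) \<times> real) set) a b Y r u.
               open Q \<and> admissible_coeffs \<nu> S Q a b \<and>
               0 < r \<and> cylinder Y r \<subseteq> Q \<and> C21_closure (cylinder Y r) u \<and>
               (\<forall>X\<in>cylinder Y r. - dt u X + elliptic_op a b u X \<ge> 0) \<and>
               measure lebesgue ({X. u X > 0} \<inter> cylinder Y r) \<le> \<mu> * measure lebesgue (cylinder Y r)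
               \<longrightarrow> sup_pos u Y (r / 2) \<le> \<beta>\<^sub>1 \<mu> * sup_pos u Y r))"
proof -
  define P where "P = (\<lambda>\<mu> \<beta>. \<forall>(Q :: ((real ^ 'n) \<times> real) set) a b Y r u.
    open Q \<and> admissible_coeffs \<nu> S Q a b \<and>
    0 < r \<and> cylinder Y r \<subseteq> Q \<and> C21_closure (cylinder Y r) u \<and>
    (\<forall>X\<in>cylinder Y r. - dt u X + elliptic_op a b u X \<ge> 0) \<and>
    measure lebesgue ({X. u X > 0} \<inter> cylinder Y r) \<le> \<mu> * measure lebesgue (cylinder Y r)
    \<longrightarrow> sup_pos u Y (r / 2) \<le> \<beta> * sup_pos u Y r)"
  have ex: "\<exists>\<mu>\<in>{0<..<1}. P \<mu> \<beta>" if "0 < \<beta>" for \<beta>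
    unfolding P_def by (rule growth_estimate[OF assms that])
  have mono: "P \<mu>' \<beta>'" if P: "P \<mu> \<beta>" and le: "\<mu>' \<le> \<mu>" "\<beta> \<le> \<beta>'" for \<mu> \<mu>' \<beta> \<beta>'
    unfolding P_def
  proof (intro allI impI, elim conjE)
    fix Q :: "((real ^ 'n) \<times> real) set" and a b Y r u
    assume h: "open Q" "admissible_coeffs \<nu> S Q a b" "0 < r" "cylinder Y r \<subseteq> Q" "C21_closure (cylinder Y r) u"
      "\<forall>X\<in>cylinder Y r. - dt u X + elliptic_op a b u X \<ge> 0"
      and meas: "measure lebesgue ({X. u X > 0} \<inter> cylinder Y r) \<le> \<mu>' * measure lebesgue (cylinder Y r)"
    have "\<mu>' * measure lebesgue (cylinder Y r) \<le> \<mu> * measure lebesgue (cylinder Y r)"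
      using le(1) by (intro mult_right_mono) auto
    then have "measure lebesgue ({X. u X > 0} \<inter> cylinder Y r) \<le> \<mu> * measure lebesgue (cylinder Y r)"
      using meas by linarith
    with P h have "sup_pos u Y (r / 2) \<le> \<beta> * sup_pos u Y r"
      unfolding P_def by blast
    also have "\<dots> \<le> \<beta>' * sup_pos u Y r"
      using le(2) sup_pos_nonneg[OF h(5,3)] by (intro mult_right_mono) auto
    finally show "sup_pos u Y (r / 2) \<le> \<beta>' * sup_pos u Y r" .
  qed
  have one: "P \<mu> 1" for \<mu>
    unfolding P_def using sup_pos_half_le by auto
  have "\<forall>\<beta>\<^sub>1\<in>{0<..<1}. \<exists>\<mu>\<in>{0<..<1}. P \<mu> \<beta>\<^sub>1" using ex by auto
  moreover have "\<exists>\<beta>\<^sub>1 :: real \<Rightarrow> real. filterlim \<beta>\<^sub>1 (at_right 0) (at_right 0) \<and> (\<forall>\<mu>\<in>{0<..<1}. P \<mu> (\<beta>\<^sub>1 \<mu>))"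
    by (rule vanishing_constant[where P=P, OF ex mono one])
  ultimately show ?thesis unfolding P_def by (rule conjI)
qed

end
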